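(* Let $m,n\geq1$ and $r\geq0$ be integers, and let $(K,\partial_1,\dots,\partial_m)$ be a differential field of characteristic zero with $m$ commuting derivations. Suppose $V\subseteq\mathbb A^n$ is a differential algebraic variety defined by differential polynomials over $K$ of order at most $r$. If $W$ is a $K$-irreducible component of $V$ of finite order, then $$\operatorname{ord}(W)\leq n\cdot(C_{r,m}^n)^m.$$
   Context: Differential varieties. $x=(x_1,\dots,x_n)$ are differential indeterminates and $K\{x\}$ is the differential polynomial ring. A differential algebraic variety over $K$ is the set of common zeros (in a universal differential field extension of $K$) of a collection of differential polynomials over $K$. For such $V$, $\mathcal I(V)=\{f\in K\{x\}:f(V)=0\}$ and $K\{V\}=K\{x\}/\mathcal I(V)$; if $V$ is $K$-irreducible, $K\langle V\rangle=\operatorname{Frac}(K\{V\})$ and the order of $V$ is $\operatorname{ord}(V)=\operatorname{trdeg}_K K\langle V\rangle$. The number $C_{r,m}^n$. $\mathbb N=\{0,1,2,\dots\}$, $\mathfrak n=\{1,\dots,n\}$. For $\xi=(u_1,\dots,u_m)\in\mathbb N^m$, $\deg\xi=u_1+\cdots+u_m$; $\deg(\xi,i)=\deg\xi$ for $(\xi,i)\in\mathbb N^m\times\mathfrak n$. $\Gamma(r)=\{\alpha\in\mathbb N^m\times\mathfrak n:\deg\alpha\leq r\}$. ${\bf k}\in\mathbb N^m$ is the tuple with $1$ in the $k$-th entry and zeros elsewhere. $(\xi,i)\leq(\tau,j)$ iff $i=j$ and $\xi\leq\tau$ in the product order of $\mathbb N^m$. An antichain sequence of $\mathbb N^m\times\mathfrak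 n$ is a finite sequence of pairwise $\leq$-incomparable elements. $\mathrm{LUB}(\eta,\tau)$ is the entrywise maximum of $\eta,\tau\in\mathbb N^m$. For an antichain (sequence) $\bar\alpha$, $\gamma(\bar\alpha)=\{(\mathrm{LUB}(\eta,\tau),i):\eta\neq\tau,\ (\eta,i),(\tau,i)\in\bar\alpha\text{ for some }i\}$ and $\Gamma_{\bar\alpha}(p)=\{\alpha\in\bar\alpha:\alpha\in\Gamma(p)\}$. $D_{r,\bar\alpha}$ is the smallest integer $p\geq r$ such that: for every $(\tau,l)\in\gamma(\Gamma_{\bar\alpha}(p))\setminus\Gamma(p)$ and $1\leq i<j\leq m$ such that $(\tau-{\bf i},l)\geq\beta_1$ and $(\tau-{\bf j},l)\geq\beta_2$ for some $\beta_1,\beta_2\in\Gamma_{\bar\alpha}(p)$, there exists a sequence $(\eta_1,l),\dots,(\eta_s,l)$ in $\Gamma_{\bar\alpha}(p)$ and indices $k_1,\dots,k_s\in\{1,\dots,m\}$ with $k_1=i$, $k_s=j$, $\eta_\ell\leq\tau-{\bf k}_\ell$ for all $\ell$ (where ${\bf k}_\ell$ has $1$ in entry $k_\ell$ and zeros elsewhere), and $\deg\mathrm{LUB}(\eta_\ell,\eta_{\ell+1})\leq p$ for $\ell=1,\dots,s-1$. Then $C_{r,m}^n=\max\{D_{r,\bar\alpha}:\bar\alpha\text{ an antichain sequence of }\mathbb N^m\times\mathfrak n\}$ (this maximum is finite). *)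

theory Defs
  imports
    "HOL-Algebra.Algebra"
    "HOL-Algebra.Algebraic_Closure_Type"
    "HOL-Library.Poly_Mapping"
    "HOL-Library.Extended_Nat"
    "HOL-Library.FuncSet"
begin

section \<open>Differential fields\<close>

text \<open>Derivations are indexed by \<open>1, \<dots>, m\<close>; the values of \<open>D\<close> at other indices are irrelevant.\<close>

locale differential_field = field R for R (structure) +
  fixes m :: nat and D :: "nat \<Rightarrow> 'a \<Rightarrow> 'a"
  assumes D_closed: "\<lbrakk>k \<in> {1..m}; x \<in> carrier R\<rbrakk> \<Longrightarrow> D k x \<in> carrier R"
    and D_add: "\<lbrakk>k \<in> {1..m}; x \<in> carrier R; y \<in> carrier R\<rbrakk> \<Longrightarrow> D k (x \<oplus> y) = D k x \<oplus> D k y"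
    and D_mult: "\<lbrakk>k \<in> {1..m}; x \<in> carrier R; y \<in> carrier R\<rbrakk>
      \<Longrightarrow> D k (x \<otimes> y) = (D k x \<otimes> y) \<oplus> (x \<otimes> D k y)"
    and D_commute: "\<lbrakk>k \<in> {1..m}; l \<in> {1..m}; x \<in> carrier R\<rbrakk> \<Longrightarrow> D k (D l x) = D l (D k x)"

definition differential_hom ::
  "nat \<Rightarrow> ('a, 'c) ring_scheme \<Rightarrow> (nat \<Rightarrow> 'a \<Rightarrow> 'a) \<Rightarrow> ('b, 'd) ring_scheme \<Rightarrow> (nat \<Rightarrow> 'b \<Rightarrow> 'b)
    \<Rightarrow> ('a \<Rightarrow> 'b) \<Rightarrow> bool" where
  "differential_hom m R D S E h \<longleftrightarrow>
     h \<in> ring_hom R S \<and> (\<forall>k\<in>{1..m}. \<forall>x\<in>carrier R. h (D k x) = E k (h x))"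

definition diff_field_generated ::
  "('a, 'c) ring_scheme \<Rightarrow> nat \<Rightarrow> (nat \<Rightarrow> 'a \<Rightarrow> 'a) \<Rightarrow> 'a set \<Rightarrow> 'a set" where
  "diff_field_generated R m D A =
     \<Inter>{F. subfield F R \<and> (\<forall>k\<in>{1..m}. D k ` F \<subseteq> F) \<and> A \<subseteq> F}"

text \<open>
  Universal extensions in the sense of Kolchin. \<open>U\<close> is semiuniversal over a differential subfield
  \<open>F\<close> if every finitely generated differential field extension \<open>\<phi> : F \<rightarrow> L\<close> embeds into \<open>U\<close> over
  \<open>F\<close>. Restricting \<open>L\<close> to carriers inside the type of \<open>U\<close> loses nothing in characteristic zero:
  such an \<open>L\<close> has at most \<open>max(|F|, \<aleph>\<^sub>0) \<le> |U|\<close> elements.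
\<close>

definition semiuniversal_over ::
  "'u ring \<Rightarrow> nat \<Rightarrow> (nat \<Rightarrow> 'u \<Rightarrow> 'u) \<Rightarrow> 'u set \<Rightarrow> bool" where
  "semiuniversal_over U m dU F \<longleftrightarrow>
     (\<forall>(L :: 'u ring) D \<phi>.
        differential_field L m D \<and>
        differential_hom m (U\<lparr>carrier := F\<rparr>) dU L D \<phi> \<and>
        (\<exists>A. finite A \<and> A \<subseteq> carrier L \<and> diff_field_generated L m D (\<phi> ` F \<union> A) = carrier L)
        \<longrightarrow> (\<exists>\<psi>. differential_hom m L D U dU \<psi> \<and> (\<forall>x\<in>F. \<psi> (\<phi> x) = x)))"

definition universal_extension ::
  "nat \<Rightarrow> ('a, 'c) ring_scheme \<Rightarrow> (nat \<Rightarrow> 'a \<Rightarrow> 'a) \<Rightarrow> 'u ring \<Rightarrow> (nat \<Rightarrow> 'u \<Rightarrow> 'u)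
    \<Rightarrow> ('a \<Rightarrow> 'u) \<Rightarrow> bool" where
  "universal_extension m K dK U dU \<iota> \<longleftrightarrow>
     differential_field U m dU \<and> differential_hom m K dK U dU \<iota> \<and>
     (\<forall>A. finite A \<and> A \<subseteq> carrier U
        \<longrightarrow> semiuniversal_over U m dU (diff_field_generated U m dU (\<iota> ` carrier K \<union> A)))"


section \<open>Multi-indices and differential polynomials\<close>

text \<open>\<open>\<nat>\<^sup>m\<close> is represented by the functions \<open>nat \<Rightarrow> nat\<close> vanishing outside \<open>{1..m}\<close>.\<close>

definition multi_indices :: "nat \<Rightarrow> (nat \<Rightarrow> nat) set" where
  "multi_indices m = {\<xi>. \<forall>k. k \<notin> {1..m} \<longrightarrow> \<xi> k = 0}"

definition mdeg :: "nat \<Rightarrow> (nat \<Rightarrow> nat) \<Rightarrow> nat" where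
  "mdeg m \<xi> = (\<Sum>k=1..m. \<xi> k)"

type_synonym dvar = "(nat \<Rightarrow> nat) \<times> nat"

definition dvars :: "nat \<Rightarrow> nat \<Rightarrow> dvar set" where
  "dvars m n = multi_indices m \<times> {1..n}"

text \<open>Polynomials with coefficients in \<open>'k\<close> in indeterminates from \<open>'v\<close>.\<close>

type_synonym ('v, 'k) mpoly = "('v \<Rightarrow>\<^sub>0 nat) \<Rightarrow>\<^sub>0 'k"

definition mpoly_vars :: "('v, 'k::zero) mpoly \<Rightarrow> 'v set" where
  "mpoly_vars p = (\<Union>t\<in>Poly_Mapping.keys p. Poly_Mapping.keys t)"

definition mpoly_eval :: "('k::zero \<Rightarrow> 'u::comm_ring_1) \<Rightarrow> ('v \<Rightarrow> 'u) \<Rightarrow> ('v, 'k) mpoly \<Rightarrow> 'u" where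
  "mpoly_eval \<phi> a p =
     (\<Sum>t\<in>Poly_Mapping.keys p. \<phi> (Poly_Mapping.lookup p t) *
        (\<Prod>v\<in>Poly_Mapping.keys t. a v ^ Poly_Mapping.lookup t v))"

text \<open>
  The indeterminate \<open>(\<xi>, i)\<close> stands for the derivative \<open>\<partial>\<^sup>\<xi> x\<^sub>i\<close>, so the following set is the
  differential polynomial ring \<open>K{x\<^sub>1, \<dots>, x\<^sub>n}\<close>.
\<close>

definition dpolys :: "nat \<Rightarrow> nat \<Rightarrow> (dvar, 'k::zero) mpoly set" where
  "dpolys m n = {f. mpoly_vars f \<subseteq> dvars m n}"

definition dpoly_ring :: "nat \<Rightarrow> nat \<Rightarrow> (dvar, 'k::comm_ring_1) mpoly ring" where
  "dpoly_ring m n = ring_of_type_algebra\<lparr>carrier := dpolys m n\<rparr>"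

definition order_at_most :: "nat \<Rightarrow> nat \<Rightarrow> (dvar, 'k::zero) mpoly \<Rightarrow> bool" where
  "order_at_most m r f \<longleftrightarrow> (\<forall>(\<xi>, i)\<in>mpoly_vars f. mdeg m \<xi> \<le> r)"

definition iterated_deriv :: "nat \<Rightarrow> (nat \<Rightarrow> 'u \<Rightarrow> 'u) \<Rightarrow> (nat \<Rightarrow> nat) \<Rightarrow> 'u \<Rightarrow> 'u" where
  "iterated_deriv m d \<xi> x = foldr (\<lambda>k. (d k ^^ \<xi> k)) [1..<Suc m] x"

definition dpoly_eval ::
  "nat \<Rightarrow> ('k::zero \<Rightarrow> 'u::comm_ring_1) \<Rightarrow> (nat \<Rightarrow> 'u \<Rightarrow> 'u) \<Rightarrow> (nat \<Rightarrow> 'u) \<Rightarrow> (dvar, 'k) mpoly \<Rightarrow> 'u" where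
  "dpoly_eval m \<iota> dU a f = mpoly_eval \<iota> (\<lambda>(\<xi>, i). iterated_deriv m dU \<xi> (a i)) f"


section \<open>Differential algebraic varieties\<close>

definition affine_space :: "nat \<Rightarrow> (nat \<Rightarrow> 'u) set" where
  "affine_space n = {1..n} \<rightarrow>\<^sub>E UNIV"

definition zero_set ::
  "nat \<Rightarrow> nat \<Rightarrow> ('k::zero \<Rightarrow> 'u::comm_ring_1) \<Rightarrow> (nat \<Rightarrow> 'u \<Rightarrow> 'u) \<Rightarrow> (dvar, 'k) mpoly set
    \<Rightarrow> (nat \<Rightarrow> 'u) set" where
  "zero_set m n \<iota> dU \<Sigma> = {a \<in> affine_space n. \<forall>f\<in>\<Sigma>. dpoly_eval m \<iota> dU a f = 0}"

definition diff_variety ::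
  "nat \<Rightarrow> nat \<Rightarrow> ('k::zero \<Rightarrow> 'u::comm_ring_1) \<Rightarrow> (nat \<Rightarrow> 'u \<Rightarrow> 'u) \<Rightarrow> (nat \<Rightarrow> 'u) set \<Rightarrow> bool" where
  "diff_variety m n \<iota> dU V \<longleftrightarrow> (\<exists>\<Sigma> \<subseteq> dpolys m n. V = zero_set m n \<iota> dU \<Sigma>)"

definition irreducible_variety ::
  "nat \<Rightarrow> nat \<Rightarrow> ('k::zero \<Rightarrow> 'u::comm_ring_1) \<Rightarrow> (nat \<Rightarrow> 'u \<Rightarrow> 'u) \<Rightarrow> (nat \<Rightarrow> 'u) set \<Rightarrow> bool" where
  "irreducible_variety m n \<iota> dU W \<longleftrightarrow>
     diff_variety m n \<iota> dU W \<and> W \<noteq> {} \<and>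
     (\<forall>W\<^sub>1 W\<^sub>2. diff_variety m n \<iota> dU W\<^sub>1 \<and> diff_variety m n \<iota> dU W\<^sub>2 \<and> W = W\<^sub>1 \<union> W\<^sub>2
        \<longrightarrow> W = W\<^sub>1 \<or> W = W\<^sub>2)"

definition irreducible_component ::
  "nat \<Rightarrow> nat \<Rightarrow> ('k::zero \<Rightarrow> 'u::comm_ring_1) \<Rightarrow> (nat \<Rightarrow> 'u \<Rightarrow> 'u) \<Rightarrow> (nat \<Rightarrow> 'u) set
    \<Rightarrow> (nat \<Rightarrow> 'u) set \<Rightarrow> bool" where
  "irreducible_component m n \<iota> dU V W \<longleftrightarrow>
     irreducible_variety m n \<iota> dU W \<and> W \<subseteq> V \<and>
     (\<forall>W'. irreducible_variety m n \<iota> dU W' \<and> W \<subseteq> W' \<and> W' \<subseteq> V \<longrightarrow> W' = W)"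

definition vanishing_ideal ::
  "nat \<Rightarrow> nat \<Rightarrow> ('k::zero \<Rightarrow> 'u::comm_ring_1) \<Rightarrow> (nat \<Rightarrow> 'u \<Rightarrow> 'u) \<Rightarrow> (nat \<Rightarrow> 'u) set
    \<Rightarrow> (dvar, 'k) mpoly set" where
  "vanishing_ideal m n \<iota> dU V = {f \<in> dpolys m n. \<forall>a\<in>V. dpoly_eval m \<iota> dU a f = 0}"

definition coordinate_ring ::
  "nat \<Rightarrow> nat \<Rightarrow> ('k::comm_ring_1 \<Rightarrow> 'u::comm_ring_1) \<Rightarrow> (nat \<Rightarrow> 'u \<Rightarrow> 'u) \<Rightarrow> (nat \<Rightarrow> 'u) set
    \<Rightarrow> (dvar, 'k) mpoly set ring" where
  "coordinate_ring m n \<iota> dU V = dpoly_ring m n Quot vanishing_ideal m n \<iota> dU V"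


section \<open>Fraction fields and transcendence degree\<close>

definition fraction_rel :: "('a, 'c) ring_scheme \<Rightarrow> (('a \<times> 'a) \<times> ('a \<times> 'a)) set" where
  "fraction_rel R = {((a, b), (c, d)).
     a \<in> carrier R \<and> b \<in> carrier R - {\<zero>\<^bsub>R\<^esub>} \<and> c \<in> carrier R \<and> d \<in> carrier R - {\<zero>\<^bsub>R\<^esub>} \<and>
     a \<otimes>\<^bsub>R\<^esub> d = c \<otimes>\<^bsub>R\<^esub> b}"

definition fraction :: "('a, 'c) ring_scheme \<Rightarrow> 'a \<Rightarrow> 'a \<Rightarrow> ('a \<times> 'a) set" where
  "fraction R a b = fraction_rel R `` {(a, b)}"

text \<open>The fraction field of an integral domain \<open>R\<close>, as a quotient of pairs (numerator, denominator).\<close>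

definition fraction_field :: "('a, 'c) ring_scheme \<Rightarrow> ('a \<times> 'a) set ring" where
  "fraction_field R =
     \<lparr>carrier = (carrier R \<times> (carrier R - {\<zero>\<^bsub>R\<^esub>})) // fraction_rel R,
      monoid.mult = (\<lambda>P Q. \<Union>(a, b)\<in>P. \<Union>(c, d)\<in>Q. fraction R (a \<otimes>\<^bsub>R\<^esub> c) (b \<otimes>\<^bsub>R\<^esub> d)),
      one = fraction R \<one>\<^bsub>R\<^esub> \<one>\<^bsub>R\<^esub>,
      ring.zero = fraction R \<zero>\<^bsub>R\<^esub> \<one>\<^bsub>R\<^esub>,
      add = (\<lambda>P Q. \<Union>(a, b)\<in>P. \<Union>(c, d)\<in>Q.
        fraction R ((a \<otimes>\<^bsub>R\<^esub> d) \<oplus>\<^bsub>R\<^esub> (c \<otimes>\<^bsub>R\<^esub> b)) (b \<otimes>\<^bsub>R\<^esub> d))\<rparr>"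

text \<open>Below, \<open>L\<close> is regarded as an extension of the field \<open>'k\<close> through \<open>\<phi>\<close>.\<close>

definition mpoly_eval_ring ::
  "('l, 'c) ring_scheme \<Rightarrow> ('k::zero \<Rightarrow> 'l) \<Rightarrow> ('v \<Rightarrow> 'l) \<Rightarrow> ('v, 'k) mpoly \<Rightarrow> 'l" where
  "mpoly_eval_ring L \<phi> a p =
     (\<Oplus>\<^bsub>L\<^esub>t\<in>Poly_Mapping.keys p. \<phi> (Poly_Mapping.lookup p t) \<otimes>\<^bsub>L\<^esub>
        (\<Otimes>\<^bsub>L\<^esub>v\<in>Poly_Mapping.keys t. a v [^]\<^bsub>L\<^esub> Poly_Mapping.lookup t v))"

definition algebraically_independent ::
  "('l, 'c) ring_scheme \<Rightarrow> ('k::zero \<Rightarrow> 'l) \<Rightarrow> 'l set \<Rightarrow> bool" where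
  "algebraically_independent L \<phi> S \<longleftrightarrow>
     S \<subseteq> carrier L \<and>
     (\<forall>p :: ('l, 'k) mpoly. mpoly_vars p \<subseteq> S \<and> mpoly_eval_ring L \<phi> (\<lambda>s. s) p = \<zero>\<^bsub>L\<^esub> \<longrightarrow> p = 0)"

definition trdeg :: "('l, 'c) ring_scheme \<Rightarrow> ('k::zero \<Rightarrow> 'l) \<Rightarrow> enat" where
  "trdeg L \<phi> = Sup {enat (card S) | S. finite S \<and> algebraically_independent L \<phi> S}"

text \<open>The order of an irreducible \<open>W\<close>; it is \<open>\<infinity>\<close> if the transcendence degree is infinite.\<close>

definition function_field ::
  "nat \<Rightarrow> nat \<Rightarrow> ('k::comm_ring_1 \<Rightarrow> 'u::comm_ring_1) \<Rightarrow> (nat \<Rightarrow> 'u \<Rightarrow> 'u) \<Rightarrow> (nat \<Rightarrow> 'u) set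
    \<Rightarrow> ((dvar, 'k) mpoly set \<times> (dvar, 'k) mpoly set) set ring" where
  "function_field m n \<iota> dU W = fraction_field (coordinate_ring m n \<iota> dU W)"

definition const_function ::
  "nat \<Rightarrow> nat \<Rightarrow> ('k::comm_ring_1 \<Rightarrow> 'u::comm_ring_1) \<Rightarrow> (nat \<Rightarrow> 'u \<Rightarrow> 'u) \<Rightarrow> (nat \<Rightarrow> 'u) set
    \<Rightarrow> 'k \<Rightarrow> ((dvar, 'k) mpoly set \<times> (dvar, 'k) mpoly set) set" where
  "const_function m n \<iota> dU W c =
     fraction (coordinate_ring m n \<iota> dU W)
       (vanishing_ideal m n \<iota> dU W +>\<^bsub>dpoly_ring m n\<^esub> Poly_Mapping.single 0 c)
       \<one>\<^bsub>coordinate_ring m n \<iota> dU W\<^esub>"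

definition variety_order ::
  "nat \<Rightarrow> nat \<Rightarrow> ('k::comm_ring_1 \<Rightarrow> 'u::comm_ring_1) \<Rightarrow> (nat \<Rightarrow> 'u \<Rightarrow> 'u) \<Rightarrow> (nat \<Rightarrow> 'u) set \<Rightarrow> enat" where
  "variety_order m n \<iota> dU W = trdeg (function_field m n \<iota> dU W) (const_function m n \<iota> dU W)"


section \<open>The number \<open>C\<close>\<close>

definition dvar_le :: "dvar \<Rightarrow> dvar \<Rightarrow> bool" where
  "dvar_le \<alpha> \<beta> \<longleftrightarrow> snd \<alpha> = snd \<beta> \<and> fst \<alpha> \<le> fst \<beta>"

definition Gamma_upto :: "nat \<Rightarrow> nat \<Rightarrow> nat \<Rightarrow> dvar set" where
  "Gamma_upto m n p = {\<alpha> \<in> dvars m n. mdeg m (fst \<alpha>) \<le> p}"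

definition antichain_seq :: "nat \<Rightarrow> nat \<Rightarrow> dvar list \<Rightarrow> bool" where
  "antichain_seq m n \<alpha>s \<longleftrightarrow>
     set \<alpha>s \<subseteq> dvars m n \<and>
     (\<forall>i < length \<alpha>s. \<forall>j < length \<alpha>s. i \<noteq> j \<longrightarrow> \<not> dvar_le (\<alpha>s ! i) (\<alpha>s ! j))"

text \<open>The supremum of functions is the entrywise maximum, i.e. the LUB.\<close>

definition lub_set :: "dvar set \<Rightarrow> dvar set" where
  "lub_set A = {(sup \<eta> \<tau>, i) | \<eta> \<tau> i. \<eta> \<noteq> \<tau> \<and> (\<eta>, i) \<in> A \<and> (\<tau>, i) \<in> A}"

text \<open>
  \<open>below_minus \<eta> \<tau> k\<close> says \<open>\<eta> \<le> \<tau> - \<^bold>k\<close>, where \<open>\<^bold>k\<close> is the \<open>k\<close>-th unit vector. It is written as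
  \<open>\<eta> + \<^bold>k \<le> \<tau>\<close> because truncated subtraction would wrongly give \<open>\<tau> - \<^bold>k = \<tau>\<close> when \<open>\<tau> k = 0\<close>.
\<close>

definition below_minus :: "(nat \<Rightarrow> nat) \<Rightarrow> (nat \<Rightarrow> nat) \<Rightarrow> nat \<Rightarrow> bool" where
  "below_minus \<eta> \<tau> k \<longleftrightarrow> \<eta>(k := Suc (\<eta> k)) \<le> \<tau>"

definition D_condition :: "nat \<Rightarrow> nat \<Rightarrow> dvar list \<Rightarrow> nat \<Rightarrow> bool" where
  "D_condition m n \<alpha>s p \<longleftrightarrow>
     (let A = set \<alpha>s \<inter> Gamma_upto m n p in
      \<forall>(\<tau>, l) \<in> lub_set A - Gamma_upto m n p. \<forall>i j.
        1 \<le> i \<and> i < j \<and> j \<le> m \<and>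
        (\<exists>\<beta>\<^sub>1. (\<beta>\<^sub>1, l) \<in> A \<and> below_minus \<beta>\<^sub>1 \<tau> i) \<and> (\<exists>\<beta>\<^sub>2. (\<beta>\<^sub>2, l) \<in> A \<and> below_minus \<beta>\<^sub>2 \<tau> j)
        \<longrightarrow> (\<exists>(s :: nat) \<eta> k. 1 \<le> s \<and> k 1 = i \<and> k s = j \<and>
               (\<forall>q\<in>{1..s}. (\<eta> q, l) \<in> A \<and> k q \<in> {1..m} \<and> below_minus (\<eta> q) \<tau> (k q)) \<and>
               (\<forall>q\<in>{1..<s}. mdeg m (sup (\<eta> q) (\<eta> (Suc q))) \<le> p)))"

definition D_number :: "nat \<Rightarrow> nat \<Rightarrow> nat \<Rightarrow> dvar list \<Rightarrow> nat" where
  "D_number r m n \<alpha>s = (LEAST p. r \<le> p \<and> D_condition m n \<alpha>s p)"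

definition C_number :: "nat \<Rightarrow> nat \<Rightarrow> nat \<Rightarrow> nat" where
  "C_number r m n = Max {D_number r m n \<alpha>s | \<alpha>s. antichain_seq m n \<alpha>s}"

end

theory Submission
  imports Defs "HOL-Library.Countable_Set" "HOL-Library.Fun_Lexorder"
begin

text \<open>
  Let \<open>P\<close> be the prime differential ideal of \<open>W\<close>, and call \<open>v = \<partial>\<^sup>\<xi> x\<^sub>i\<close> a leader of \<open>P\<close> if, modulo \<open>P\<close>,
  it is algebraic over the derivatives of lower rank (for an orderly ranking). The minimal leaders
  form an antichain; let \<open>p\<close> be its number \<open>D\<close>, so \<open>r \<le> p \<le> C\<close>. Keeping only the elements of \<open>P\<close> of
  order at most \<open>p\<close>, prolong them freely: derivatives above a minimal leader of order at most \<open>p\<close> are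
  determined by differentiation, all others become independent transcendentals. The chain condition
  that defines \<open>D\<close> is what makes the different ways of differentiating agree, as in Rosenfeld's lemma.
  The resulting kernel \<open>Q \<subseteq> P\<close> is a prime differential ideal that contains the equations of \<open>V\<close>, so
  \<open>W\<close> being a component forces \<open>Q = P\<close>. Thus all minimal leaders have order at most \<open>C\<close>. When the order
  of \<open>W\<close> is finite, some pure power of each derivation is a leader for each \<open>x\<^sub>i\<close>, whence at most
  \<open>n C\<^sup>m\<close> derivatives are not leaders; these form a transcendence basis of the function field.

  The number \<open>C\<close> is a maximum over a finite set because strictly increasing chains of antichains are
  finite.
\<close>


section \<open>Finiteness of antichains and of the number C\<close>

text \<open>The truncated prolongation is built with values instead of ideals: \<open>b\<close>
  gives every derivative an element of the universal field, one rank at a time, and the new ideal is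
  the kernel of evaluation at \<open>b\<close>, so it is prime at once. The price is that
  \<open>b\<close> is not known to come from a point: no derivation links its values, and closure of
  the kernel under each \<open>dd k\<close> must be proved. This is an induction on the rank of the
  target v of a differentiation. Two routes into v that start from a common derivative of a retained
  leader agree because the derivations commute; other routes are linked through further leaders, and
  only when v is itself the least upper bound of two leaders is the chain condition needed. Only
  afterwards is the kernel realized by an actual point. A second constraint is that semiuniversality
  speaks only of fields whose carrier lies in the type of the universal field. Every field to be
  embedded is therefore first coded into that type by an injection. The factor \<open>C ^ m\<close>
  counts exponent vectors with all entries below \<open>C\<close>: finite order forces each entry of
  a nonleader below \<open>C\<close>.\<close>

lemma exists_mono_subseq_nat:
  fixes s :: "nat \<Rightarrow> nat"
  obtains g :: "nat \<Rightarrow> nat" where "strict_mono g" "mono (\<lambda>i. s (g i))"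
proof -
  \<comment> \<open>\<open>T i\<close> is the minimum of the tail from \<open>i\<close>, and
    \<open>f i\<close> a position where it is attained. Jumping from such a position to one for the
    tail behind it makes the values increase, as minima of shrinking tails do.\<close>
  define T where "T i = (LEAST x. x \<in> s ` {i..})" for i
  have T: "\<exists>j\<ge>i. s j = T i \<and> (\<forall>l\<ge>i. s j \<le> s l)" for i
  proof -
    have "T i \<in> s ` {i..}" unfolding T_def by (rule LeastI[of _ "s i"]) auto
    then obtain j where j: "j \<ge> i" "s j = T i" by auto
    moreover have "s j \<le> s l" if "l \<ge> i" for l
      using Least_le[of "\<lambda>x. x \<in> s ` {i..}" "s l"] that j unfolding T_def by auto
    ultimately show ?thesis by blast
  qed
  then obtain f where f: "f i \<ge> i" "\<And>l. l \<ge> i \<Longrightarrow> s (f i) \<le> s l" for i by metis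
  define g where "g = rec_nat (f 0) (\<lambda>_ x. f (Suc x))"
  have g0: "g 0 = f 0" and gS: "g (Suc i) = f (Suc (g i))" for i by (simp_all add: g_def)
  have sm: "strict_mono g"
    unfolding strict_mono_Suc_iff using f(1) by (simp add: gS Suc_le_lessD)
  have "s (g i) \<le> s (g (Suc i))" for i
  proof (cases i)
    case 0 then show ?thesis using f by (simp add: g0)
  next
    case (Suc l)
    have "s (g (Suc l)) \<le> s (g (Suc (Suc l)))"
      unfolding gS[of l] by (rule f(2)) (use sm in \<open>metis gS Suc_le_eq dual_order.trans f(1) less_or_eq_imp_le strict_mono_less lessI\<close>)
    then show ?thesis using Suc by simp
  qed
  then have "mono (\<lambda>i. s (g i))" by (simp add: mono_iff_le_Suc)
  with sm show thesis by (rule that)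
qed

lemma exists_mono_subseq_nats:
  fixes s :: "nat \<Rightarrow> 'a \<Rightarrow> nat"
  assumes "finite A"
  shows "\<exists>g :: nat \<Rightarrow> nat. strict_mono g \<and> (\<forall>k\<in>A. mono (\<lambda>i. s (g i) k))"
  using assms
proof induction
  case empty show ?case using strict_mono_id by blast
next
  case (insert a A)
  then obtain g :: "nat \<Rightarrow> nat" where g: "strict_mono g" "\<forall>k\<in>A. mono (\<lambda>i. s (g i) k)" by auto
  obtain h :: "nat \<Rightarrow> nat" where h: "strict_mono h" "mono (\<lambda>i. s (g (h i)) a)"
    using exists_mono_subseq_nat[of "\<lambda>i. s (g i) a"] by blast
  have "mono (\<lambda>i. s (g (h i)) k)" if "k \<in> A" for k
    using g(2) that h(1) unfolding mono_def by (meson strict_mono_leD)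
  with h g show ?case
    by (intro exI[of _ "g \<circ> h"]) (auto simp: strict_mono_def)
qed

text \<open>Dickson's lemma. A sequence of distinct elements has a subsequence increasing in every
  entry; the index takes finitely many values, so two members of the subsequence share it and are
  comparable.\<close>

lemma dickson_dvars:
  assumes "A \<subseteq> dvars m n" "infinite A"
  shows "\<exists>\<alpha>\<in>A. \<exists>\<beta>\<in>A. \<alpha> \<noteq> \<beta> \<and> dvar_le \<alpha> \<beta>"
proof -
  obtain e :: "nat \<Rightarrow> dvar" where e: "inj e" "range e \<subseteq> A"
    using infinite_countable_subset[OF assms(2)] by auto
  define s where "s j k = (if k = 0 then snd (e j) else fst (e j) k)" for j k
  obtain g :: "nat \<Rightarrow> nat" where g: "strict_mono g" "\<forall>k\<in>{0..m}. mono (\<lambda>i. s (g i) k)"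
    using exists_mono_subseq_nats[of "{0..m}" s] by auto
  have in_A: "e j \<in> dvars m n" for j using e assms by auto
  have "finite (range (\<lambda>i. snd (e (g i))))"
    by (rule finite_subset[of _ "{1..n}"]) (use in_A in \<open>auto simp: dvars_def mem_Times_iff\<close>)
  then obtain i where inf: "infinite {j. snd (e (g j)) = snd (e (g i))}"
    using pigeonhole_infinite[of UNIV "\<lambda>i. snd (e (g i))"] infinite_UNIV_nat by auto
  obtain a where a: "snd (e (g a)) = snd (e (g i))"
    using inf not_finite_existsD by auto
  obtain b where b: "snd (e (g b)) = snd (e (g i))" "b > a"
    using inf unfolding infinite_nat_iff_unbounded by auto
  have "g a \<noteq> g b" using g(1) b(2) strict_mono_eq by fastforce
  then have ne: "e (g a) \<noteq> e (g b)" using e(1) by (auto dest: injD)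
  have "fst (e (g a)) k \<le> fst (e (g b)) k" for k
  proof (cases "k \<in> {1..m}")
    case True
    then have "mono (\<lambda>i. s (g i) k)" using g by auto
    then have "s (g a) k \<le> s (g b) k" using b(2) by (auto simp: mono_def)
    then show ?thesis using True by (auto simp: s_def)
  next
    case False
    then show ?thesis using in_A[of "g a"] by (auto simp: dvars_def multi_indices_def)
  qed
  then have "dvar_le (e (g a)) (e (g b))" using a b by (auto simp: dvar_le_def le_fun_def)
  then show ?thesis using ne e by blast
qed

definition antichain :: "nat \<Rightarrow> nat \<Rightarrow> dvar set \<Rightarrow> bool" where
  "antichain m n A \<longleftrightarrow> A \<subseteq> dvars m n \<and> (\<forall>\<alpha>\<in>A. \<forall>\<beta>\<in>A. dvar_le \<alpha> \<beta> \<longrightarrow> \<alpha> = \<beta>)"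

lemma antichain_finite: "antichain m n A \<Longrightarrow> finite A"
  unfolding antichain_def using dickson_dvars by blast

lemma antichain_subset: "antichain m n A \<Longrightarrow> B \<subseteq> A \<Longrightarrow> antichain m n B"
  unfolding antichain_def by blast

lemma dvar_le_refl [simp]: "dvar_le \<alpha> \<alpha>"
  by (simp add: dvar_le_def)

lemma antichain_seq_imp_antichain: "antichain_seq m n \<alpha>s \<Longrightarrow> antichain m n (set \<alpha>s)"
  unfolding antichain_seq_def antichain_def by (metis in_set_conv_nth)

lemma antichain_imp_antichain_seq:
  assumes "antichain m n A"
  shows "\<exists>\<alpha>s. antichain_seq m n \<alpha>s \<and> set \<alpha>s = A"
proof -
  obtain \<alpha>s where "set \<alpha>s = A" "distinct \<alpha>s"
    using finite_distinct_list antichain_finite[OF assms] by blast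
  then show ?thesis
    using assms unfolding antichain_seq_def antichain_def
    by (metis nth_eq_iff_index_eq nth_mem)
qed

text \<open>The union of an increasing chain of antichains is an antichain, hence finite by
  Dickson's lemma, while the cardinalities along a strictly increasing chain are unbounded.\<close>

lemma wf_antichains: "wf {(B', B). B \<subset> B' \<and> antichain m n B'}"
  unfolding wf_iff_no_infinite_down_chain
proof
  assume "\<exists>f. \<forall>i. (f (Suc i), f i) \<in> {(B', B). B \<subset> B' \<and> antichain m n B'}"
  then obtain f where "\<forall>i. f i \<subset> f (Suc i) \<and> antichain m n (f (Suc i))" by auto
  then have f: "\<And>i. f i \<subset> f (Suc i)" "\<And>i. antichain m n (f (Suc i))" by auto
  have mf: "mono f" using f by (intro mono_iff_le_Suc[THEN iffD2]) auto
  have "antichain m n (\<Union>i. f (Suc i))"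
    unfolding antichain_def
  proof (intro conjI ballI impI)
    show "(\<Union>i. f (Suc i)) \<subseteq> dvars m n" using f(2) by (auto simp: antichain_def)
    fix \<alpha> \<beta> assume "\<alpha> \<in> (\<Union>i. f (Suc i))" "\<beta> \<in> (\<Union>i. f (Suc i))" and le: "dvar_le \<alpha> \<beta>"
    then obtain i j where "\<alpha> \<in> f (Suc i)" "\<beta> \<in> f (Suc j)" by auto
    then have "\<alpha> \<in> f (Suc (max i j))" "\<beta> \<in> f (Suc (max i j))"
      using mf unfolding mono_def by (meson Suc_le_mono max.cobounded1 max.cobounded2 subsetD)+
    then show "\<alpha> = \<beta>" using f(2) le by (auto simp: antichain_def)
  qed
  then have fin: "finite (\<Union>i. f (Suc i))" by (rule antichain_finite)
  have "card (f (Suc i)) \<ge> i" for i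
  proof (induction i)
    case (Suc i)
    have "card (f (Suc i)) < card (f (Suc (Suc i)))"
      by (intro psubset_card_mono antichain_finite[of m n] f)
    with Suc show ?case by simp
  qed simp
  moreover have "card (f (Suc i)) \<le> card (\<Union>i. f (Suc i))" for i
    using fin by (intro card_mono) auto
  ultimately have "i \<le> card (\<Union>i. f (Suc i))" for i by (meson order.trans)
  then show False using Suc_n_not_le_n by blast
qed

lemma finite_Gamma_upto: "finite (Gamma_upto m n p)"
proof -
  have "fst ` Gamma_upto m n p \<subseteq> {\<xi>. \<forall>k. (k \<in> {1..m} \<longrightarrow> \<xi> k \<in> {0..p}) \<and> (k \<notin> {1..m} \<longrightarrow> \<xi> k = 0)}"
  proof (clarsimp simp: Gamma_upto_def dvars_def multi_indices_def mdeg_def)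
    fix \<xi> :: "nat \<Rightarrow> nat" and k assume "(\<Sum>k = Suc 0..m. \<xi> k) \<le> p" "Suc 0 \<le> k" "k \<le> m"
    then show "\<xi> k \<le> p" using member_le_sum[of k "{1..m}" \<xi>] by auto
  qed
  then have "finite (fst ` Gamma_upto m n p)"
    by (rule finite_subset) (rule finite_set_of_finite_funs; simp)
  then have "finite (fst ` Gamma_upto m n p \<times> {1..n})" by simp
  moreover have "Gamma_upto m n p \<subseteq> fst ` Gamma_upto m n p \<times> {1..n}"
    by (force simp: Gamma_upto_def dvars_def)
  ultimately show ?thesis by (rule finite_subset[rotated])
qed

lemma Gamma_upto_mono: "p \<le> q \<Longrightarrow> Gamma_upto m n p \<subseteq> Gamma_upto m n q"
  by (auto simp: Gamma_upto_def)

lemma finite_lub_set: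
  assumes "finite A"
  shows "finite (lub_set A)"
proof -
  have "lub_set A \<subseteq> (\<lambda>(\<alpha>, \<beta>). (sup (fst \<alpha>) (fst \<beta>), snd \<alpha>)) ` (A \<times> A)"
    by (force simp: lub_set_def image_iff)
  then show ?thesis using assms finite_subset by blast
qed

lemma multi_indices_sup:
  "\<eta> \<in> multi_indices m \<Longrightarrow> \<tau> \<in> multi_indices m \<Longrightarrow> sup \<eta> \<tau> \<in> multi_indices m"
  by (auto simp: multi_indices_def)

lemma finite_dvars_bounded:
  assumes "finite A" "A \<subseteq> dvars m n"
  shows "\<exists>q\<ge>r. A \<subseteq> Gamma_upto m n q"
proof -
  define q where "q = r + (\<Sum>\<alpha>\<in>A. mdeg m (fst \<alpha>))"
  have "mdeg m (fst \<alpha>) \<le> q" if "\<alpha> \<in> A" for \<alpha>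
    using member_le_sum[of \<alpha> A "\<lambda>\<alpha>. mdeg m (fst \<alpha>)"] that assms by (auto simp: q_def)
  then show ?thesis using assms by (intro exI[of _ q]) (auto simp: Gamma_upto_def q_def)
qed

text \<open>
  An antichain that has no further elements up to a degree bounding the least upper bounds of its
  elements of degree \<open>\<le> p\<close> satisfies the defining condition of \<open>D\<close> vacuously.
\<close>

lemma D_condition_bounded:
  assumes "antichain m n B"
  shows "\<exists>N. \<forall>\<alpha>s. antichain_seq m n \<alpha>s \<and> set \<alpha>s \<inter> Gamma_upto m n p = B
           \<longrightarrow> (\<exists>q\<le>N. r \<le> q \<and> D_condition m n \<alpha>s q)"
  using wf_antichains[of m n] assms
proof (induction B arbitrary: p rule: wf_induct_rule)
  case (less B)
  have B: "finite B" "B \<subseteq> dvars m n"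
    using less.prems antichain_finite by (auto simp: antichain_def)
  have "lub_set B \<subseteq> dvars m n"
    using B(2) by (auto simp: lub_set_def dvars_def subset_iff intro!: multi_indices_sup)
  then obtain q where q: "q \<ge> max p r" "lub_set B \<subseteq> Gamma_upto m n q"
    using finite_dvars_bounded[OF finite_lub_set[OF B(1)]] by blast
  \<comment> \<open>The sequence can continue beyond \<open>B\<close> up to degree \<open>q\<close>
    in finitely many ways only. Each strict extension has a bound by induction, now with
    \<open>q\<close> in the role of \<open>p\<close>; the sum of these bounds dominates them
    all.\<close>
  define \<B> where "\<B> = {B'. B' \<subseteq> Gamma_upto m n q \<and> B \<subset> B' \<and> antichain m n B'}"
  have fin: "finite \<B>"
    by (rule finite_subset[of _ "Pow (Gamma_upto m n q)"]) (auto simp: \<B>_def finite_Gamma_upto)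
  have "\<forall>B'\<in>\<B>. \<exists>N. \<forall>\<alpha>s. antichain_seq m n \<alpha>s \<and> set \<alpha>s \<inter> Gamma_upto m n q = B'
           \<longrightarrow> (\<exists>q\<le>N. r \<le> q \<and> D_condition m n \<alpha>s q)"
    using less.IH[where p = q] by (auto simp: \<B>_def)
  then obtain N where N: "\<And>B' \<alpha>s. B' \<in> \<B> \<Longrightarrow> antichain_seq m n \<alpha>s \<Longrightarrow>
      set \<alpha>s \<inter> Gamma_upto m n q = B' \<Longrightarrow> \<exists>q\<le>N B'. r \<le> q \<and> D_condition m n \<alpha>s q" by metis
  show ?case
  proof (rule exI[of _ "q + (\<Sum>B'\<in>\<B>. N B')"], intro allI impI)
    fix \<alpha>s assume \<alpha>s: "antichain_seq m n \<alpha>s \<and> set \<alpha>s \<inter> Gamma_upto m n p = B"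
    define B' where "B' = set \<alpha>s \<inter> Gamma_upto m n q"
    have "B \<subseteq> B'" using \<alpha>s Gamma_upto_mono[of p q m n] q by (auto simp: B'_def)
    show "\<exists>q'\<le>q + (\<Sum>B'\<in>\<B>. N B'). r \<le> q' \<and> D_condition m n \<alpha>s q'"
    proof (cases "B = B'")
      case True
      then have "D_condition m n \<alpha>s q"
        using q(2) by (auto simp: D_condition_def Let_def B'_def)
      then show ?thesis using q(1) by (intro exI[of _ q]) auto
    next
      case False
      have "antichain m n B'"
        using antichain_subset[OF antichain_seq_imp_antichain] \<alpha>s by (auto simp: B'_def)
      then have B': "B' \<in> \<B>" using False \<open>B \<subseteq> B'\<close> by (auto simp: \<B>_def B'_def)
      then obtain q' where "q' \<le> N B'" "r \<le> q'" "D_condition m n \<alpha>s q'"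
        using N[OF B' conjunct1[OF \<alpha>s] B'_def[symmetric]] by blast
      moreover have "N B' \<le> (\<Sum>B'\<in>\<B>. N B')" using B' fin by (intro member_le_sum) auto
      ultimately show ?thesis by (intro exI[of _ q']) auto
    qed
  qed
qed

text \<open>There are finitely many antichains in degree 0, so the bounds attached to them give one
  bound for all antichain sequences. It provides the witness behind \<open>LEAST\<close> and the
  finiteness without which \<open>Max\<close> would carry no information.\<close>

lemma D_number_props:
  assumes "antichain_seq m n \<alpha>s"
  shows "r \<le> D_number r m n \<alpha>s" "D_condition m n \<alpha>s (D_number r m n \<alpha>s)"
    "D_number r m n \<alpha>s \<le> C_number r m n"
proof -
  define \<B> where "\<B> = {B. B \<subseteq> Gamma_upto m n 0 \<and> antichain m n B}"
  have fin: "finite \<B>"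
    by (rule finite_subset[of _ "Pow (Gamma_upto m n 0)"]) (auto simp: \<B>_def finite_Gamma_upto)
  have "\<forall>B\<in>\<B>. \<exists>N. \<forall>\<alpha>s. antichain_seq m n \<alpha>s \<and> set \<alpha>s \<inter> Gamma_upto m n 0 = B
           \<longrightarrow> (\<exists>q\<le>N. r \<le> q \<and> D_condition m n \<alpha>s q)"
    using D_condition_bounded by (auto simp: \<B>_def)
  then obtain N where N: "\<And>B \<alpha>s. B \<in> \<B> \<Longrightarrow> antichain_seq m n \<alpha>s \<Longrightarrow>
      set \<alpha>s \<inter> Gamma_upto m n 0 = B \<Longrightarrow> \<exists>q\<le>N B. r \<le> q \<and> D_condition m n \<alpha>s q" by metis
  have *: "\<exists>q\<le>(\<Sum>B\<in>\<B>. N B). r \<le> q \<and> D_condition m n \<alpha>s q" if "antichain_seq m n \<alpha>s" for \<alpha>s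
  proof -
    define B where "B = set \<alpha>s \<inter> Gamma_upto m n 0"
    have B: "B \<in> \<B>"
      using antichain_subset[OF antichain_seq_imp_antichain[OF that]] by (auto simp: \<B>_def B_def)
    then have "N B \<le> (\<Sum>B\<in>\<B>. N B)" using fin by (intro member_le_sum) auto
    then show ?thesis using N[OF B that] B_def le_trans by blast
  qed
  have D: "r \<le> D_number r m n \<alpha>s \<and> D_condition m n \<alpha>s (D_number r m n \<alpha>s)"
    "D_number r m n \<alpha>s \<le> (\<Sum>B\<in>\<B>. N B)" if "antichain_seq m n \<alpha>s" for \<alpha>s
  proof -
    from *[OF that] obtain q where q: "q \<le> (\<Sum>B\<in>\<B>. N B)" "r \<le> q \<and> D_condition m n \<alpha>s q" by blast
    show "r \<le> D_number r m n \<alpha>s \<and> D_condition m n \<alpha>s (D_number r m n \<alpha>s)"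
      unfolding D_number_def by (rule LeastI) (fact q(2))
    have "D_number r m n \<alpha>s \<le> q"
      unfolding D_number_def by (rule Least_le) (fact q(2))
    with q(1) show "D_number r m n \<alpha>s \<le> (\<Sum>B\<in>\<B>. N B)" by simp
  qed
  show "r \<le> D_number r m n \<alpha>s" "D_condition m n \<alpha>s (D_number r m n \<alpha>s)"
    using D(1)[OF assms] by auto
  have "finite {D_number r m n \<alpha>s | \<alpha>s. antichain_seq m n \<alpha>s}"
    by (rule finite_subset[of _ "{..(\<Sum>B\<in>\<B>. N B)}"]) (use D(2) in auto)
  then show "D_number r m n \<alpha>s \<le> C_number r m n"
    unfolding C_number_def by (intro Max_ge) (use assms in auto)
qed

section \<open>Polynomials, evaluations and derivations\<close>

locale unital_hom =
  fixes h :: "'a::comm_ring_1 \<Rightarrow> 'b::comm_ring_1"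
  assumes hom_add: "h (x + y) = h x + h y"
    and hom_mult: "h (x * y) = h x * h y"
    and hom_one [simp]: "h 1 = 1"
begin

lemma hom_zero [simp]: "h 0 = 0"
  using hom_add[of 0 0] by simp

lemma hom_minus: "h (- x) = - h x"
  using hom_add[of x "- x"] by (simp add: eq_neg_iff_add_eq_0 add.commute)

lemma hom_diff: "h (x - y) = h x - h y"
  using hom_add[of x "- y"] by (simp add: hom_minus)

lemma hom_of_nat [simp]: "h (of_nat k) = of_nat k"
  by (induction k) (auto simp: hom_add)

lemma hom_poly: "h (poly G x) = poly (map_poly h G) (h x)"
  by (induction G) (auto simp: hom_add hom_mult map_poly_pCons)

lemma hom_coeff: "coeff (map_poly h G) i = h (coeff G i)"
  by (simp add: coeff_map_poly)

end

text \<open>The formal derivative, without the absence of zero divisors that \<^const>\<open>pderiv\<close> asks for.\<close>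

definition pdiff :: "'a::comm_ring_1 poly \<Rightarrow> 'a poly" where
  "pdiff G = Abs_poly (\<lambda>i. of_nat (Suc i) * coeff G (Suc i))"

lemma coeff_pdiff: "coeff (pdiff G) i = of_nat (Suc i) * coeff G (Suc i)"
proof -
  have "\<forall>\<^sub>\<infinity>i. of_nat (Suc i) * coeff G (Suc i) = 0"
    unfolding MOST_nat by (intro exI[of _ "Polynomial.degree G"]) (simp add: coeff_eq_0)
  then show ?thesis unfolding pdiff_def by (simp add: Abs_poly_inverse)
qed

lemma pdiff_0 [simp]: "pdiff 0 = 0"
  by (rule poly_eqI) (simp add: coeff_pdiff)

lemma pdiff_pCons: "pdiff (pCons a G) = G + pCons 0 (pdiff G)"
  by (rule poly_eqI) (auto simp: coeff_pdiff coeff_pCons algebra_simps split: nat.splits)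

lemma degree_pdiff_less: "Polynomial.degree G > 0 \<Longrightarrow> Polynomial.degree (pdiff G) < Polynomial.degree G"
  by (rule le_less_trans[OF degree_le[of "Polynomial.degree G - 1"]]) (auto simp: coeff_pdiff coeff_eq_0)

locale derivation =
  fixes d :: "'a::comm_ring_1 \<Rightarrow> 'a"
  assumes deriv_add: "d (x + y) = d x + d y"
    and deriv_mult: "d (x * y) = d x * y + x * d y"
begin

lemma deriv_zero [simp]: "d 0 = 0"
  using deriv_add[of 0 0] by simp

lemma deriv_one [simp]: "d 1 = 0"
  using deriv_mult[of 1 1] by simp

lemma deriv_minus: "d (- x) = - d x"
  using deriv_add[of x "- x"] by (simp add: eq_neg_iff_add_eq_0 add.commute)

lemma deriv_diff: "d (x - y) = d x - d y"
  using deriv_add[of x "- y"] by (simp add: deriv_minus)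

text \<open>Chain rule. Applied to a relation for a derivative, it gives an expression linear in the
  next derivative with the separant as coefficient; \<open>prolong\<close> is read off from
  it.\<close>

lemma deriv_poly:
  "d (poly G x) = poly (map_poly d G) x + poly (pdiff G) x * d x"
  by (induction G) (auto simp: deriv_add deriv_mult map_poly_pCons pdiff_pCons algebra_simps)

end

section \<open>Multivariate polynomials, their evaluation, and one distinguished variable\<close>

definition mconst :: "'k::zero \<Rightarrow> ('v, 'k) mpoly" where
  "mconst c = Poly_Mapping.single 0 c"

definition mvar :: "'v \<Rightarrow> ('v, 'k::zero_neq_one) mpoly" where
  "mvar v = Poly_Mapping.single (Poly_Mapping.single v 1) 1"

lemma mconst_zero [simp]: "mconst 0 = 0"
  and mconst_one [simp]: "mconst 1 = 1"
  and mconst_add: "mconst (a + b) = mconst a + mconst b"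
  and mconst_mult: "mconst (c * e) = mconst c * mconst e"
  by (simp_all add: mconst_def single_add mult_single)

lemma unital_hom_mconst: "unital_hom (mconst :: 'k::comm_ring_1 \<Rightarrow> ('v, 'k) mpoly)"
  by unfold_locales (simp_all add: mconst_add mconst_mult)

lemma sum_single_lookup: "(\<Sum>t\<in>Poly_Mapping.keys p. Poly_Mapping.single t (Poly_Mapping.lookup p t)) = p"
  by (rule poly_mapping_eqI)
     (auto simp: lookup_sum lookup_single when_def in_keys_iff sum.delta)

lemma mvar_power:
  "mvar v ^ k = (Poly_Mapping.single (Poly_Mapping.single v k) 1 :: ('v, 'k::comm_ring_1) mpoly)"
  by (induction k) (auto simp: mvar_def mult_single single_add[symmetric])

lemma single_sum:
  "finite A \<Longrightarrow> Poly_Mapping.single (\<Sum>v\<in>A. f v) 1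
     = (\<Prod>v\<in>A. Poly_Mapping.single (f v) (1 :: 'k::comm_ring_1))"
proof (induction A rule: finite_induct)
  case (insert x A)
  have "Poly_Mapping.single (f x + sum f A) (1 :: 'k)
      = Poly_Mapping.single (f x) 1 * Poly_Mapping.single (sum f A) 1"
    by (simp add: mult_single)
  with insert show ?case by simp
qed simp

lemma single_eq_mvars:
  "Poly_Mapping.single t c
    = mconst c * (\<Prod>v\<in>Poly_Mapping.keys t. (mvar v :: ('v, 'k::comm_ring_1) mpoly) ^ Poly_Mapping.lookup t v)"
proof -
  have "Poly_Mapping.single t 1
      = (\<Prod>v\<in>Poly_Mapping.keys t. (mvar v :: ('v, 'k) mpoly) ^ Poly_Mapping.lookup t v)"
    by (subst (1) sum_single_lookup[of t, symmetric], subst single_sum) (simp_all add: mvar_power)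
  moreover have "Poly_Mapping.single t c = mconst c * Poly_Mapping.single t 1"
    by (simp add: mconst_def mult_single)
  ultimately show ?thesis by simp
qed

lemma mpoly_eq_mvars:
  "p = (\<Sum>t\<in>Poly_Mapping.keys p. mconst (Poly_Mapping.lookup p t) *
        (\<Prod>v\<in>Poly_Mapping.keys t. (mvar v :: ('v, 'k::comm_ring_1) mpoly) ^ Poly_Mapping.lookup t v))"
  by (subst (1) sum_single_lookup[symmetric]) (simp only: single_eq_mvars)

lemma mpoly_vars_mconst [simp]: "mpoly_vars (mconst c) = {}"
  by (auto simp: mpoly_vars_def mconst_def)

lemma mpoly_vars_0 [simp]: "mpoly_vars 0 = {}"
  by (auto simp: mpoly_vars_def)

lemma mpoly_vars_1 [simp]: "mpoly_vars (1 :: ('v, 'k::comm_ring_1) mpoly) = {}"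
  by (auto simp: mpoly_vars_def)

lemma mpoly_vars_mvar [simp]: "mpoly_vars (mvar v :: ('v, 'k::comm_ring_1) mpoly) = {v}"
  by (auto simp: mpoly_vars_def mvar_def)

lemma mpoly_vars_add: "mpoly_vars p \<subseteq> V \<Longrightarrow> mpoly_vars q \<subseteq> V \<Longrightarrow> mpoly_vars (p + q) \<subseteq> V"
  using Poly_Mapping.keys_add[of p q] unfolding mpoly_vars_def by blast

lemma mpoly_vars_mult:
  fixes p q :: "('v, 'k::comm_ring_1) mpoly"
  assumes "mpoly_vars p \<subseteq> V" "mpoly_vars q \<subseteq> V"
  shows "mpoly_vars (p * q) \<subseteq> V"
proof
  fix v assume "v \<in> mpoly_vars (p * q)"
  then obtain t where t: "t \<in> Poly_Mapping.keys (p * q)" "v \<in> Poly_Mapping.keys t"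
    by (auto simp: mpoly_vars_def)
  then obtain a b where "t = a + b" "a \<in> Poly_Mapping.keys p" "b \<in> Poly_Mapping.keys q"
    using keys_mult[of p q] by blast
  then show "v \<in> V" using t(2) Poly_Mapping.keys_add[of a b] assms unfolding mpoly_vars_def by blast
qed

text \<open>The monomial expansion builds a polynomial from constants and its own variables, so
  nothing outside \<open>V\<close> enters.\<close>

lemma mpoly_induct [consumes 1, case_names const var add mult]:
  fixes p :: "('v, 'k::comm_ring_1) mpoly"
  assumes p: "mpoly_vars p \<subseteq> V"
    and const: "\<And>c. P (mconst c)" and var: "\<And>v. v \<in> V \<Longrightarrow> P (mvar v)"
    and add: "\<And>p q. mpoly_vars p \<subseteq> V \<Longrightarrow> mpoly_vars q \<subseteq> V \<Longrightarrow> P p \<Longrightarrow> P q \<Longrightarrow> P (p + q)"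
    and mult: "\<And>p q. mpoly_vars p \<subseteq> V \<Longrightarrow> mpoly_vars q \<subseteq> V \<Longrightarrow> P p \<Longrightarrow> P q \<Longrightarrow> P (p * q)"
  shows "P p"
proof -
  \<comment> \<open>The bound on the variables is proved along with \<open>P\<close>, since the
    rules for sums and products require it of both arguments.\<close>
  let ?P = "\<lambda>p :: ('v, 'k) mpoly. mpoly_vars p \<subseteq> V \<and> P p"
  have P01: "?P 0" "?P 1" using const[of 0] const[of 1] by simp_all
  have sum: "?P (\<Sum>x\<in>A. f x)" if "finite A" "\<And>x. x \<in> A \<Longrightarrow> ?P (f x)"
    for A :: "('v \<Rightarrow>\<^sub>0 nat) set" and f :: "('v \<Rightarrow>\<^sub>0 nat) \<Rightarrow> ('v, 'k) mpoly"
    using that by (induction A rule: finite_induct) (simp_all add: P01 add mpoly_vars_add)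
  have prod: "?P (\<Prod>x\<in>A. f x)" if "finite A" "\<And>x. x \<in> A \<Longrightarrow> ?P (f x)" 
    for A :: "'v set" and f :: "'v \<Rightarrow> ('v, 'k) mpoly"
    using that by (induction A rule: finite_induct) (use P01 in \<open>simp_all add: mult mpoly_vars_mult\<close>)
  have power: "?P (x ^ k)" if "?P x" for x and k :: nat
    using that by (induction k) (use P01 in \<open>simp_all add: mult mpoly_vars_mult\<close>)
  have v: "?P (mvar v)" if "v \<in> V" for v using var that by simp
  have c: "?P (mconst c)" for c using const by simp
  have m: "?P (x * y)" if "?P x" "?P y" for x y using that mult mpoly_vars_mult by blast
  have "?P (\<Sum>t\<in>Poly_Mapping.keys p. mconst (Poly_Mapping.lookup p t) *
        (\<Prod>v\<in>Poly_Mapping.keys t. (mvar v :: ('v, 'k::comm_ring_1) mpoly) ^ Poly_Mapping.lookup t v))"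
    by (intro sum m c prod power v finite_keys) (use p in \<open>auto simp: mpoly_vars_def\<close>)
  then show ?thesis by (simp only: mpoly_eq_mvars[of p, symmetric])
qed

lemma mpoly_eval_superset:
  assumes "unital_hom \<phi>" "finite A" "Poly_Mapping.keys p \<subseteq> A"
  shows "mpoly_eval \<phi> a p = (\<Sum>t\<in>A. \<phi> (Poly_Mapping.lookup p t) *
           (\<Prod>v\<in>Poly_Mapping.keys t. a v ^ Poly_Mapping.lookup t v))"
  unfolding mpoly_eval_def
  by (rule sum.mono_neutral_left)
     (use assms in \<open>auto simp: in_keys_iff unital_hom.hom_zero[OF assms(1)]\<close>)

lemma mpoly_eval_add:
  assumes "unital_hom \<phi>"
  shows "mpoly_eval \<phi> a (p + q) = mpoly_eval \<phi> a p + mpoly_eval \<phi> a q"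
proof -
  let ?A = "Poly_Mapping.keys p \<union> Poly_Mapping.keys q"
  have "mpoly_eval \<phi> a (p + q) = (\<Sum>t\<in>?A. \<phi> (Poly_Mapping.lookup (p + q) t) *
           (\<Prod>v\<in>Poly_Mapping.keys t. a v ^ Poly_Mapping.lookup t v))"
    by (rule mpoly_eval_superset[OF assms]) (use Poly_Mapping.keys_add[of p q] in auto)
  then show ?thesis
    by (simp add: mpoly_eval_superset[OF assms, of ?A p] mpoly_eval_superset[OF assms, of ?A q]
        lookup_add unital_hom.hom_add[OF assms] distrib_right sum.distrib)
qed

lemma mpoly_eval_single:
  assumes "unital_hom \<phi>"
  shows "mpoly_eval \<phi> a (Poly_Mapping.single t c) = \<phi> c *
           (\<Prod>v\<in>Poly_Mapping.keys t. a v ^ Poly_Mapping.lookup t v)"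
  by (subst mpoly_eval_superset[OF assms, of "{t}"]) auto

lemma monomial_eval_add:
  fixes a :: "'v \<Rightarrow> 'u::comm_ring_1"
  shows "(\<Prod>v\<in>Poly_Mapping.keys (s + t). a v ^ Poly_Mapping.lookup (s + t) v)
    = (\<Prod>v\<in>Poly_Mapping.keys s. a v ^ Poly_Mapping.lookup s v) *
      (\<Prod>v\<in>Poly_Mapping.keys t. a v ^ Poly_Mapping.lookup t v)"
proof -
  let ?A = "Poly_Mapping.keys s \<union> Poly_Mapping.keys t"
  have *: "(\<Prod>v\<in>Poly_Mapping.keys u. a v ^ Poly_Mapping.lookup u v) = (\<Prod>v\<in>?A. a v ^ Poly_Mapping.lookup u v)"
    if "Poly_Mapping.keys u \<subseteq> ?A" for u
    by (rule prod.mono_neutral_left) (use that in \<open>auto simp: in_keys_iff\<close>)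
  show ?thesis
    using Poly_Mapping.keys_add[of s t]
    by (subst (1 2 3) *) (auto simp: lookup_add power_add prod.distrib)
qed

text \<open>By bilinearity it is enough to multiply monomials, where exponents add.\<close>

lemma mpoly_eval_mult:
  fixes \<phi> :: "'k::comm_ring_1 \<Rightarrow> 'u::comm_ring_1"
  assumes "unital_hom \<phi>"
  shows "mpoly_eval \<phi> a (p * q) = mpoly_eval \<phi> a p * mpoly_eval \<phi> a q"
proof -
  have sum: "mpoly_eval \<phi> a (\<Sum>x\<in>A. f x) = (\<Sum>x\<in>A. mpoly_eval \<phi> a (f x))"
    for a :: "'v \<Rightarrow> 'u" and A :: "('v \<Rightarrow>\<^sub>0 nat) set" and f :: "('v \<Rightarrow>\<^sub>0 nat) \<Rightarrow> ('v, 'k) mpoly"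
    by (induction A rule: infinite_finite_induct)
       (auto simp: mpoly_eval_add[OF assms], auto simp: mpoly_eval_def)
  have single: "mpoly_eval \<phi> a (Poly_Mapping.single s c * Poly_Mapping.single t e)
     = mpoly_eval \<phi> a (Poly_Mapping.single s c) * mpoly_eval \<phi> a (Poly_Mapping.single t e)" for s t c e
    by (simp add: mult_single mpoly_eval_single[OF assms] monomial_eval_add unital_hom.hom_mult[OF assms])
  have "mpoly_eval \<phi> a (p * q) = mpoly_eval \<phi> a
      ((\<Sum>s\<in>Poly_Mapping.keys p. Poly_Mapping.single s (Poly_Mapping.lookup p s)) *
       (\<Sum>t\<in>Poly_Mapping.keys q. Poly_Mapping.single t (Poly_Mapping.lookup q t)))"
    by (simp only: sum_single_lookup)
  also have "\<dots> = mpoly_eval \<phi> a (\<Sum>s\<in>Poly_Mapping.keys p. Poly_Mapping.single s (Poly_Mapping.lookup p s))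
      * mpoly_eval \<phi> a (\<Sum>t\<in>Poly_Mapping.keys q. Poly_Mapping.single t (Poly_Mapping.lookup q t))"
    by (simp only: sum_product sum single)
  finally show ?thesis by (simp only: sum_single_lookup)
qed

lemma mpoly_eval_mconst:
  "unital_hom \<phi> \<Longrightarrow> mpoly_eval \<phi> a (mconst c) = \<phi> c"
  by (simp add: mconst_def mpoly_eval_single)

lemma mpoly_eval_mvar:
  "unital_hom \<phi> \<Longrightarrow> mpoly_eval \<phi> a (mvar v) = a v"
  by (simp add: mvar_def mpoly_eval_single unital_hom.hom_one)

lemma unital_hom_mpoly_eval:
  assumes "unital_hom \<phi>"
  shows "unital_hom (mpoly_eval \<phi> a)"
  using mpoly_eval_add[OF assms] mpoly_eval_mult[OF assms] mpoly_eval_mconst[OF assms, of a 1]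
  by unfold_locales (auto simp: unital_hom.hom_one[OF assms])

lemma mpoly_eval_cong:
  assumes "\<And>v. v \<in> mpoly_vars p \<Longrightarrow> a v = b v"
  shows "mpoly_eval \<phi> a p = mpoly_eval \<phi> b p"
  unfolding mpoly_eval_def
  by (intro sum.cong arg_cong2[where f = "(*)"] prod.cong refl arg_cong2[where f = "(^)"] assms)
     (auto simp: mpoly_vars_def)

definition coeffs_in :: "'v set \<Rightarrow> ('v, 'k::zero) mpoly poly \<Rightarrow> bool" where
  "coeffs_in V G \<longleftrightarrow> (\<forall>i. mpoly_vars (coeff G i) \<subseteq> V)"

lemma coeffs_in_0 [simp]: "coeffs_in V 0"
  by (simp add: coeffs_in_def)

lemma coeffs_in_pCons [simp]:
  "coeffs_in V (pCons c G) \<longleftrightarrow> mpoly_vars c \<subseteq> V \<and> coeffs_in V G"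
  unfolding coeffs_in_def by (auto simp: coeff_pCons split: nat.splits)

lemma coeffs_in_mono: "coeffs_in V G \<Longrightarrow> V \<subseteq> V' \<Longrightarrow> coeffs_in V' G"
  unfolding coeffs_in_def by blast

lemma coeffs_in_add: "coeffs_in V F \<Longrightarrow> coeffs_in V G \<Longrightarrow> coeffs_in V (F + G)"
  unfolding coeffs_in_def by (simp add: mpoly_vars_add)

lemma mpoly_vars_sum:
  "(\<And>x. x \<in> A \<Longrightarrow> mpoly_vars (f x) \<subseteq> V) \<Longrightarrow> mpoly_vars (\<Sum>x\<in>A. f x) \<subseteq> V"
  by (induction A rule: infinite_finite_induct) (simp_all add: mpoly_vars_add)

lemma mpoly_vars_minus [simp]: "mpoly_vars (- p) = mpoly_vars (p :: ('v, 'k::comm_ring_1) mpoly)"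
proof -
  have "Poly_Mapping.keys (- p) = Poly_Mapping.keys p" by (auto simp: in_keys_iff)
  then show ?thesis by (simp add: mpoly_vars_def)
qed

lemma mpoly_vars_diff:
  fixes p q :: "('v, 'k::comm_ring_1) mpoly"
  shows "mpoly_vars p \<subseteq> V \<Longrightarrow> mpoly_vars q \<subseteq> V \<Longrightarrow> mpoly_vars (p - q) \<subseteq> V"
  using mpoly_vars_add[of p V "- q"] by simp

lemma coeffs_in_mult:
  fixes F G :: "('v, 'k::comm_ring_1) mpoly poly"
  shows "coeffs_in V F \<Longrightarrow> coeffs_in V G \<Longrightarrow> coeffs_in V (F * G)"
  unfolding coeffs_in_def coeff_mult by (intro allI mpoly_vars_sum mpoly_vars_mult) auto

lemma coeffs_in_smult:
  fixes G :: "('v, 'k::comm_ring_1) mpoly poly"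
  shows "mpoly_vars c \<subseteq> V \<Longrightarrow> coeffs_in V G \<Longrightarrow> coeffs_in V (Polynomial.smult c G)"
  unfolding coeffs_in_def by (simp add: mpoly_vars_mult)

lemma coeffs_in_diff:
  fixes F G :: "('v, 'k::comm_ring_1) mpoly poly"
  shows "coeffs_in V F \<Longrightarrow> coeffs_in V G \<Longrightarrow> coeffs_in V (F - G)"
  unfolding coeffs_in_def by (simp add: mpoly_vars_diff)

lemma coeffs_in_monom:
  fixes c :: "('v, 'k::comm_ring_1) mpoly"
  shows "mpoly_vars c \<subseteq> V \<Longrightarrow> coeffs_in V (Polynomial.monom c k)"
  unfolding coeffs_in_def by simp

lemma coeffs_in_pdiff:
  fixes G :: "('v, 'k::comm_ring_1) mpoly poly"
  shows "coeffs_in V G \<Longrightarrow> coeffs_in V (pdiff G)"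
  by (induction G)
     (auto simp: pdiff_pCons intro!: coeffs_in_add)

lemma mpoly_vars_poly:
  fixes G :: "('v, 'k::comm_ring_1) mpoly poly"
  assumes "coeffs_in V G" "mpoly_vars x \<subseteq> V'" "V \<subseteq> V'"
  shows "mpoly_vars (poly G x) \<subseteq> V'"
  using assms(1)
proof (induction G)
  case (pCons c G)
  have "mpoly_vars c \<subseteq> V'" "coeffs_in V G" using pCons.prems assms(3) by auto
  then show ?case using pCons.IH assms(2) by (simp add: mpoly_vars_add mpoly_vars_mult)
qed simp

lemma mpoly_univariate:
  fixes p :: "('v, 'k::comm_ring_1) mpoly"
  assumes "mpoly_vars p \<subseteq> insert v V"
  shows "\<exists>G. coeffs_in V G \<and> p = poly G (mvar v)"
  using assms
proof (induction p rule: mpoly_induct)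
  case (const c)
  show ?case by (intro exI[of _ "[:mconst c:]"]) simp
next
  case (var w)
  show ?case
  proof (cases "w = v")
    case True then show ?thesis by (intro exI[of _ "[:0, 1:]"]) simp
  next
    case False then show ?thesis using var by (intro exI[of _ "[:mvar w:]"]) simp
  qed
next
  case (add p q)
  then obtain F G where "coeffs_in V F" "coeffs_in V G" "p = poly F (mvar v)" "q = poly G (mvar v)" by blast
  then show ?case by (intro exI[of _ "F + G"]) (simp add: coeffs_in_add)
next
  case (mult p q)
  then obtain F G where "coeffs_in V F" "coeffs_in V G" "p = poly F (mvar v)" "q = poly G (mvar v)" by blast
  then show ?case by (intro exI[of _ "F * G"]) (simp add: coeffs_in_mult)
qed

lemma unital_hom_const_poly: "unital_hom (\<lambda>c :: 'a::comm_ring_1. [:c:])"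
  by unfold_locales auto

lemma unital_hom_comp: "unital_hom f \<Longrightarrow> unital_hom g \<Longrightarrow> unital_hom (\<lambda>x. f (g x))"
  unfolding unital_hom_def by simp

text \<open>Substituting a new indeterminate for \<open>v\<close> while treating the other variables
  as constants recovers \<open>G\<close> from \<open>poly G (mvar v)\<close>.\<close>

lemma mpoly_univariate_unique:
  fixes G :: "('v, 'k::comm_ring_1) mpoly poly"
  assumes "coeffs_in V G" "v \<notin> V" "poly G (mvar v) = 0"
  shows "G = 0"
proof -
  have c: "unital_hom (\<lambda>c :: 'k. [:mconst c :: ('v, 'k) mpoly:])"
    by (rule unital_hom_comp[OF unital_hom_const_poly unital_hom_mconst])
  define h :: "('v, 'k) mpoly \<Rightarrow> ('v, 'k) mpoly poly"
    where "h = mpoly_eval (\<lambda>c. [:mconst c:]) (\<lambda>w. if w = v then [:0, 1:] else [:mvar w:])"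
  interpret h: unital_hom h unfolding h_def by (rule unital_hom_mpoly_eval[OF c])
  have h_id: "h q = [:q:]" if "mpoly_vars q \<subseteq> V" for q
    using that
  proof (induction q rule: mpoly_induct)
    case (var w) then show ?case using assms(2) by (auto simp: h_def mpoly_eval_mvar[OF c])
  next
    case (const c') then show ?case by (simp add: h_def mpoly_eval_mconst[OF c])
  qed (simp_all add: h.hom_add h.hom_mult)
  have hv: "h (mvar v) = [:0, 1:]" by (simp add: h_def mpoly_eval_mvar[OF c])
  have "poly (map_poly h F) [:0, 1:] = F" if "coeffs_in V F" for F
    using that by (induction F) (auto simp: map_poly_pCons h_id)
  then have "G = h (poly G (mvar v))" using assms(1) by (simp add: h.hom_poly hv)
  then show ?thesis using assms(3) by simp
qed

text \<open>Dual numbers \<open>a + b \<epsilon>\<close> with \<open>\<epsilon>\<^sup>2 = 0\<close>: derivations are the ring homomorphisms into them.\<close>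

datatype 'a dual = Dual (dual_re: 'a) (dual_ep: 'a)

instantiation dual :: (comm_ring_1) comm_ring_1
begin

definition "0 = Dual 0 0"
definition "1 = Dual 1 0"
definition "x + y = Dual (dual_re x + dual_re y) (dual_ep x + dual_ep y)"
definition "x - y = Dual (dual_re x - dual_re y) (dual_ep x - dual_ep y)"
definition "- x = Dual (- dual_re x) (- dual_ep x)"
definition "x * y = Dual (dual_re x * dual_re y) (dual_ep x * dual_re y + dual_re x * dual_ep y)"

instance
  by standard
     (auto simp: zero_dual_def one_dual_def plus_dual_def minus_dual_def uminus_dual_def
       times_dual_def algebra_simps)

end

text \<open>A derivation with prescribed values on constants and variables thus exists by the
  universal property of evaluation, and its product rule is multiplication of dual numbers.\<close>

definition mderiv ::
  "('k::comm_ring_1 \<Rightarrow> 'k) \<Rightarrow> ('v \<Rightarrow> ('v, 'k) mpoly) \<Rightarrow> ('v, 'k) mpoly \<Rightarrow> ('v, 'k) mpoly" where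
  "mderiv \<delta> s p =
     dual_ep (mpoly_eval (\<lambda>c. Dual (mconst c) (mconst (\<delta> c))) (\<lambda>v. Dual (mvar v) (s v)) p)"

context
  fixes \<delta> :: "'k::comm_ring_1 \<Rightarrow> 'k" and s :: "'v \<Rightarrow> ('v, 'k) mpoly"
  assumes \<delta>: "derivation \<delta>"
begin

interpretation \<delta>: derivation \<delta> by (fact \<delta>)

lemma unital_hom_dual: "unital_hom (\<lambda>c. Dual (mconst c :: ('v, 'k) mpoly) (mconst (\<delta> c)))"
  by unfold_locales
     (auto simp: plus_dual_def times_dual_def one_dual_def mconst_add mconst_mult
       \<delta>.deriv_add \<delta>.deriv_mult)

lemma dual_re_mpoly_eval:
  "dual_re (mpoly_eval (\<lambda>c. Dual (mconst c) (mconst (\<delta> c))) (\<lambda>v. Dual (mvar v) (s v)) p) = p"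
proof -
  have "mpoly_vars p \<subseteq> UNIV" by simp
  then show ?thesis
    by (induction p rule: mpoly_induct)
       (simp_all add: mpoly_eval_add[OF unital_hom_dual] mpoly_eval_mult[OF unital_hom_dual]
          mpoly_eval_mconst[OF unital_hom_dual] mpoly_eval_mvar[OF unital_hom_dual]
          plus_dual_def times_dual_def)
qed

lemma derivation_mderiv: "derivation (mderiv \<delta> s)"
  by unfold_locales
     (auto simp: mderiv_def mpoly_eval_add[OF unital_hom_dual] mpoly_eval_mult[OF unital_hom_dual]
        plus_dual_def times_dual_def dual_re_mpoly_eval)

lemma mderiv_mconst: "mderiv \<delta> s (mconst c) = mconst (\<delta> c)"
  by (simp add: mderiv_def mpoly_eval_mconst[OF unital_hom_dual])

lemma mderiv_mvar: "mderiv \<delta> s (mvar v) = s v"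
  by (simp add: mderiv_def mpoly_eval_mvar[OF unital_hom_dual])

lemma mpoly_vars_mderiv:
  assumes "mpoly_vars p \<subseteq> V" "V \<subseteq> V'" "\<And>v. v \<in> V \<Longrightarrow> mpoly_vars (s v) \<subseteq> V'"
  shows "mpoly_vars (mderiv \<delta> s p) \<subseteq> V'"
  using assms(1)
proof (induction p rule: mpoly_induct)
  case (add p q)
  then show ?case by (simp add: derivation.deriv_add[OF derivation_mderiv] mpoly_vars_add)
next
  case (mult p q)
  moreover have "mpoly_vars p \<subseteq> V'" "mpoly_vars q \<subseteq> V'" using mult assms(2) by auto
  ultimately show ?case
    by (simp add: derivation.deriv_mult[OF derivation_mderiv] mpoly_vars_add mpoly_vars_mult)
qed (use assms in \<open>auto simp: mderiv_mconst mderiv_mvar\<close>)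

end

section \<open>Realizing differential algebras in a universal extension\<close>

lemma exists_inj_pair:
  assumes "infinite (UNIV :: 'u set)"
  shows "\<exists>f :: 'u \<times> 'u \<Rightarrow> 'u. inj f"
proof -
  have "|UNIV \<times> UNIV :: ('u \<times> 'u) set| \<le>o |UNIV :: 'u set|"
    using card_of_Times_same_infinite[OF assms] ordIso_imp_ordLeq by blast
  then show ?thesis by (metis UNIV_Times_UNIV card_of_ordLeq)
qed

lemma exists_inj_on_Times:
  fixes e :: "'z \<Rightarrow> 'u"
  assumes "infinite (UNIV :: 'u set)" "inj_on e S"
  shows "\<exists>f :: 'z \<times> 'z \<Rightarrow> 'u. inj_on f (S \<times> S)"
proof -
  obtain pr :: "'u \<times> 'u \<Rightarrow> 'u" where pr: "inj pr" using exists_inj_pair[OF assms(1)] by blast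
  have "inj_on (\<lambda>q. pr (e (fst q), e (snd q))) (S \<times> S)"
    by (rule inj_onI) (auto dest!: injD[OF pr] inj_onD[OF assms(2)])
  then show ?thesis by blast
qed

text \<open>Iterated pairing is injective only among lists of equal length; the length is therefore
  coded along, through an injection of the naturals.\<close>

lemma exists_inj_lists:
  assumes "infinite (UNIV :: 'u set)"
  shows "\<exists>f :: 'u list \<Rightarrow> 'u. inj f"
proof -
  obtain pr :: "'u \<times> 'u \<Rightarrow> 'u" where pr: "inj pr" using exists_inj_pair[OF assms] by blast
  obtain z :: "nat \<Rightarrow> 'u" where z: "inj z"
    using infinite_countable_subset[OF assms] by auto
  define enc where "enc = rec_list (z 0) (\<lambda>x _ y. pr (x, y))"
  have enc_inj: "enc xs = enc ys \<Longrightarrow> xs = ys" if "length xs = length ys" for xs ys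
    using that by (induction rule: list_induct2) (auto simp: enc_def dest!: injD[OF pr])
  have "inj (\<lambda>xs. pr (z (length xs), enc xs))"
    by (rule injI) (auto dest!: injD[OF pr] injD[OF z] enc_inj)
  then show ?thesis by blast
qed

lemma exists_inj_finite_sets:
  assumes "infinite (UNIV :: 'u set)"
  shows "\<exists>f :: 'u set \<Rightarrow> 'u. inj_on f {A. finite A}"
proof -
  obtain f :: "'u list \<Rightarrow> 'u" where f: "inj f" using exists_inj_lists[OF assms] by blast
  have "set (SOME xs. set xs = A) = A" if "finite A" for A :: "'u set"
    using finite_list[OF that] by (rule someI_ex)
  then have "inj_on (\<lambda>A. f (SOME xs. set xs = A)) {A. finite A}"
    by (intro inj_onI) (metis f injD mem_Collect_eq)
  then show ?thesis by blast
qed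

text \<open>A polynomial is determined by the finite set of its pairs of monomial and coefficient.
  Monomials over a countable \<open>V\<close> are countable and get codes through \<open>z\<close>;
  coefficients get theirs through \<open>\<iota>\<close>.\<close>

lemma exists_inj_mpoly:
  fixes \<iota> :: "'k::zero \<Rightarrow> 'u"
  assumes inf: "infinite (UNIV :: 'u set)" and V: "countable V" and \<iota>: "inj \<iota>"
  shows "\<exists>e :: ('v, 'k) mpoly \<Rightarrow> 'u. inj_on e {p. mpoly_vars p \<subseteq> V}"
proof -
  obtain pr :: "'u \<times> 'u \<Rightarrow> 'u" where pr: "inj pr" using exists_inj_pair[OF inf] by blast
  obtain z :: "nat \<Rightarrow> 'u" where z: "inj z"
    using infinite_countable_subset[OF inf] by auto
  obtain fs :: "'u set \<Rightarrow> 'u" where fs: "inj_on fs {A. finite A}"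
    using exists_inj_finite_sets[OF inf] by blast
  define M :: "('v \<Rightarrow>\<^sub>0 nat) set" where "M = {t. Poly_Mapping.keys t \<subseteq> V}"
  \<comment> \<open>The graph of the exponents, a finite subset of a countable set: this is why
    there are countably many monomials.\<close>
  define gr :: "('v \<Rightarrow>\<^sub>0 nat) \<Rightarrow> ('v \<times> nat) set"
    where "gr t = (\<lambda>v. (v, Poly_Mapping.lookup t v)) ` Poly_Mapping.keys t" for t
  have "inj gr"
  proof (rule injI, rule poly_mapping_eqI)
    fix s t v assume "gr s = gr t"
    then have "(v, i) \<in> gr s \<longleftrightarrow> (v, i) \<in> gr t" for i by simp
    then show "Poly_Mapping.lookup s v = Poly_Mapping.lookup t v"
      unfolding gr_def by (auto simp: image_iff in_keys_iff) (metis not_gr_zero)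
  qed
  moreover have "gr ` M \<subseteq> Fpow (V \<times> UNIV)"
    by (auto simp: gr_def M_def Fpow_def)
  moreover have "countable (Fpow (V \<times> (UNIV :: nat set)))"
    using V by (intro countable_Fpow countable_SIGMA) auto
  ultimately have M: "countable M"
    using countable_image_inj_on countable_subset inj_on_subset by (metis subset_UNIV)
  define c where "c p t = pr (z (to_nat_on M t), \<iota> (Poly_Mapping.lookup p t))"
    for p :: "('v, 'k) mpoly" and t
  have c_eq: "t = t' \<and> Poly_Mapping.lookup p t = Poly_Mapping.lookup q t'"
    if "c p t = c q t'" "t \<in> M" "t' \<in> M" for p q t t'
    using that M unfolding c_def
    by (auto dest!: injD[OF pr] injD[OF z] injD[OF \<iota>] inj_onD[OF inj_on_to_nat_on])
  define e where "e p = fs (c p ` Poly_Mapping.keys p)" for p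
  have "inj_on e {p. mpoly_vars p \<subseteq> V}"
  proof (rule inj_onI)
    fix p q assume pq: "p \<in> {p. mpoly_vars p \<subseteq> V}" "q \<in> {p. mpoly_vars p \<subseteq> V}" "e p = e q"
    have keys: "Poly_Mapping.keys p \<subseteq> M" "Poly_Mapping.keys q \<subseteq> M"
      using pq by (auto simp: mpoly_vars_def M_def)
    have eq: "c p ` Poly_Mapping.keys p = c q ` Poly_Mapping.keys q"
      using pq(3) fs unfolding e_def by (auto dest!: inj_onD)
    have "t \<in> Poly_Mapping.keys q \<and> Poly_Mapping.lookup p t = Poly_Mapping.lookup q t"
      if "t \<in> Poly_Mapping.keys p" for t
    proof -
      have "c p t \<in> c q ` Poly_Mapping.keys q" unfolding eq[symmetric] using that by (rule imageI)
      then obtain t' where "t' \<in> Poly_Mapping.keys q" "c p t = c q t'" by (metis imageE)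
      then show ?thesis using c_eq that keys by blast
    qed
    moreover have "t \<in> Poly_Mapping.keys p" if "t \<in> Poly_Mapping.keys q" for t
    proof -
      have "c q t \<in> c p ` Poly_Mapping.keys p" unfolding eq using that by (rule imageI)
      then obtain t' where "t' \<in> Poly_Mapping.keys p" "c p t' = c q t" by (metis imageE)
      then show ?thesis using c_eq that keys by blast
    qed
    ultimately show "p = q" by (intro poly_mapping_eqI) (metis in_keys_iff)
  qed
  then show ?thesis by blast
qed

lemma exists_inj_poly:
  assumes "infinite (UNIV :: 'u::zero set)"
  shows "\<exists>e :: 'u poly \<Rightarrow> 'u. inj e"
proof -
  obtain f :: "'u list \<Rightarrow> 'u" where f: "inj f" using exists_inj_lists[OF assms] by blast
  have "inj (\<lambda>q :: 'u poly. f (coeffs q))"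
    by (rule injI) (simp add: inj_eq[OF f] coeffs_eq_iff)
  then show ?thesis by blast
qed

text \<open>
  The fraction field of \<open>S / Q\<close>, for a prime ideal \<open>Q\<close> of a ring \<open>S\<close>, with carrier moved into the
  type \<open>'u\<close> along an injection \<open>e\<close>: a fraction is represented by the code of one of its
  representing pairs.
\<close>

locale coded_fractions =
  fixes m :: nat and S Q :: "'z::comm_ring_1 set" and \<delta> :: "nat \<Rightarrow> 'z \<Rightarrow> 'z" and e :: "'z \<times> 'z \<Rightarrow> 'u"
  assumes S_one: "1 \<in> S" and S_minus: "x \<in> S \<Longrightarrow> - x \<in> S"
    and S_add: "x \<in> S \<Longrightarrow> y \<in> S \<Longrightarrow> x + y \<in> S"
    and S_mult: "x \<in> S \<Longrightarrow> y \<in> S \<Longrightarrow> x * y \<in> S"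
    and S_deriv: "k \<in> {1..m} \<Longrightarrow> x \<in> S \<Longrightarrow> \<delta> k x \<in> S"
    and Q_subset: "Q \<subseteq> S" and Q_zero: "0 \<in> Q" and Q_one: "1 \<notin> Q"
    and Q_add: "x \<in> Q \<Longrightarrow> y \<in> Q \<Longrightarrow> x + y \<in> Q"
    and Q_mult: "x \<in> S \<Longrightarrow> y \<in> Q \<Longrightarrow> x * y \<in> Q"
    and Q_prime: "x \<in> S \<Longrightarrow> y \<in> S \<Longrightarrow> x * y \<in> Q \<Longrightarrow> x \<in> Q \<or> y \<in> Q"
    and Q_deriv: "k \<in> {1..m} \<Longrightarrow> x \<in> Q \<Longrightarrow> \<delta> k x \<in> Q"
    and \<delta>: "k \<in> {1..m} \<Longrightarrow> derivation (\<delta> k)"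
    and \<delta>_commute: "k \<in> {1..m} \<Longrightarrow> l \<in> {1..m} \<Longrightarrow> \<delta> k (\<delta> l x) = \<delta> l (\<delta> k x)"
    and e: "inj_on e (S \<times> S)"
begin

lemma S_zero: "0 \<in> S" using Q_subset Q_zero by blast
lemma S_diff: "x \<in> S \<Longrightarrow> y \<in> S \<Longrightarrow> x - y \<in> S" using S_add[of x "- y"] S_minus by simp
lemma Q_minus: "x \<in> Q \<Longrightarrow> - x \<in> Q" using Q_mult[of "-1" x] S_minus[OF S_one] by simp
lemma Q_diff: "x \<in> Q \<Longrightarrow> y \<in> Q \<Longrightarrow> x - y \<in> Q" using Q_add[of x "- y"] Q_minus by simp

lemmas S_closed = S_zero S_one S_minus S_add S_diff S_mult S_deriv

definition "T = S - Q"

lemma T_iff: "t \<in> T \<longleftrightarrow> t \<in> S \<and> t \<notin> Q" by (simp add: T_def)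
lemma T_S: "t \<in> T \<Longrightarrow> t \<in> S" by (simp add: T_iff)
lemma T_one: "1 \<in> T" using S_one Q_one by (simp add: T_iff)
lemma T_mult: "s \<in> T \<Longrightarrow> t \<in> T \<Longrightarrow> s * t \<in> T" using S_mult Q_prime unfolding T_iff by blast

text \<open>The set from which \<open>SOME\<close> chooses depends only on the class of
  \<open>(s, t)\<close>, so equal fractions receive the same code; injectivity of \<open>e\<close>
  separates different ones.\<close>

definition fr :: "'z \<Rightarrow> 'z \<Rightarrow> 'u" where
  "fr s t = e (SOME q. q \<in> S \<times> T \<and> s * snd q - fst q * t \<in> Q)"

lemma frac_rep:
  assumes "s \<in> S" "t \<in> T"
  shows "\<exists>s' t'. s' \<in> S \<and> t' \<in> T \<and> s * t' - s' * t \<in> Q \<and> fr s t = e (s', t')"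
proof -
  let ?P = "\<lambda>q. q \<in> S \<times> T \<and> s * snd q - fst q * t \<in> Q"
  have "?P (s, t)" using assms Q_zero by simp
  then have P: "?P (SOME q. ?P q)" by (rule someI)
  obtain s' t' where eq: "(SOME q. ?P q) = (s', t')" by fastforce
  have "fr s t = e (s', t')" unfolding fr_def eq ..
  with P show ?thesis unfolding eq by auto
qed

text \<open>Primality of \<open>Q\<close> enters here: a combination of the two given differences is
  \<open>t2\<close> times the wanted one, and \<open>t2\<close> lies outside
  \<open>Q\<close>.\<close>

lemma rel_trans:
  assumes "s1 \<in> S" "t1 \<in> T" "s2 \<in> S" "t2 \<in> T" "s3 \<in> S" "t3 \<in> T"
    and "s1 * t2 - s2 * t1 \<in> Q" "s2 * t3 - s3 * t2 \<in> Q"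
  shows "s1 * t3 - s3 * t1 \<in> Q"
proof -
  have "t3 * (s1 * t2 - s2 * t1) + t1 * (s2 * t3 - s3 * t2) \<in> Q"
    using assms by (intro Q_add Q_mult) (auto simp: T_iff)
  also have "t3 * (s1 * t2 - s2 * t1) + t1 * (s2 * t3 - s3 * t2) = t2 * (s1 * t3 - s3 * t1)"
    by (simp add: algebra_simps)
  finally show ?thesis using Q_prime[of t2 "s1 * t3 - s3 * t1"] assms S_closed by (auto simp: T_iff)
qed

lemma rel_sym: "s1 * t2 - s2 * t1 \<in> Q \<Longrightarrow> s2 * t1 - s1 * t2 \<in> Q"
  using Q_minus[of "s1 * t2 - s2 * t1"] by simp

lemma frac_eq_iff:
  assumes "s \<in> S" "t \<in> T" "s' \<in> S" "t' \<in> T"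
  shows "fr s t = fr s' t' \<longleftrightarrow> s * t' - s' * t \<in> Q"
proof
  assume eq: "fr s t = fr s' t'"
  obtain a b where ab: "a \<in> S" "b \<in> T" "s * b - a * t \<in> Q" "fr s t = e (a, b)"
    using frac_rep[OF assms(1,2)] by blast
  obtain c d where cd: "c \<in> S" "d \<in> T" "s' * d - c * t' \<in> Q" "fr s' t' = e (c, d)"
    using frac_rep[OF assms(3,4)] by blast
  have "(a, b) = (c, d)" by (rule inj_onD[OF e]) (use eq ab cd in \<open>auto simp: T_iff\<close>)
  then show "s * t' - s' * t \<in> Q"
    using rel_trans[OF assms(1,2) ab(1,2) assms(3,4) ab(3)] rel_sym cd by auto
next
  assume rel: "s * t' - s' * t \<in> Q"
  have *: "q \<in> S \<times> T \<and> s * snd q - fst q * t \<in> Q \<longleftrightarrow> q \<in> S \<times> T \<and> s' * snd q - fst q * t' \<in> Q" for q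
    using rel_trans[OF assms, of "fst q" "snd q"] rel_trans[OF assms(3,4,1,2), of "fst q" "snd q"]
      rel rel_sym[OF rel] by (cases q) auto
  show "fr s t = fr s' t'"
    unfolding fr_def by (intro arg_cong[where f = e] arg_cong[where f = Eps] ext *)
qed

definition num :: "'u \<Rightarrow> 'z" where
  "num x = fst (SOME q. q \<in> S \<times> T \<and> fr (fst q) (snd q) = x)"
definition den :: "'u \<Rightarrow> 'z" where
  "den x = snd (SOME q. q \<in> S \<times> T \<and> fr (fst q) (snd q) = x)"

definition fracs :: "'u set" where
  "fracs = {fr s t | s t. s \<in> S \<and> t \<in> T}"

lemma num_den:
  assumes "x \<in> fracs"
  shows "num x \<in> S" "den x \<in> T" "fr (num x) (den x) = x"
proof -
  let ?P = "\<lambda>q. q \<in> S \<times> T \<and> fr (fst q) (snd q) = x"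
  from assms obtain s t where "?P (s, t)" by (auto simp: fracs_def)
  then have "?P (SOME q. ?P q)" by (rule someI)
  then show "num x \<in> S" "den x \<in> T" "fr (num x) (den x) = x"
    unfolding num_def den_def by auto
qed

lemma frac_in_fracs [intro, simp]: "s \<in> S \<Longrightarrow> t \<in> T \<Longrightarrow> fr s t \<in> fracs"
  unfolding fracs_def by blast

definition L :: "'u ring" where
  "L = \<lparr>carrier = fracs, monoid.mult = (\<lambda>x y. fr (num x * num y) (den x * den y)),
     one = fr 1 1, ring.zero = fr 0 1,
     add = (\<lambda>x y. fr (num x * den y + num y * den x) (den x * den y))\<rparr>"

definition DL :: "nat \<Rightarrow> 'u \<Rightarrow> 'u" where
  "DL k x = fr (\<delta> k (num x) * den x - num x * \<delta> k (den x)) (den x * den x)"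

lemma carrier_L [simp]: "carrier L = fracs"
  and one_L: "\<one>\<^bsub>L\<^esub> = fr 1 1" and zero_L: "\<zero>\<^bsub>L\<^esub> = fr 0 1"
  by (simp_all add: L_def)

lemma mult_frac:
  assumes "s \<in> S" "t \<in> T" "s' \<in> S" "t' \<in> T"
  shows "fr s t \<otimes>\<^bsub>L\<^esub> fr s' t' = fr (s * s') (t * t')"
proof -
  define a where "a = num (fr s t)"
  define b where "b = den (fr s t)"
  define c where "c = num (fr s' t')"
  define d where "d = den (fr s' t')"
  have abcd: "a \<in> S" "b \<in> T" "fr a b = fr s t" "c \<in> S" "d \<in> T" "fr c d = fr s' t'"
    using num_den assms unfolding a_def b_def c_def d_def by auto
  then have "a * t - s * b \<in> Q" "c * t' - s' * d \<in> Q"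
    using frac_eq_iff assms by auto
  then have "(c * t') * (a * t - s * b) + (s * b) * (c * t' - s' * d) \<in> Q"
    using assms abcd by (intro Q_add Q_mult S_mult) (auto simp: T_iff)
  moreover have "(c * t') * (a * t - s * b) + (s * b) * (c * t' - s' * d)
      = (a * c) * (t * t') - (s * s') * (b * d)" by (simp add: algebra_simps)
  ultimately have "fr (a * c) (b * d) = fr (s * s') (t * t')"
    using assms abcd by (subst frac_eq_iff) (auto intro: S_mult T_mult)
  then show ?thesis by (simp add: L_def a_def b_def c_def d_def)
qed

lemma add_frac:
  assumes "s \<in> S" "t \<in> T" "s' \<in> S" "t' \<in> T"
  shows "fr s t \<oplus>\<^bsub>L\<^esub> fr s' t' = fr (s * t' + s' * t) (t * t')"
proof -
  define a where "a = num (fr s t)"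
  define b where "b = den (fr s t)"
  define c where "c = num (fr s' t')"
  define d where "d = den (fr s' t')"
  have abcd: "a \<in> S" "b \<in> T" "fr a b = fr s t" "c \<in> S" "d \<in> T" "fr c d = fr s' t'"
    using num_den assms unfolding a_def b_def c_def d_def by auto
  then have "a * t - s * b \<in> Q" "c * t' - s' * d \<in> Q"
    using frac_eq_iff assms by auto
  then have "(d * t') * (a * t - s * b) + (b * t) * (c * t' - s' * d) \<in> Q"
    using assms abcd by (intro Q_add Q_mult S_mult) (auto simp: T_iff)
  moreover have "(d * t') * (a * t - s * b) + (b * t) * (c * t' - s' * d)
      = (a * d + c * b) * (t * t') - (s * t' + s' * t) * (b * d)" by (simp add: algebra_simps)
  ultimately have "fr (a * d + c * b) (b * d) = fr (s * t' + s' * t) (t * t')"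
    using assms abcd by (subst frac_eq_iff) (auto intro: S_add S_mult T_mult T_S)
  then show ?thesis by (simp add: L_def a_def b_def c_def d_def)
qed

lemma DL_frac:
  assumes "s \<in> S" "t \<in> T" "k \<in> {1..m}"
  shows "DL k (fr s t) = fr (\<delta> k s * t - s * \<delta> k t) (t * t)"
proof -
  define a where "a = num (fr s t)"
  define b where "b = den (fr s t)"
  interpret \<delta>: derivation "\<delta> k" by (rule \<delta>[OF assms(3)])
  have ab: "a \<in> S" "b \<in> T" "fr a b = fr s t"
    using num_den assms unfolding a_def b_def by auto
  then have q: "a * t - s * b \<in> Q" using frac_eq_iff assms by auto
  have S: "a \<in> S" "b \<in> S" "s \<in> S" "t \<in> S" "\<delta> k a \<in> S" "\<delta> k b \<in> S" "\<delta> k s \<in> S" "\<delta> k t \<in> S"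
    using ab assms S_deriv by (auto simp: T_iff)
  \<comment> \<open>For \<open>z = a * t - s * b\<close> this combination is the cross difference of
    the two quotient-rule fractions; it lies in \<open>Q\<close> because \<open>z\<close> and its
    derivative do.\<close>
  have "(b * t) * \<delta> k z - (t * \<delta> k b) * z - (b * \<delta> k t) * z \<in> Q" if "z \<in> Q" for z
    using that Q_deriv[OF assms(3) that] S by (intro Q_diff Q_mult S_mult)
  from this[OF q]
  have "(b * t) * \<delta> k (a * t - s * b) - (t * \<delta> k b) * (a * t - s * b) - (b * \<delta> k t) * (a * t - s * b) \<in> Q" .
  moreover have "(b * t) * \<delta> k (a * t - s * b) - (t * \<delta> k b) * (a * t - s * b) - (b * \<delta> k t) * (a * t - s * b)
     = (\<delta> k a * b - a * \<delta> k b) * (t * t) - (\<delta> k s * t - s * \<delta> k t) * (b * b)"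
    unfolding \<delta>.deriv_diff \<delta>.deriv_mult by (simp add: algebra_simps)
  ultimately have "fr (\<delta> k a * b - a * \<delta> k b) (b * b) = fr (\<delta> k s * t - s * \<delta> k t) (t * t)"
    using assms ab S by (subst frac_eq_iff) (auto intro: S_diff S_mult T_mult)
  then show ?thesis by (simp add: DL_def a_def b_def)
qed

lemma fracsE:
  assumes "x \<in> fracs"
  obtains s t where "s \<in> S" "t \<in> T" "x = fr s t"
  using assms unfolding fracs_def by blast

lemma frac_eqI:
  assumes "s \<in> S" "t \<in> T" "s' \<in> S" "t' \<in> T" "s * t' = s' * t"
  shows "fr s t = fr s' t'"
  using frac_eq_iff[OF assms(1-4)] assms(5) Q_zero by simp

lemma field_L: "field L"
proof -
  note closed = S_add S_mult T_mult T_S S_zero S_one T_one S_minus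
  have ag: "abelian_group L"
  proof (rule abelian_groupI, goal_cases)
    case (1 x y)
    then obtain a b c d where *: "a \<in> S" "b \<in> T" "x = fr a b" "c \<in> S" "d \<in> T" "y = fr c d"
      by (auto elim!: fracsE)
    then show ?case by (simp add: add_frac closed)
  next
    case 2 then show ?case by (simp add: zero_L closed)
  next
    case (3 x y z)
    then obtain a b c d f g where *: "a \<in> S" "b \<in> T" "x = fr a b" "c \<in> S" "d \<in> T" "y = fr c d"
      "f \<in> S" "g \<in> T" "z = fr f g" by (auto elim!: fracsE)
    then show ?case
      by (simp add: add_frac closed)
         (rule frac_eqI; (simp add: closed)?; (simp add: algebra_simps)?)
  next
    case (4 x y)
    then obtain a b c d where *: "a \<in> S" "b \<in> T" "x = fr a b" "c \<in> S" "d \<in> T" "y = fr c d"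
      by (auto elim!: fracsE)
    then show ?case
      by (simp add: add_frac closed)
         (rule frac_eqI; (simp add: closed)?; (simp add: algebra_simps)?)
  next
    case (5 x)
    then show ?case
      by (auto elim!: fracsE simp: zero_L add_frac closed)
  next
    case (6 x)
    then obtain a b where *: "a \<in> S" "b \<in> T" "x = fr a b" by (auto elim!: fracsE)
    then have "fr (- a) b \<oplus>\<^bsub>L\<^esub> x = \<zero>\<^bsub>L\<^esub>"
      by (simp add: add_frac zero_L closed)
         (rule frac_eqI; (simp add: closed)?; (simp add: algebra_simps)?)
    then show ?case using * by (intro bexI[of _ "fr (- a) b"]) (auto simp: closed)
  qed
  have cm: "Group.comm_monoid L"
  proof (rule comm_monoidI, goal_cases)
    case (1 x y)
    then obtain a b c d where *: "a \<in> S" "b \<in> T" "x = fr a b" "c \<in> S" "d \<in> T" "y = fr c d"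
      by (auto elim!: fracsE)
    then show ?case by (simp add: mult_frac closed)
  next
    case 2 then show ?case by (simp add: one_L closed)
  next
    case (3 x y z)
    then show ?case
      by (auto elim!: fracsE simp: mult_frac closed mult.assoc)
  next
    case (4 x) then show ?case
      by (auto elim!: fracsE simp: one_L mult_frac closed)
  next
    case (5 x y) then show ?case
      by (auto elim!: fracsE simp: mult_frac closed mult.commute)
  qed
  have "cring L"
  proof (rule cringI[OF ag cm], goal_cases)
    case (1 x y z)
    then obtain a b c d f g where *: "a \<in> S" "b \<in> T" "x = fr a b" "c \<in> S" "d \<in> T" "y = fr c d"
      "f \<in> S" "g \<in> T" "z = fr f g" by (auto elim!: fracsE)
    then show ?case
      by (simp add: add_frac mult_frac closed)
         (rule frac_eqI; (simp add: closed)?; (simp add: algebra_simps)?)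
  qed
  moreover have "\<zero>\<^bsub>L\<^esub> \<noteq> \<one>\<^bsub>L\<^esub>"
    using frac_eq_iff[OF S_zero T_one S_one T_one] Q_one Q_minus[of "-1"] by (auto simp: zero_L one_L)
  moreover have "\<exists>y\<in>carrier L. x \<otimes>\<^bsub>L\<^esub> y = \<one>\<^bsub>L\<^esub>" if x: "x \<in> carrier L" "x \<noteq> \<zero>\<^bsub>L\<^esub>" for x
  proof -
    from x obtain a b where *: "a \<in> S" "b \<in> T" "x = fr a b" by (auto elim!: fracsE)
    then have "a \<in> T" using x(2) frac_eq_iff[OF *(1,2) S_zero T_one] unfolding zero_L T_iff by auto
    moreover have "x \<otimes>\<^bsub>L\<^esub> fr b a = \<one>\<^bsub>L\<^esub>"
      using * \<open>a \<in> T\<close>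
      by (simp add: mult_frac one_L closed)
         (rule frac_eqI; (simp add: closed)?; (simp add: algebra_simps)?)
    ultimately show ?thesis using * by (intro bexI[of _ "fr b a"]) (auto simp: closed)
  qed
  ultimately show "field L" by (rule cring.cring_fieldI2)
qed

lemma differential_field_L: "differential_field L m DL"
proof -
  note closed = S_add S_mult T_mult T_S S_diff S_deriv
  have "differential_field_axioms L m DL"
  proof (unfold_locales, goal_cases)
    case (1 k x)
    then obtain a b where "a \<in> S" "b \<in> T" "x = fr a b" by (auto elim!: fracsE)
    then show ?case using 1(1) by (simp add: DL_frac closed del: atLeastAtMost_iff)
  next
    case (2 k x y)
    then obtain a b c d where *: "a \<in> S" "b \<in> T" "x = fr a b" "c \<in> S" "d \<in> T" "y = fr c d"
      by (auto elim!: fracsE)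
    interpret \<delta>: derivation "\<delta> k" by (rule \<delta>[OF 2(1)])
    show ?case using * 2(1)
      by (simp add: DL_frac add_frac closed del: atLeastAtMost_iff)
         (rule frac_eqI; (simp add: closed)?; (simp add: algebra_simps \<delta>.deriv_add \<delta>.deriv_mult)?)
  next
    case (3 k x y)
    then obtain a b c d where *: "a \<in> S" "b \<in> T" "x = fr a b" "c \<in> S" "d \<in> T" "y = fr c d"
      by (auto elim!: fracsE)
    interpret \<delta>: derivation "\<delta> k" by (rule \<delta>[OF 3(1)])
    show ?case using * 3(1)
      by (simp add: DL_frac add_frac mult_frac closed del: atLeastAtMost_iff)
         (rule frac_eqI; (simp add: closed)?; (simp add: algebra_simps \<delta>.deriv_add \<delta>.deriv_mult)?)
  next
    case (4 k l x)
    then obtain a b where *: "a \<in> S" "b \<in> T" "x = fr a b"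
      by (auto elim!: fracsE)
    interpret k: derivation "\<delta> k" by (rule \<delta>[OF 4(1)])
    interpret l: derivation "\<delta> l" by (rule \<delta>[OF 4(2)])
    show ?case using * 4(1,2)
      by (simp add: DL_frac closed del: atLeastAtMost_iff)
         (rule frac_eqI; (simp add: closed)?;
           (simp add: algebra_simps k.deriv_diff k.deriv_mult l.deriv_diff l.deriv_mult
             \<delta>_commute[OF 4(1,2)])?)
  qed
  then show ?thesis using field_L by (simp add: differential_field_def)
qed

lemma inv_fr:
  assumes "t \<in> T"
  shows "inv\<^bsub>L\<^esub> (fr t 1) = fr 1 t" "fr t 1 \<noteq> \<zero>\<^bsub>L\<^esub>"
proof -
  interpret L: field L by (rule field_L)
  have "fr t 1 \<otimes>\<^bsub>L\<^esub> fr 1 t = \<one>\<^bsub>L\<^esub>"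
    using assms by (simp add: mult_frac one_L S_one T_one T_S) (rule frac_eqI; simp add: S_one T_one T_S)
  then show "inv\<^bsub>L\<^esub> (fr t 1) = fr 1 t"
    using assms by (intro L.comm_inv_char) (auto simp: S_one T_one T_S)
  show "fr t 1 \<noteq> \<zero>\<^bsub>L\<^esub>"
    using frac_eq_iff[OF _ T_one S_zero T_one, of t] assms by (auto simp: zero_L T_iff)
qed

lemma fr_hom:
  assumes "s \<in> S" "t \<in> S"
  shows "fr (s + t) 1 = fr s 1 \<oplus>\<^bsub>L\<^esub> fr t 1" "fr (s * t) 1 = fr s 1 \<otimes>\<^bsub>L\<^esub> fr t 1"
  using assms by (simp_all add: add_frac mult_frac T_one)

lemma DL_fr:
  assumes "s \<in> S" "k \<in> {1..m}"
  shows "DL k (fr s 1) = fr (\<delta> k s) 1"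
  using assms by (simp add: DL_frac T_one derivation.deriv_one[OF \<delta>])

text \<open>\<open>gen\<close> says that \<open>S\<close> is generated by \<open>B\<close> as a
  differential ring. For a differential subfield containing the image of \<open>B\<close>, the
  elements of \<open>S\<close> mapped into it are closed under all operations, hence are all of
  \<open>S\<close>; inverses then give all fractions.\<close>

lemma fr_generated:
  assumes gen: "\<And>S'. \<lbrakk>1 \<in> S'; \<And>x y. x \<in> S' \<Longrightarrow> y \<in> S' \<Longrightarrow> x + y \<in> S' \<and> x * y \<in> S';
      \<And>k x. k \<in> {1..m} \<Longrightarrow> x \<in> S' \<Longrightarrow> \<delta> k x \<in> S'; B \<subseteq> S'\<rbrakk> \<Longrightarrow> S \<subseteq> S'"
    and B: "B \<subseteq> S"
  shows "diff_field_generated L m DL ((\<lambda>s. fr s 1) ` B) = carrier L"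
proof
  interpret L: field L by (rule field_L)
  interpret D: differential_field L m DL by (rule differential_field_L)
  show "diff_field_generated L m DL ((\<lambda>s. fr s 1) ` B) \<subseteq> carrier L"
    unfolding diff_field_generated_def
    by (rule Inter_lower) (use B L.carrier_is_subfield D.D_closed T_one in auto)
  show "carrier L \<subseteq> diff_field_generated L m DL ((\<lambda>s. fr s 1) ` B)"
    unfolding diff_field_generated_def
  proof (rule Inter_greatest)
    fix M assume "M \<in> {F. subfield F L \<and> (\<forall>k\<in>{1..m}. DL k ` F \<subseteq> F) \<and> (\<lambda>s. fr s 1) ` B \<subseteq> F}"
    then have M: "subfield M L" "\<And>k x. k \<in> {1..m} \<Longrightarrow> x \<in> M \<Longrightarrow> DL k x \<in> M" "(\<lambda>s. fr s 1) ` B \<subseteq> M"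
      by blast+
    note sub = subringE[OF subfieldE(1)[OF M(1)]]
    have "S \<subseteq> {s \<in> S. fr s 1 \<in> M}"
    proof (rule gen, goal_cases)
      case 1 show ?case using sub(3) by (simp add: one_L S_one)
    next
      case (2 x y) then show ?case using sub(6,7) by (simp add: fr_hom S_add S_mult)
    next
      case (3 k x) then show ?case using M(2)[of k "fr x 1"] by (simp add: DL_fr S_deriv)
    next
      case 4 then show ?case using M(3) B by auto
    qed
    then have S: "fr s 1 \<in> M" if "s \<in> S" for s using that by blast
    show "carrier L \<subseteq> M"
    proof
      fix x assume "x \<in> carrier L"
      then obtain s t where st: "s \<in> S" "t \<in> T" "x = fr s t" by (auto elim!: fracsE)
      have "fr 1 t \<in> M"
        using L.subfield_m_inv(1)[OF M(1), of "fr t 1"] S[of t] inv_fr[of t] st by (simp add: T_S)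
      moreover have "x = fr s 1 \<otimes>\<^bsub>L\<^esub> fr 1 t" using st by (simp add: mult_frac S_one T_one)
      ultimately show "x \<in> M" using sub(6) S st by blast
    qed
  qed
qed

end

text \<open>The fraction field of \<open>S / Q\<close> is a finitely generated differential
  extension of \<open>F\<close> through \<open>j\<close>, so semiuniversality embeds it over
  \<open>F\<close>. The composite from \<open>S\<close> has kernel exactly \<open>Q\<close>, since
  nonzero fractions are invertible.\<close>

lemma coded_fractions_realization:
  fixes dU :: "nat \<Rightarrow> 'u::field \<Rightarrow> 'u" and j :: "'u \<Rightarrow> 'z::comm_ring_1" and e :: "'z \<times> 'z \<Rightarrow> 'u"
  assumes "coded_fractions m S Q \<delta> e"
    and semi: "semiuniversal_over (ring_of_type_algebra :: 'u ring) m dU F"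
    and j_S: "j ` F \<subseteq> S" and j_one: "j 1 = 1"
    and j_hom: "\<And>x y. x \<in> F \<Longrightarrow> y \<in> F \<Longrightarrow> j (x + y) = j x + j y \<and> j (x * y) = j x * j y"
    and j_deriv: "\<And>k x. k \<in> {1..m} \<Longrightarrow> x \<in> F \<Longrightarrow> j (dU k x) = \<delta> k (j x)"
    and A: "finite A" "A \<subseteq> S"
    and gen: "\<And>S'. \<lbrakk>1 \<in> S'; \<And>x y. x \<in> S' \<Longrightarrow> y \<in> S' \<Longrightarrow> x + y \<in> S' \<and> x * y \<in> S';
      \<And>k x. k \<in> {1..m} \<Longrightarrow> x \<in> S' \<Longrightarrow> \<delta> k x \<in> S'; j ` F \<union> A \<subseteq> S'\<rbrakk> \<Longrightarrow> S \<subseteq> S'"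
  shows "\<exists>h. h 1 = 1 \<and> (\<forall>s\<in>S. \<forall>t\<in>S. h (s + t) = h s + h t \<and> h (s * t) = h s * h t) \<and>
     (\<forall>k\<in>{1..m}. \<forall>s\<in>S. h (\<delta> k s) = dU k (h s)) \<and> (\<forall>s\<in>S. h s = 0 \<longleftrightarrow> s \<in> Q) \<and>
     (\<forall>x\<in>F. h (j x) = x)"
proof -
  interpret coded_fractions m S Q \<delta> e by fact
  let ?U = "ring_of_type_algebra :: 'u ring"
  let ?\<phi> = "\<lambda>x. fr (j x) 1"
  have hom: "differential_hom m (?U\<lparr>carrier := F\<rparr>) dU L DL ?\<phi>"
    unfolding differential_hom_def
  proof (intro conjI ballI ring_hom_memI)
    fix x assume "x \<in> carrier (?U\<lparr>carrier := F\<rparr>)"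
    then show "?\<phi> x \<in> carrier L" using j_S T_one by auto
  next
    fix x y assume "x \<in> carrier (?U\<lparr>carrier := F\<rparr>)" "y \<in> carrier (?U\<lparr>carrier := F\<rparr>)"
    then show "?\<phi> (x \<otimes>\<^bsub>?U\<lparr>carrier := F\<rparr>\<^esub> y) = ?\<phi> x \<otimes>\<^bsub>L\<^esub> ?\<phi> y"
      and "?\<phi> (x \<oplus>\<^bsub>?U\<lparr>carrier := F\<rparr>\<^esub> y) = ?\<phi> x \<oplus>\<^bsub>L\<^esub> ?\<phi> y"
      using j_S j_hom by (auto simp: ring_of_type_algebra_def fr_hom image_subset_iff)
  next
    show "?\<phi> \<one>\<^bsub>?U\<lparr>carrier := F\<rparr>\<^esub> = \<one>\<^bsub>L\<^esub>" by (simp add: ring_of_type_algebra_def j_one one_L)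
  next
    fix k x assume "k \<in> {1..m}" "x \<in> carrier (?U\<lparr>carrier := F\<rparr>)"
    then show "?\<phi> (dU k x) = DL k (?\<phi> x)" using j_S by (simp add: j_deriv DL_fr image_subset_iff)
  qed
  have "diff_field_generated L m DL (?\<phi> ` F \<union> (\<lambda>s. fr s 1) ` A) = carrier L"
    using fr_generated[of "j ` F \<union> A"] gen j_S A(2) by (simp add: image_Un image_image)
  moreover have "finite ((\<lambda>s. fr s 1) ` A)" "(\<lambda>s. fr s 1) ` A \<subseteq> carrier L"
    using A T_one by auto
  ultimately obtain \<psi> where \<psi>: "differential_hom m L DL ?U dU \<psi>" "\<forall>x\<in>F. \<psi> (?\<phi> x) = x"
    using semi[unfolded semiuniversal_over_def, rule_format, of L DL ?\<phi>] differential_field_L hom by blast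
  have \<psi>_add: "\<psi> (x \<oplus>\<^bsub>L\<^esub> y) = \<psi> x + \<psi> y" and \<psi>_mult: "\<psi> (x \<otimes>\<^bsub>L\<^esub> y) = \<psi> x * \<psi> y"
    if "x \<in> fracs" "y \<in> fracs" for x y
    using \<psi>(1) that by (auto simp: differential_hom_def ring_hom_def ring_of_type_algebra_def)
  have \<psi>_one: "\<psi> (fr 1 1) = 1"
    using \<psi>(1) by (auto simp: differential_hom_def ring_hom_def ring_of_type_algebra_def one_L)
  have \<psi>_deriv: "\<psi> (DL k x) = dU k (\<psi> x)" if "k \<in> {1..m}" "x \<in> fracs" for k x
    using \<psi>(1) that by (auto simp: differential_hom_def)
  have \<psi>_zero: "\<psi> (fr 0 1) = 0"
  proof -
    have "fr 0 1 \<in> fracs" by (simp add: S_zero T_one)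
    from \<psi>_add[OF this this] fr_hom(1)[OF S_zero S_zero] show ?thesis by (metis add.right_neutral add_left_cancel)
  qed
  define h where "h s = \<psi> (fr s 1)" for s
  have zero: "h s = 0 \<longleftrightarrow> s \<in> Q" if "s \<in> S" for s
  proof
    assume "s \<in> Q"
    then have "fr s 1 = fr 0 1" using frac_eq_iff[of s 1 0 1] that by (simp add: S_zero T_one)
    then show "h s = 0" by (simp add: h_def \<psi>_zero)
  next
    assume "h s = 0"
    show "s \<in> Q"
    proof (rule ccontr)
      assume "s \<notin> Q"
      then have s: "s \<in> T" using that by (simp add: T_iff)
      have "fr s 1 \<otimes>\<^bsub>L\<^esub> fr 1 s = fr 1 1"
        using s that by (simp add: mult_frac S_one T_one) (rule frac_eqI; simp add: S_one T_one)
      then have "h s * \<psi> (fr 1 s) = 1"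
        using \<psi>_mult[of "fr s 1" "fr 1 s"] s that by (simp add: h_def \<psi>_one S_one T_one)
      then show False using \<open>h s = 0\<close> by simp
    qed
  qed
  show ?thesis
  proof (rule exI[of _ h], intro conjI ballI)
    fix s t assume "s \<in> S" "t \<in> S"
    then show "h (s + t) = h s + h t" "h (s * t) = h s * h t"
      by (simp_all add: h_def fr_hom \<psi>_add \<psi>_mult T_one)
  next
    fix k s assume "k \<in> {1..m}" "s \<in> S"
    then show "h (\<delta> k s) = dU k (h s)"
      using \<psi>_deriv[of k "fr s 1"] by (simp add: h_def DL_fr T_one)
  qed (use zero \<psi>(2) \<psi>_one in \<open>auto simp: h_def\<close>)
qed

section \<open>Differential polynomials over an extension\<close>

lemma differential_field_type:
  fixes d :: "nat \<Rightarrow> 'a::field \<Rightarrow> 'a"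
  assumes "differential_field (ring_of_type_algebra :: 'a ring) m d" "k \<in> {1..m}"
  shows "derivation (d k)"
proof -
  interpret differential_field "ring_of_type_algebra :: 'a ring" m d by fact
  show ?thesis
    using D_add[OF assms(2)] D_mult[OF assms(2)]
    by unfold_locales (auto simp: ring_of_type_algebra_def)
qed

lemma differential_field_type_commute:
  fixes d :: "nat \<Rightarrow> 'a::field \<Rightarrow> 'a"
  assumes "differential_field (ring_of_type_algebra :: 'a ring) m d" "k \<in> {1..m}" "l \<in> {1..m}"
  shows "d k (d l x) = d l (d k x)"
proof -
  interpret differential_field "ring_of_type_algebra :: 'a ring" m d by fact
  show ?thesis using D_commute[OF assms(2,3)] by (simp add: ring_of_type_algebra_def)
qed

lemma subring_typeI:
  fixes F :: "'a::comm_ring_1 set"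
  assumes "subring F ring_of_type_algebra"
  shows "0 \<in> F" "1 \<in> F" "x \<in> F \<Longrightarrow> y \<in> F \<Longrightarrow> x + y \<in> F" "x \<in> F \<Longrightarrow> y \<in> F \<Longrightarrow> x * y \<in> F"
    "x \<in> F \<Longrightarrow> - x \<in> F"
proof -
  interpret R: ring "ring_of_type_algebra :: 'a ring" by (rule ring_from_type_algebra)
  show 0: "0 \<in> F" and "1 \<in> F" and "x \<in> F \<Longrightarrow> y \<in> F \<Longrightarrow> x + y \<in> F"
    and "x \<in> F \<Longrightarrow> y \<in> F \<Longrightarrow> x * y \<in> F"
    using subringE[OF assms] by (auto simp: ring_of_type_algebra_def)
  assume x: "x \<in> F"
  have "\<ominus>\<^bsub>ring_of_type_algebra\<^esub> x = - x"
    by (rule R.minus_equality) (auto simp: ring_of_type_algebra_def)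
  then show "- x \<in> F" using subringE(5)[OF assms x] by simp
qed

definition shift :: "nat \<Rightarrow> dvar \<Rightarrow> dvar" where
  "shift k \<alpha> = ((fst \<alpha>)(k := Suc (fst \<alpha> k)), snd \<alpha>)"

lemma shift_dvars: "k \<in> {1..m} \<Longrightarrow> \<alpha> \<in> dvars m n \<Longrightarrow> shift k \<alpha> \<in> dvars m n"
  by (auto simp: shift_def dvars_def multi_indices_def)

lemma shift_commute: "shift k (shift l \<alpha>) = shift l (shift k \<alpha>)"
  by (auto simp: shift_def fun_eq_iff)

lemma mdeg_shift: "k \<in> {1..m} \<Longrightarrow> mdeg m (fst (shift k \<alpha>)) = Suc (mdeg m (fst \<alpha>))"
  unfolding mdeg_def shift_def by (simp add: sum.remove[of _ k])

lemma dvars_induct [consumes 1, case_names zero shift]: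
  assumes "\<alpha> \<in> dvars m n"
    and zero: "\<And>i. i \<in> {1..n} \<Longrightarrow> P (\<lambda>_. 0, i)"
    and shift: "\<And>k \<alpha>. k \<in> {1..m} \<Longrightarrow> \<alpha> \<in> dvars m n \<Longrightarrow> P \<alpha> \<Longrightarrow> P (shift k \<alpha>)"
  shows "P \<alpha>"
  using assms(1)
proof (induction "mdeg m (fst \<alpha>)" arbitrary: \<alpha>)
  case 0
  then have "fst \<alpha> = (\<lambda>_. 0)" by (auto simp: mdeg_def dvars_def multi_indices_def fun_eq_iff)
  then show ?case using 0 zero[of "snd \<alpha>"] by (cases \<alpha>) (auto simp: dvars_def)
next
  case (Suc d)
  have "\<exists>k\<in>{1..m}. fst \<alpha> k \<noteq> 0"
  proof (rule ccontr)
    assume "\<not> ?thesis"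
    then have "mdeg m (fst \<alpha>) = 0" by (simp add: mdeg_def)
    then show False using Suc(2) by simp
  qed
  then obtain k where k: "k \<in> {1..m}" "fst \<alpha> k \<noteq> 0" by blast
  define \<beta> where "\<beta> = ((fst \<alpha>)(k := fst \<alpha> k - 1), snd \<alpha>)"
  have \<beta>: "shift k \<beta> = \<alpha>" "\<beta> \<in> dvars m n"
    using k Suc(3) by (auto simp: \<beta>_def shift_def dvars_def multi_indices_def)
  then have "P \<beta>" using Suc(1)[of \<beta>] Suc(2) mdeg_shift[OF k(1), of \<beta>] by simp
  then show ?case using shift[OF k(1) \<beta>(2)] \<beta>(1) by simp
qed

lemma countable_dvars: "countable (dvars m n)"
proof -
  have "dvars m n = (\<Union>p. Gamma_upto m n p)" by (auto simp: Gamma_upto_def)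
  moreover have "countable (Gamma_upto m n p)" for p
    by (rule countable_finite) (rule finite_Gamma_upto)
  ultimately show ?thesis by simp
qed

text \<open>The additional derivation acts at the position of \<open>k\<close> in the list and is
  moved to the front past the others, with which it commutes.\<close>

lemma iterated_deriv_list:
  assumes comm: "\<And>j l x. j \<in> {1..m} \<Longrightarrow> l \<in> {1..m} \<Longrightarrow> d j (d l x) = d l (d j x)"
    and "distinct ks" "set ks \<subseteq> {1..m}" "k \<in> set ks"
  shows "foldr (\<lambda>j. d j ^^ (\<xi>(k := Suc (\<xi> k))) j) ks x = d k (foldr (\<lambda>j. d j ^^ \<xi> j) ks x)"
  using assms(2-4)
proof (induction ks)
  case (Cons j ks)
  show ?case
  proof (cases "j = k")
    case True
    then have "foldr (\<lambda>j. d j ^^ (\<xi>(k := Suc (\<xi> k))) j) ks x = foldr (\<lambda>j. d j ^^ \<xi> j) ks x"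
      using Cons.prems by (intro foldr_cong) auto
    then show ?thesis using True by simp
  next
    case False
    have *: "(d j ^^ i) (d k y) = d k ((d j ^^ i) y)" for i y
      using comm[of j k] Cons.prems by (induction i) auto
    show ?thesis using Cons False by (simp add: *)
  qed
qed simp

lemma iterated_deriv_shift:
  assumes "\<And>j l x. j \<in> {1..m} \<Longrightarrow> l \<in> {1..m} \<Longrightarrow> d j (d l x) = d l (d j x)" "k \<in> {1..m}"
  shows "iterated_deriv m d (fst (shift k \<alpha>)) x = d k (iterated_deriv m d (fst \<alpha>) x)"
  unfolding iterated_deriv_def shift_def fst_conv
  by (rule iterated_deriv_list[of m]) (use assms in auto)

lemma iterated_deriv_zero: "iterated_deriv m d (\<lambda>_. 0) x = x"
proof -
  have "foldr (\<lambda>k. d k ^^ 0) ks x = x" for ks :: "nat list" by (induction ks) auto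
  then show ?thesis by (simp add: iterated_deriv_def)
qed

locale differential_extension =
  fixes m n :: nat and dK :: "nat \<Rightarrow> 'k::field_char_0 \<Rightarrow> 'k" and dU :: "nat \<Rightarrow> 'u::field_char_0 \<Rightarrow> 'u"
    and \<iota> :: "'k \<Rightarrow> 'u"
  assumes dK: "differential_field (ring_of_type_algebra :: 'k ring) m dK"
    and univ: "universal_extension m (ring_of_type_algebra :: 'k ring) dK
           (ring_of_type_algebra :: 'u ring) dU \<iota>"
begin

lemma dU: "differential_field (ring_of_type_algebra :: 'u ring) m dU"
  and \<iota>_hom: "differential_hom m (ring_of_type_algebra :: 'k ring) dK (ring_of_type_algebra :: 'u ring) dU \<iota>"
  and semiuniversal: "finite A \<Longrightarrow> semiuniversal_over (ring_of_type_algebra :: 'u ring) m dU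
        (diff_field_generated ring_of_type_algebra m dU (range \<iota> \<union> A))"
  using univ by (auto simp: universal_extension_def ring_of_type_algebra_def)

lemma unital_\<iota>: "unital_hom \<iota>"
  using \<iota>_hom by unfold_locales (auto simp: differential_hom_def ring_hom_def ring_of_type_algebra_def)

sublocale \<iota>: unital_hom \<iota> by (rule unital_\<iota>)

lemma \<iota>_deriv: "k \<in> {1..m} \<Longrightarrow> \<iota> (dK k x) = dU k (\<iota> x)"
  using \<iota>_hom by (auto simp: differential_hom_def ring_of_type_algebra_def)

lemma \<iota>_eq_0_iff [simp]: "\<iota> c = 0 \<longleftrightarrow> c = 0"
proof
  assume "\<iota> c = 0"
  show "c = 0"
  proof (rule ccontr)
    assume "c \<noteq> 0"
    then have "\<iota> c * \<iota> (inverse c) = 1" by (simp flip: \<iota>.hom_mult)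
    then show False using \<open>\<iota> c = 0\<close> by simp
  qed
qed simp

lemma inj_\<iota>: "inj \<iota>"
  by (rule injI) (metis \<iota>.hom_diff \<iota>_eq_0_iff right_minus_eq)

abbreviation dpoly :: "(dvar, 'k) mpoly set" where "dpoly \<equiv> dpolys m n"

definition dd :: "nat \<Rightarrow> (dvar, 'k) mpoly \<Rightarrow> (dvar, 'k) mpoly" where
  "dd k = mderiv (dK k) (\<lambda>\<alpha>. mvar (shift k \<alpha>))"

lemma derivation_dd: "k \<in> {1..m} \<Longrightarrow> derivation (dd k)"
  unfolding dd_def by (intro derivation_mderiv differential_field_type[OF dK])

lemma dd_mconst: "k \<in> {1..m} \<Longrightarrow> dd k (mconst c) = mconst (dK k c)"
  unfolding dd_def by (intro mderiv_mconst differential_field_type[OF dK])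

lemma dd_mvar: "k \<in> {1..m} \<Longrightarrow> dd k (mvar \<alpha>) = mvar (shift k \<alpha>)"
  unfolding dd_def by (intro mderiv_mvar differential_field_type[OF dK])

lemma mpoly_vars_dd:
  assumes "k \<in> {1..m}" "mpoly_vars f \<subseteq> V" "V \<subseteq> V'" "\<And>\<alpha>. \<alpha> \<in> V \<Longrightarrow> shift k \<alpha> \<in> V'"
  shows "mpoly_vars (dd k f) \<subseteq> V'"
  unfolding dd_def
  by (rule mpoly_vars_mderiv[OF differential_field_type[OF dK assms(1)] assms(2,3)]) (use assms(4) in auto)

lemma dd_commute:
  assumes kl: "k \<in> {1..m}" "l \<in> {1..m}"
  shows "dd k (dd l f) = dd l (dd k f)"
proof -
  interpret k: derivation "dd k" by (rule derivation_dd[OF kl(1)])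
  interpret l: derivation "dd l" by (rule derivation_dd[OF kl(2)])
  have "mpoly_vars f \<subseteq> UNIV" by simp
  then show ?thesis
  proof (induction f rule: mpoly_induct)
    case (const c)
    then show ?case using kl by (simp add: dd_mconst differential_field_type_commute[OF dK kl])
  next
    case (var v)
    then show ?case using kl by (simp add: dd_mvar shift_commute[of k])
  next
    case (add p q)
    then show ?case by (simp add: k.deriv_add l.deriv_add)
  next
    case (mult p q)
    then show ?case by (simp add: k.deriv_add l.deriv_add k.deriv_mult l.deriv_mult algebra_simps)
  qed
qed

lemma dpoly_closed:
  shows "f \<in> dpoly \<Longrightarrow> g \<in> dpoly \<Longrightarrow> f + g \<in> dpoly" "f \<in> dpoly \<Longrightarrow> g \<in> dpoly \<Longrightarrow> f * g \<in> dpoly"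
    "f \<in> dpoly \<Longrightarrow> - f \<in> dpoly" "mconst c \<in> dpoly" "0 \<in> dpoly" "1 \<in> dpoly"
    "k \<in> {1..m} \<Longrightarrow> f \<in> dpoly \<Longrightarrow> dd k f \<in> dpoly" "\<alpha> \<in> dvars m n \<Longrightarrow> mvar \<alpha> \<in> dpoly"
  unfolding dpolys_def
  by (simp_all add: mpoly_vars_add mpoly_vars_mult)
     (rule mpoly_vars_dd[of _ _ "dvars m n"]; simp add: shift_dvars)

text \<open>The jet of the point \<open>a\<close>: differential evaluation at \<open>a\<close> is
  ordinary evaluation at \<open>pt a\<close>. Keeping \<open>ev\<close> separate allows assignments
  of values that are not known to be jets.\<close>

definition pt :: "(nat \<Rightarrow> 'u) \<Rightarrow> dvar \<Rightarrow> 'u" where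
  "pt a \<alpha> = iterated_deriv m dU (fst \<alpha>) (a (snd \<alpha>))"

abbreviation ev :: "(dvar \<Rightarrow> 'u) \<Rightarrow> (dvar, 'k) mpoly \<Rightarrow> 'u" where "ev \<equiv> mpoly_eval \<iota>"

sublocale ev: unital_hom "ev b" for b by (rule unital_hom_mpoly_eval[OF unital_\<iota>])

lemma ev_mconst [simp]: "ev b (mconst c) = \<iota> c"
  by (rule mpoly_eval_mconst[OF unital_\<iota>])

lemma ev_mvar [simp]: "ev b (mvar \<alpha>) = b \<alpha>"
  by (rule mpoly_eval_mvar[OF unital_\<iota>])

lemma dpoly_eval_eq: "dpoly_eval m \<iota> dU a f = ev (pt a) f"
  unfolding dpoly_eval_def by (rule arg_cong[where f = "\<lambda>b. ev b f"]) (auto simp: pt_def fun_eq_iff)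

lemma pt_shift: "k \<in> {1..m} \<Longrightarrow> pt a (shift k \<alpha>) = dU k (pt a \<alpha>)"
  unfolding pt_def
  by (subst iterated_deriv_shift) (use differential_field_type_commute[OF dU] in \<open>auto simp: shift_def\<close>)

lemma ev_dd:
  assumes k: "k \<in> {1..m}"
  shows "ev (pt a) (dd k f) = dU k (ev (pt a) f)"
proof -
  interpret k: derivation "dd k" by (rule derivation_dd[OF k])
  interpret u: derivation "dU k" by (rule differential_field_type[OF dU k])
  have "mpoly_vars f \<subseteq> UNIV" by simp
  then show ?thesis
  proof (induction f rule: mpoly_induct)
    case (const c)
    then show ?case using k by (simp add: dd_mconst \<iota>_deriv)
  next
    case (var v)
    then show ?case using k by (simp add: dd_mvar pt_shift)
  next
    case (add p q)
    then show ?case by (simp add: k.deriv_add u.deriv_add ev.hom_add)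
  next
    case (mult p q)
    then show ?case by (simp add: k.deriv_mult u.deriv_mult ev.hom_add ev.hom_mult)
  qed
qed

section \<open>Prime differential ideals and their generic points\<close>

definition prime_dideal :: "(dvar, 'k) mpoly set \<Rightarrow> bool" where
  "prime_dideal Q \<longleftrightarrow> Q \<subseteq> dpoly \<and> 0 \<in> Q \<and> 1 \<notin> Q \<and> (\<forall>f\<in>Q. \<forall>g\<in>Q. f + g \<in> Q) \<and>
     (\<forall>f\<in>dpoly. \<forall>g\<in>Q. f * g \<in> Q) \<and> (\<forall>f\<in>dpoly. \<forall>g\<in>dpoly. f * g \<in> Q \<longrightarrow> f \<in> Q \<or> g \<in> Q) \<and>
     (\<forall>k\<in>{1..m}. \<forall>f\<in>Q. dd k f \<in> Q)"

definition dfield :: "'u set \<Rightarrow> 'u set" where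
  "dfield A = diff_field_generated ring_of_type_algebra m dU (range \<iota> \<union> A)"

lemma dfield_incl: "range \<iota> \<subseteq> dfield A" "A \<subseteq> dfield A"
  by (auto simp: dfield_def diff_field_generated_def)

lemma dfield_closed:
  shows "0 \<in> dfield A" "1 \<in> dfield A" "x \<in> dfield A \<Longrightarrow> y \<in> dfield A \<Longrightarrow> x + y \<in> dfield A"
    "x \<in> dfield A \<Longrightarrow> y \<in> dfield A \<Longrightarrow> x * y \<in> dfield A" "x \<in> dfield A \<Longrightarrow> - x \<in> dfield A"
    "k \<in> {1..m} \<Longrightarrow> x \<in> dfield A \<Longrightarrow> dU k x \<in> dfield A"
  unfolding dfield_def diff_field_generated_def
  by (auto intro!: subring_typeI dest: subfieldE(1) simp del: atLeastAtMost_iff)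

text \<open>The image of the base field is already a differential subfield, so in semiuniversality
  over it every element can be pulled back along \<open>\<iota>\<close> to a constant
  polynomial.\<close>

lemma dfield_empty: "dfield {} = range \<iota>"
proof
  interpret U: field "ring_of_type_algebra :: 'u ring" by (rule field_from_type_algebra)
  interpret K: field "ring_of_type_algebra :: 'k ring" by (rule field_from_type_algebra)
  have "ring_hom_ring (ring_of_type_algebra :: 'k ring) (ring_of_type_algebra :: 'u ring) \<iota>"
    using \<iota>_hom by (intro ring_hom_ringI2) (auto simp: differential_hom_def K.ring_axioms U.ring_axioms)
  then have "subfield (\<iota> ` carrier ring_of_type_algebra) (ring_of_type_algebra :: 'u ring)"
    by (rule ring_hom_ring.img_is_subfield(2)[OF _ K.carrier_is_subfield]) simp
  then have "subfield (range \<iota>) (ring_of_type_algebra :: 'u ring)" by (simp add: ring_of_type_algebra_def)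
  then show "dfield {} \<subseteq> range \<iota>"
    unfolding dfield_def diff_field_generated_def
    by (intro Inter_lower) (auto simp flip: \<iota>_deriv)
qed (rule dfield_incl)

text \<open>Existence of a generic point. The fraction field of the differential polynomial ring
  modulo \<open>Q\<close> is generated by the classes of the indeterminates and embeds over the base
  field; the images of these classes are the coordinates.\<close>

lemma realize_prime_dideal:
  assumes Q: "prime_dideal Q"
  shows "\<exists>b\<in>affine_space n. \<forall>f\<in>dpoly. ev (pt b) f = 0 \<longleftrightarrow> f \<in> Q"
proof -
  have inf: "infinite (UNIV :: 'u set)" by (rule infinite_UNIV_char_0)
  obtain e0 :: "(dvar, 'k) mpoly \<Rightarrow> 'u" where e0: "inj_on e0 dpoly"
    using exists_inj_mpoly[OF inf countable_dvars inj_\<iota>, of m n] by (auto simp: dpolys_def)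
  obtain e where e: "inj_on (e :: (dvar, 'k) mpoly \<times> (dvar, 'k) mpoly \<Rightarrow> 'u) (dpoly \<times> dpoly)"
    using exists_inj_on_Times[OF inf e0] by blast
  have cf: "coded_fractions m dpoly Q dd e"
    by (rule coded_fractions.intro)
       (use Q e in \<open>auto simp: prime_dideal_def dpoly_closed dd_commute derivation_dd\<close>)
  define j :: "'u \<Rightarrow> (dvar, 'k) mpoly" where "j x = mconst (inv_into UNIV \<iota> x)" for x
  have j_\<iota>: "j (\<iota> c) = mconst c" for c by (simp add: j_def inv_f_f[OF inj_\<iota>])
  define A where "A = (\<lambda>i. mvar (\<lambda>_. 0, i) :: (dvar, 'k) mpoly) ` {1..n}"
  have "\<exists>h. h 1 = 1 \<and> (\<forall>s\<in>dpoly. \<forall>t\<in>dpoly. h (s + t) = h s + h t \<and> h (s * t) = h s * h t) \<and>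
     (\<forall>k\<in>{1..m}. \<forall>s\<in>dpoly. h (dd k s) = dU k (h s)) \<and> (\<forall>s\<in>dpoly. h s = 0 \<longleftrightarrow> s \<in> Q) \<and>
     (\<forall>x\<in>dfield {}. h (j x) = x)"
  proof (rule coded_fractions_realization[OF cf, where A = A])
    show "semiuniversal_over ring_of_type_algebra m dU (dfield {})"
      using semiuniversal[of "{}"] by (simp add: dfield_def)
    show "j ` dfield {} \<subseteq> dpoly" "finite A" by (auto simp: j_def dpoly_closed A_def)
    show "j 1 = 1" using j_\<iota>[of 1] by simp
    show "j (x + y) = j x + j y \<and> j (x * y) = j x * j y" if "x \<in> dfield {}" "y \<in> dfield {}" for x y
      using that by (auto simp: dfield_empty j_\<iota> mconst_add mconst_mult simp flip: \<iota>.hom_add \<iota>.hom_mult)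
    show "j (dU k x) = dd k (j x)" if "k \<in> {1..m}" "x \<in> dfield {}" for k x
      using that by (auto simp: dfield_empty j_\<iota> dd_mconst simp flip: \<iota>_deriv)
    show "A \<subseteq> dpoly" by (auto simp: A_def dvars_def multi_indices_def intro!: dpoly_closed)
    fix S' assume S': "1 \<in> S'" "\<And>x y. x \<in> S' \<Longrightarrow> y \<in> S' \<Longrightarrow> x + y \<in> S' \<and> x * y \<in> S'"
      "\<And>k x. k \<in> {1..m} \<Longrightarrow> x \<in> S' \<Longrightarrow> dd k x \<in> S'" "j ` dfield {} \<union> A \<subseteq> S'"
    have const: "mconst c \<in> S'" for c using S'(4) by (auto simp: dfield_empty j_\<iota> image_subset_iff)
    have var: "mvar \<alpha> \<in> S'" if "\<alpha> \<in> dvars m n" for \<alpha>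
      using that
    proof (induction rule: dvars_induct)
      case (zero i)
      then show ?case using S'(4) by (auto simp: A_def)
    next
      case (shift k \<alpha>)
      then show ?case using S'(3)[of k "mvar \<alpha>"] by (simp add: dd_mvar del: atLeastAtMost_iff)
    qed
    show "dpoly \<subseteq> S'"
    proof
      fix f assume "f \<in> dpoly"
      then have "mpoly_vars f \<subseteq> dvars m n" by (simp add: dpolys_def)
      then show "f \<in> S'" by (induction f rule: mpoly_induct) (use const var S'(2) in auto)
    qed
  qed
  then obtain h where h1: "h 1 = 1"
    and hom: "\<And>s t. s \<in> dpoly \<Longrightarrow> t \<in> dpoly \<Longrightarrow> h (s + t) = h s + h t"
      "\<And>s t. s \<in> dpoly \<Longrightarrow> t \<in> dpoly \<Longrightarrow> h (s * t) = h s * h t"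
    and hd: "\<And>k s. k \<in> {1..m} \<Longrightarrow> s \<in> dpoly \<Longrightarrow> h (dd k s) = dU k (h s)"
    and h0: "\<And>s. s \<in> dpoly \<Longrightarrow> h s = 0 \<longleftrightarrow> s \<in> Q" and hj: "\<And>x. x \<in> dfield {} \<Longrightarrow> h (j x) = x"
    by blast
  define b where "b = (\<lambda>i\<in>{1..n}. h (mvar (\<lambda>_. 0, i)))"
  \<comment> \<open>As \<open>h\<close> commutes with the derivations, the jet of \<open>b\<close>
    consists of the images of all derivatives.\<close>
  have pt: "pt b \<alpha> = h (mvar \<alpha>)" if "\<alpha> \<in> dvars m n" for \<alpha>
    using that
  proof (induction rule: dvars_induct)
    case (zero i)
    then show ?case by (simp add: pt_def b_def iterated_deriv_zero)
  next
    case (shift k \<alpha>)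
    then show ?case using hd[of k "mvar \<alpha>"]
      by (simp add: pt_shift dd_mvar dpoly_closed del: atLeastAtMost_iff)
  qed
  have "ev (pt b) f = h f" if "f \<in> dpoly" for f
  proof -
    have "mpoly_vars f \<subseteq> dvars m n" using that by (simp add: dpolys_def)
    then show ?thesis
    proof (induction f rule: mpoly_induct)
      case (const c)
      then show ?case using hj[of "\<iota> c"] by (simp add: dfield_empty j_\<iota>)
    next
      case (var v) then show ?case by (simp add: pt)
    qed (auto simp: ev.hom_add ev.hom_mult hom dpolys_def)
  qed
  moreover have "b \<in> affine_space n" by (simp add: b_def affine_space_def)
  ultimately show ?thesis using h0 by (intro bexI[of _ b]) auto
qed

text \<open>The transcendental element is the image of an indeterminate with zero derivatives.\<close>

lemma exists_transcendental:
  assumes "finite A"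
  shows "\<exists>t. \<forall>q. (\<forall>i. coeff q i \<in> dfield A) \<and> poly q t = 0 \<longrightarrow> q = 0"
proof -
  have inf: "infinite (UNIV :: 'u set)" by (rule infinite_UNIV_char_0)
  obtain e0 :: "'u poly \<Rightarrow> 'u" where e0: "inj e0" using exists_inj_poly[OF inf] by blast
  obtain e :: "'u poly \<times> 'u poly \<Rightarrow> 'u" where e: "inj e"
    using exists_inj_on_Times[OF inf e0] by auto
  \<comment> \<open>Polynomials in one indeterminate over the differential field; below,
    \<open>\<delta>\<close> acts on coefficients only. The kernel will be zero, so the image of the
    indeterminate satisfies no relation over that field.\<close>
  define S where "S = {q. \<forall>i. coeff q i \<in> dfield A}"
  define \<delta> where "\<delta> k = map_poly (dU k)" for k
  have d: "derivation (dU k)" if "k \<in> {1..m}" for k using differential_field_type[OF dU that] .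
  have coeff_\<delta>: "coeff (\<delta> k q) i = dU k (coeff q i)" if "k \<in> {1..m}" for k q i
    using derivation.deriv_zero[OF d[OF that]] by (simp add: \<delta>_def coeff_map_poly)
  have dsum: "dU k (\<Sum>i\<in>B. f i) = (\<Sum>i\<in>B. dU k (f i))" if "k \<in> {1..m}" for k B and f :: "nat \<Rightarrow> 'u"
    using derivation.deriv_zero[OF d[OF that]] derivation.deriv_add[OF d[OF that]]
    by (induction B rule: infinite_finite_induct) auto
  have sumF: "(\<Sum>i\<in>B. f i) \<in> dfield A" if "\<And>i. i \<in> B \<Longrightarrow> f i \<in> dfield A" for B and f :: "nat \<Rightarrow> 'u"
    using that by (induction B rule: infinite_finite_induct) (auto simp: dfield_closed)
  have S_mult: "x * y \<in> S" if "x \<in> S" "y \<in> S" for x y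
    using that by (auto simp: S_def coeff_mult intro!: sumF dfield_closed)
  have S_const: "[:c:] \<in> S \<longleftrightarrow> c \<in> dfield A" for c
    unfolding S_def by (auto simp: coeff_pCons dfield_closed split: nat.splits dest: spec[of _ 0])
  have \<delta>_der: "derivation (\<delta> k)" if k: "k \<in> {1..m}" for k
    by unfold_locales
       (auto intro!: poly_eqI simp: coeff_\<delta>[OF k] derivation.deriv_add[OF d[OF k]] coeff_mult dsum[OF k]
          derivation.deriv_mult[OF d[OF k]] sum.distrib)
  have cf: "coded_fractions m S {0} \<delta> e"
  proof (rule coded_fractions.intro, goal_cases)
    case 1 then show ?case by (auto simp: S_def dfield_closed coeff_pCons one_pCons split: nat.splits)
  next
    case (4 x y) then show ?case by (rule S_mult)
  next
    case (5 k x) then show ?case by (simp add: S_def coeff_\<delta> dfield_closed del: atLeastAtMost_iff)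
  next
    case (12 k x) then show ?case using derivation.deriv_zero[OF \<delta>_der] by auto
  next
    case (13 k) then show ?case by (rule \<delta>_der)
  next
    case (14 k l x) then show ?case
      by (intro poly_eqI) (simp add: coeff_\<delta> differential_field_type_commute[OF dU, of k l] del: atLeastAtMost_iff)
  next
    case 15 then show ?case using e by (rule inj_on_subset) simp
  qed (auto simp: S_def dfield_closed)
  have "\<exists>h. h 1 = 1 \<and> (\<forall>s\<in>S. \<forall>t\<in>S. h (s + t) = h s + h t \<and> h (s * t) = h s * h t) \<and>
     (\<forall>k\<in>{1..m}. \<forall>s\<in>S. h (\<delta> k s) = dU k (h s)) \<and> (\<forall>s\<in>S. h s = 0 \<longleftrightarrow> s \<in> {0}) \<and>
     (\<forall>x\<in>dfield A. h [:x:] = x)"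
  proof (rule coded_fractions_realization[OF cf, where A = "{[:0, 1:]}"])
    show "semiuniversal_over ring_of_type_algebra m dU (dfield A)"
      using semiuniversal[OF assms] by (simp add: dfield_def)
    show "(\<lambda>x. [:x:]) ` dfield A \<subseteq> S" using S_const by auto
    show "[:dU k x:] = \<delta> k [:x:]" if "k \<in> {1..m}" for k x
      by (rule poly_eqI) (use that derivation.deriv_zero[OF d[OF that]] in
        \<open>auto simp: coeff_\<delta> coeff_pCons split: nat.splits\<close>)
    show "{[:0, 1:]} \<subseteq> S" by (auto simp: S_def dfield_closed coeff_pCons split: nat.splits)
    fix S' assume S': "1 \<in> S'" "\<And>x y. x \<in> S' \<Longrightarrow> y \<in> S' \<Longrightarrow> x + y \<in> S' \<and> x * y \<in> S'"
      "(\<lambda>x. [:x:]) ` dfield A \<union> {[:0, 1:]} \<subseteq> S'"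
    have "q \<in> S'" if "\<forall>i. coeff q i \<in> dfield A" for q
      using that
    proof (induction q)
      case 0
      have "[:0:] \<in> S'" using S'(3) dfield_closed(1)[of A] by blast
      then show ?case by simp
    next
      case (pCons c q)
      have "c \<in> dfield A" "\<forall>i. coeff q i \<in> dfield A"
        using pCons.prems[rule_format, of 0] pCons.prems[rule_format, of "Suc _"] by auto
      then have "[:c:] + [:0, 1:] * q \<in> S'" using pCons.IH S' by blast
      then show ?case by simp
    qed
    then show "S \<subseteq> S'" by (auto simp: S_def)
  qed (auto simp: one_pCons)
  then obtain h where h1: "h 1 = 1"
    and hom: "\<And>s t. s \<in> S \<Longrightarrow> t \<in> S \<Longrightarrow> h (s + t) = h s + h t"
      "\<And>s t. s \<in> S \<Longrightarrow> t \<in> S \<Longrightarrow> h (s * t) = h s * h t"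
    and h0: "\<And>s. s \<in> S \<Longrightarrow> h s = 0 \<longleftrightarrow> s = 0" and hj: "\<And>x. x \<in> dfield A \<Longrightarrow> h [:x:] = x"
    by blast
  have X: "[:0, 1:] \<in> S" by (auto simp: S_def dfield_closed coeff_pCons split: nat.splits)
  have "h q = poly q (h [:0, 1:])" if "q \<in> S" for q
    using that
  proof (induction q)
    case 0
    have "0 \<in> S" by (simp add: S_def dfield_closed)
    then show ?case using h0 by simp
  next
    case (pCons c q)
    have cq: "c \<in> dfield A" "q \<in> S"
      using pCons.prems unfolding S_def mem_Collect_eq
      by (metis coeff_pCons_0, metis coeff_pCons_Suc)
    have "h (pCons c q) = h ([:c:] + [:0, 1:] * q)" by simp
    also have "\<dots> = c + h [:0, 1:] * h q"
      using hom(1)[of "[:c:]", OF S_const[THEN iffD2, OF cq(1)] S_mult[OF X cq(2)]] hom(2)[OF X cq(2)] hj[OF cq(1)]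
      by (simp only:)
    finally show ?case using pCons.IH cq by simp
  qed
  then show ?thesis using h0 by (intro exI[of _ "h [:0, 1:]"]) (auto simp: S_def)
qed

end

section \<open>Leaders with respect to an orderly ranking\<close>

definition rank_less :: "nat \<Rightarrow> dvar \<Rightarrow> dvar \<Rightarrow> bool" where
  "rank_less m \<alpha> \<beta> \<longleftrightarrow> mdeg m (fst \<alpha>) < mdeg m (fst \<beta>) \<or>
     mdeg m (fst \<alpha>) = mdeg m (fst \<beta>) \<and>
       (less_fun (fst \<alpha>) (fst \<beta>) \<or> fst \<alpha> = fst \<beta> \<and> snd \<alpha> < snd \<beta>)"

lemma rank_less_trans: "rank_less m \<alpha> \<beta> \<Longrightarrow> rank_less m \<beta> \<gamma> \<Longrightarrow> rank_less m \<alpha> \<gamma>"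
  unfolding rank_less_def by (auto intro: less_fun_trans)

lemma rank_less_irrefl: "\<not> rank_less m \<alpha> \<alpha>"
  unfolding rank_less_def by (auto simp: less_fun_irrefl)

lemma rank_less_total:
  assumes "\<alpha> \<in> dvars m n" "\<beta> \<in> dvars m n"
  shows "rank_less m \<alpha> \<beta> \<or> \<alpha> = \<beta> \<or> rank_less m \<beta> \<alpha>"
proof -
  have "{k. fst \<alpha> k \<noteq> fst \<beta> k} \<subseteq> {1..m}"
    using assms by (force simp: dvars_def multi_indices_def)
  then have "finite {k. fst \<alpha> k \<noteq> fst \<beta> k}" by (rule finite_subset) simp
  from less_fun_trichotomy[OF this] show ?thesis
    unfolding rank_less_def by (auto simp: prod_eq_iff)
qed

lemma rank_less_shift:
  assumes "rank_less m \<alpha> \<beta>" "k \<in> {1..m}"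
  shows "rank_less m (shift k \<alpha>) (shift k \<beta>)"
proof -
  have "less_fun (fst (shift k \<alpha>)) (fst (shift k \<beta>))" if "less_fun (fst \<alpha>) (fst \<beta>)"
    using that unfolding less_fun_def shift_def by auto
  then show ?thesis
    using assms unfolding rank_less_def by (auto simp: mdeg_shift) (auto simp: shift_def)
qed

text \<open>The position in the ranking. It is finite because the ranking compares degrees first,
  and it turns induction along the ranking into induction on natural numbers.\<close>

definition rk :: "nat \<Rightarrow> nat \<Rightarrow> dvar \<Rightarrow> nat" where
  "rk m n \<alpha> = card {\<beta> \<in> dvars m n. rank_less m \<beta> \<alpha>}"

lemma finite_rank_less: "finite {\<beta> \<in> dvars m n. rank_less m \<beta> \<alpha>}"
  by (rule finite_subset[OF _ finite_Gamma_upto[of m n "mdeg m (fst \<alpha>)"]])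
     (auto simp: Gamma_upto_def rank_less_def)

lemma rank_less_imp_rk: "\<alpha> \<in> dvars m n \<Longrightarrow> rank_less m \<alpha> \<beta> \<Longrightarrow> rk m n \<alpha> < rk m n \<beta>"
  unfolding rk_def
  by (rule psubset_card_mono[OF finite_rank_less])
     (use rank_less_trans rank_less_irrefl in blast)

lemma rk_less_iff:
  assumes "\<alpha> \<in> dvars m n" "\<beta> \<in> dvars m n"
  shows "rk m n \<alpha> < rk m n \<beta> \<longleftrightarrow> rank_less m \<alpha> \<beta>"
  using rank_less_imp_rk[OF assms(1), of \<beta>] rank_less_imp_rk[OF assms(2), of \<alpha>] rank_less_total[OF assms]
  by auto

lemma rk_inj: "\<alpha> \<in> dvars m n \<Longrightarrow> \<beta> \<in> dvars m n \<Longrightarrow> rk m n \<alpha> = rk m n \<beta> \<Longrightarrow> \<alpha> = \<beta>"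
  using rank_less_total[of \<alpha> m n \<beta>] rank_less_imp_rk[of \<alpha> m n \<beta>] rank_less_imp_rk[of \<beta> m n \<alpha>] by auto

lemma mdeg_less_imp_rk: "\<alpha> \<in> dvars m n \<Longrightarrow> mdeg m (fst \<alpha>) < mdeg m (fst \<beta>) \<Longrightarrow> rk m n \<alpha> < rk m n \<beta>"
  by (rule rank_less_imp_rk) (auto simp: rank_less_def)

lemma exists_unshift:
  assumes "\<alpha> \<in> dvars m n" "\<beta> \<in> dvars m n" "dvar_le \<alpha> \<beta>" "\<alpha> \<noteq> \<beta>"
  shows "\<exists>k\<in>{1..m}. \<exists>\<gamma>\<in>dvars m n. dvar_le \<alpha> \<gamma> \<and> shift k \<gamma> = \<beta>"
proof -
  have "\<exists>k. fst \<alpha> k \<noteq> fst \<beta> k" using assms(3,4) by (auto simp: dvar_le_def prod_eq_iff)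
  then obtain k where k: "fst \<alpha> k < fst \<beta> k"
    using assms(3) by (auto simp: dvar_le_def le_fun_def) (metis le_neq_implies_less)
  then have "k \<in> {1..m}" using assms(2) by (auto simp: dvars_def multi_indices_def)
  moreover define \<gamma> where "\<gamma> = ((fst \<beta>)(k := fst \<beta> k - 1), snd \<beta>)"
  moreover have "\<gamma> \<in> dvars m n" "dvar_le \<alpha> \<gamma>" "shift k \<gamma> = \<beta>"
    using k assms by (auto simp: \<gamma>_def shift_def dvars_def multi_indices_def dvar_le_def le_fun_def)
  ultimately show ?thesis by blast
qed

lemma mdeg_mono: "\<xi> \<le> \<eta> \<Longrightarrow> mdeg m \<xi> \<le> mdeg m \<eta>"
  unfolding mdeg_def le_fun_def by (intro sum_mono) auto

lemma dvar_le_trans: "dvar_le \<alpha> \<beta> \<Longrightarrow> dvar_le \<beta> \<gamma> \<Longrightarrow> dvar_le \<alpha> \<gamma>"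
  by (auto simp: dvar_le_def)

lemma dvar_le_shift: "dvar_le \<alpha> (shift k \<alpha>)"
  by (auto simp: dvar_le_def shift_def le_fun_def)

definition below :: "nat \<Rightarrow> nat \<Rightarrow> dvar \<Rightarrow> dvar set" where
  "below m n v = {\<beta> \<in> dvars m n. rk m n \<beta> < rk m n v}"

lemma finite_below: "finite (below m n v)"
  by (rule inj_on_finite[of "rk m n" _ "{..<rk m n v}"])
     (auto simp: below_def inj_on_def dest: rk_inj)

lemma below_subset_dvars: "below m n v \<subseteq> dvars m n"
  by (auto simp: below_def)

lemma below_subset_Gamma: "v \<in> Gamma_upto m n p \<Longrightarrow> insert v (below m n v) \<subseteq> Gamma_upto m n p"
  using mdeg_less_imp_rk[of v m n]
  by (auto simp: below_def Gamma_upto_def) (meson le_trans linorder_not_less order_less_asym)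

lemma below_shift:
  assumes "\<beta> \<in> below m n v" "v \<in> dvars m n" "k \<in> {1..m}"
  shows "shift k \<beta> \<in> below m n (shift k v)"
  using assms rank_less_shift[OF _ assms(3), of \<beta> v]
  by (auto simp: below_def rk_less_iff shift_dvars simp del: atLeastAtMost_iff)

lemma rk_shift: "v \<in> dvars m n \<Longrightarrow> k \<in> {1..m} \<Longrightarrow> rk m n v < rk m n (shift k v)"
  by (rule mdeg_less_imp_rk) (auto simp: mdeg_shift)

lemma upto_subset_below_shift:
  "v \<in> dvars m n \<Longrightarrow> k \<in> {1..m} \<Longrightarrow> insert v (below m n v) \<subseteq> below m n (shift k v)"
  using rk_shift[of v m n k] by (auto simp: below_def)

lemma mpoly_vars_max:
  assumes "mpoly_vars f \<subseteq> dvars m n" "mpoly_vars f \<noteq> {}"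
  shows "\<exists>v\<in>mpoly_vars f. mpoly_vars f \<subseteq> insert v (below m n v)"
proof -
  have fin: "finite (mpoly_vars f)" by (auto simp: mpoly_vars_def)
  then have "Max (rk m n ` mpoly_vars f) \<in> rk m n ` mpoly_vars f" using assms(2) by (intro Max_in) auto
  then obtain v where "v \<in> mpoly_vars f" "rk m n v = Max (rk m n ` mpoly_vars f)" by auto
  then have v: "v \<in> mpoly_vars f" "\<And>\<beta>. \<beta> \<in> mpoly_vars f \<Longrightarrow> rk m n \<beta> \<le> rk m n v"
    using fin by auto
  have "\<beta> = v \<or> \<beta> \<in> below m n v" if "\<beta> \<in> mpoly_vars f" for \<beta>
  proof (cases "rk m n \<beta> < rk m n v")
    case True then show ?thesis using that assms(1) by (auto simp: below_def)
  next
    case False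
    then have "rk m n \<beta> = rk m n v" using v(2)[OF that] by simp
    then show ?thesis using rk_inj[of \<beta> m n v] that v(1) assms(1) by blast
  qed
  then show ?thesis using v(1) by blast
qed

lemma mpoly_vars_empty:
  fixes f :: "('v, 'k::comm_ring_1) mpoly"
  assumes "mpoly_vars f = {}"
  shows "\<exists>c. f = mconst c"
proof -
  have "mpoly_vars f \<subseteq> {}" using assms by simp
  then show ?thesis
  proof (induction f rule: mpoly_induct)
    case (add p q) then show ?case by (metis mconst_add)
  next
    case (mult p q) then show ?case by (metis mconst_mult)
  qed auto
qed

context differential_extension
begin

abbreviation "low \<equiv> below m n"
abbreviation "rank \<equiv> rk m n"

text \<open>The coefficients of \<open>\<partial>\<^sub>k G(x\<^sub>v)\<close> as a linear polynomial in its new leader \<open>shift k v\<close>.\<close>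

definition prolong :: "nat \<Rightarrow> dvar \<Rightarrow> (dvar, 'k) mpoly poly \<Rightarrow> (dvar, 'k) mpoly poly" where
  "prolong k v G = [:poly (map_poly (dd k) G) (mvar v), poly (pdiff G) (mvar v):]"

lemma poly_prolong:
  assumes "k \<in> {1..m}"
  shows "poly (prolong k v G) (mvar (shift k v)) = dd k (poly G (mvar v))"
  using derivation.deriv_poly[OF derivation_dd[OF assms], of G "mvar v"]
  by (simp add: prolong_def dd_mvar[OF assms] mult.commute)

lemma coeffs_in_map_dd:
  assumes "k \<in> {1..m}" "coeffs_in V G" "V \<subseteq> V'" "\<And>\<alpha>. \<alpha> \<in> V \<Longrightarrow> shift k \<alpha> \<in> V'"
  shows "coeffs_in V' (map_poly (dd k) G)"
  using assms mpoly_vars_dd[OF assms(1) _ assms(3,4)] derivation.deriv_zero[OF derivation_dd[OF assms(1)]]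
  by (auto simp: coeffs_in_def coeff_map_poly simp del: atLeastAtMost_iff)

lemma coeffs_in_prolong:
  assumes "k \<in> {1..m}" "v \<in> dvars m n" "coeffs_in (low v) G"
  shows "coeffs_in (low (shift k v)) (prolong k v G)"
proof -
  have sub: "insert v (low v) \<subseteq> low (shift k v)" using upto_subset_below_shift assms by blast
  have "coeffs_in (low (shift k v)) (map_poly (dd k) G)"
    by (rule coeffs_in_map_dd[OF assms(1,3)]) (use sub below_shift assms in auto)
  moreover have "coeffs_in (low (shift k v)) (pdiff G)"
    using coeffs_in_pdiff[OF assms(3)] coeffs_in_mono sub by blast
  ultimately have "mpoly_vars (poly H (mvar v)) \<subseteq> low (shift k v)" if "H \<in> {map_poly (dd k) G, pdiff G}" for H
    using that sub by (intro mpoly_vars_poly) auto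
  then show ?thesis by (simp add: prolong_def)
qed

lemma dpolyI: "mpoly_vars f \<subseteq> dvars m n \<Longrightarrow> f \<in> dpoly"
  by (simp add: dpolys_def)

lemma low_dpoly: "mpoly_vars f \<subseteq> low v \<Longrightarrow> f \<in> dpoly"
  using below_subset_dvars by (intro dpolyI) blast

lemma upto_dpoly: "v \<in> dvars m n \<Longrightarrow> mpoly_vars f \<subseteq> insert v (low v) \<Longrightarrow> f \<in> dpoly"
  using below_subset_dvars[of m n v] by (intro dpolyI) blast

lemma poly_upto:
  "coeffs_in (low v) G \<Longrightarrow> mpoly_vars (poly G (mvar v) :: (dvar, 'k) mpoly) \<subseteq> insert v (low v)"
  by (rule mpoly_vars_poly[of "low v"]) auto

lemma poly_dpoly: "v \<in> dvars m n \<Longrightarrow> coeffs_in (low v) G \<Longrightarrow> poly G (mvar v) \<in> dpoly"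
  by (rule upto_dpoly[OF _ poly_upto])

definition leader :: "(dvar, 'k) mpoly set \<Rightarrow> dvar \<Rightarrow> bool" where
  "leader P v \<longleftrightarrow> v \<in> dvars m n \<and>
     (\<exists>G. coeffs_in (low v) G \<and> poly G (mvar v) \<in> P \<and> \<not> (\<forall>i. coeff G i \<in> P))"

text \<open>A minimal polynomial of the residue of \<open>v\<close> over the field generated by the
  residues of the lower derivatives, with denominators cleared. Initial and separant must stay
  outside \<open>P\<close> because they will be cancelled.\<close>

definition minimal_poly :: "(dvar, 'k) mpoly set \<Rightarrow> dvar \<Rightarrow> (dvar, 'k) mpoly poly \<Rightarrow> bool" where
  "minimal_poly P v G \<longleftrightarrow> coeffs_in (low v) G \<and> poly G (mvar v) \<in> P \<and> lead_coeff G \<notin> P \<and>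
     Polynomial.degree G > 0 \<and> poly (pdiff G) (mvar v) \<notin> P \<and>
     (\<forall>H. coeffs_in (low v) H \<and> poly H (mvar v) \<in> P \<and> Polynomial.degree H < Polynomial.degree G
        \<longrightarrow> (\<forall>i. coeff H i \<in> P))"

lemma ideal_poly:
  assumes "v \<in> dvars m n"
    and "\<And>f g. f \<in> J \<Longrightarrow> g \<in> J \<Longrightarrow> f + g \<in> J" "\<And>f g. f \<in> dpoly \<Longrightarrow> g \<in> J \<Longrightarrow> f * g \<in> J"
    and "\<forall>i. coeff G i \<in> J"
  shows "poly G (mvar v) \<in> J"
  using assms(4)
proof (induction G)
  case 0
  then show ?case by (metis coeff_0 poly_0)
next
  case (pCons c G)
  have "c \<in> J" "\<forall>i. coeff G i \<in> J"
    using pCons.prems by (metis coeff_pCons_0, metis coeff_pCons_Suc)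
  then show ?case using pCons.IH assms(1-3) by (simp add: dpoly_closed)
qed

text \<open>Pseudo-division by \<open>F\<close>.\<close>

lemma ideal_reduction:
  assumes v: "v \<in> dvars m n" and F: "coeffs_in (low v) F" "Polynomial.degree F > 0" "poly F (mvar v) \<in> I"
    and evF: "ev b (poly F (mvar v)) = 0"
    and I_add: "\<And>f g. f \<in> I \<Longrightarrow> g \<in> I \<Longrightarrow> f + g \<in> I"
    and I_mult: "\<And>f g. f \<in> dpoly \<Longrightarrow> g \<in> I \<Longrightarrow> f * g \<in> I"
    and I_sat: "\<And>g. g \<in> dpoly \<Longrightarrow> ev b g = 0 \<Longrightarrow> lead_coeff F * g \<in> I \<Longrightarrow> g \<in> I"
    and base: "\<And>g. mpoly_vars g \<subseteq> low v \<Longrightarrow> ev b g = 0 \<Longrightarrow> g \<in> I"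
    and minimal: "\<And>H. coeffs_in (low v) H \<Longrightarrow> ev b (poly H (mvar v)) = 0 \<Longrightarrow>
      Polynomial.degree H < Polynomial.degree F \<Longrightarrow> \<forall>i. ev b (coeff H i) = 0"
    and g: "mpoly_vars g \<subseteq> insert v (low v)" "ev b g = 0"
  shows "g \<in> I"
proof -
  have F': "mpoly_vars (coeff F i) \<subseteq> low v" for i using F(1) by (auto simp: coeffs_in_def)
  \<comment> \<open>\<open>I\<close> is kept abstract because the argument serves two choices:
    \<open>P\<close> itself, and the polynomials that vanish at \<open>b\<close> together with one
    derivative.\<close>
  have *: "poly G (mvar v) \<in> I" if "coeffs_in (low v) G" "ev b (poly G (mvar v)) = 0" for G
    using that
  proof (induction "Polynomial.degree G" arbitrary: G rule: less_induct)
    case less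
    have G': "mpoly_vars (coeff G i) \<subseteq> low v" for i using less.prems(1) by (auto simp: coeffs_in_def)
    show ?case
    proof (cases "Polynomial.degree G < Polynomial.degree F")
      case True
      then have "\<forall>i. coeff G i \<in> I"
        using base G' minimal[OF less.prems] by blast
      then show ?thesis using ideal_poly[OF v I_add I_mult] by blast
    next
      case False
      \<comment> \<open>The leading terms cancel, so the degree drops. The value of \<open>H\<close>
        at the variable differs from the initial of \<open>F\<close> times that of \<open>G\<close>
        by a multiple of that of \<open>F\<close>, and \<open>I_sat\<close> removes the initial
        again.\<close>
      define H where "H = Polynomial.smult (lead_coeff F) G -
        Polynomial.monom (lead_coeff G) (Polynomial.degree G - Polynomial.degree F) * F"
      have "coeff H i = 0" if i: "i \<ge> Polynomial.degree G" for i
      proof (cases "i = Polynomial.degree G")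
        case True
        then show ?thesis using False by (simp add: H_def coeff_monom_mult mult.commute[of "lead_coeff F"])
      next
        case neq: False
        then show ?thesis using False i by (simp add: H_def coeff_monom_mult coeff_eq_0)
      qed
      then have degH: "Polynomial.degree H < Polynomial.degree G"
        using False F(2) by (intro le_less_trans[OF degree_le[of "Polynomial.degree G - 1"]]) auto
      have H: "coeffs_in (low v) H"
        unfolding H_def by (intro coeffs_in_diff coeffs_in_mult coeffs_in_smult coeffs_in_monom F less.prems F' G')
      have pH: "poly H (mvar v) = lead_coeff F * poly G (mvar v) -
          poly (Polynomial.monom (lead_coeff G) (Polynomial.degree G - Polynomial.degree F)) (mvar v) * poly F (mvar v)"
        by (simp add: H_def)
      have "ev b (poly H (mvar v)) = 0"
        using less.prems(2) evF by (simp add: pH ev.hom_diff ev.hom_mult)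
      then have "poly H (mvar v) \<in> I" using less.hyps[OF degH H] by blast
      moreover have "poly (Polynomial.monom (lead_coeff G) (Polynomial.degree G - Polynomial.degree F)) (mvar v)
         * poly F (mvar v) \<in> I"
        by (intro I_mult F(3) poly_dpoly v coeffs_in_monom G')
      ultimately have "lead_coeff F * poly G (mvar v) \<in> I"
        using I_add pH by (metis diff_add_cancel)
      then show ?thesis
        using I_sat[OF poly_dpoly[OF v less.prems(1)] less.prems(2)] by blast
    qed
  qed
  obtain G where "coeffs_in (low v) G" "g = poly G (mvar v)"
    using mpoly_univariate[OF g(1)] by blast
  then show ?thesis using * g(2) by blast
qed

text \<open>The counterpart of the reduction when no nontrivial relation involves \<open>v\<close>:
  the coefficients vanish one by one and are handled by \<open>base\<close>.\<close>

lemma ideal_transcendental: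
  assumes v: "v \<in> dvars m n"
    and I_add: "\<And>f g. f \<in> I \<Longrightarrow> g \<in> I \<Longrightarrow> f + g \<in> I"
    and I_mult: "\<And>f g. f \<in> dpoly \<Longrightarrow> g \<in> I \<Longrightarrow> f * g \<in> I"
    and base: "\<And>g. mpoly_vars g \<subseteq> low v \<Longrightarrow> ev b g = 0 \<Longrightarrow> g \<in> I"
    and trans: "\<And>H. coeffs_in (low v) H \<Longrightarrow> ev b (poly H (mvar v)) = 0 \<Longrightarrow> \<forall>i. ev b (coeff H i) = 0"
    and g: "mpoly_vars g \<subseteq> insert v (low v)" "ev b g = 0"
  shows "g \<in> I"
proof -
  obtain G where G: "coeffs_in (low v) G" "g = poly G (mvar v)"
    using mpoly_univariate[OF g(1)] by blast
  have "mpoly_vars (coeff G i) \<subseteq> low v" for i using G(1) by (auto simp: coeffs_in_def)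
  then have "\<forall>i. coeff G i \<in> I" using base trans[OF G(1)] g(2) G(2) by blast
  then show ?thesis using ideal_poly[OF v I_add I_mult] G(2) by blast
qed

end

section \<open>Leaders modulo a prime differential ideal\<close>

locale prime_kernel = differential_extension m n dK dU \<iota>
  for m n :: nat and dK :: "nat \<Rightarrow> 'k::field_char_0 \<Rightarrow> 'k" and dU :: "nat \<Rightarrow> 'u::field_char_0 \<Rightarrow> 'u"
    and \<iota> :: "'k \<Rightarrow> 'u" +
  fixes P :: "(dvar, 'k) mpoly set"
  assumes P: "prime_dideal P"
begin

lemma P_dpoly: "f \<in> P \<Longrightarrow> f \<in> dpoly"
  and P_zero: "0 \<in> P" and P_one: "1 \<notin> P"
  and P_add: "f \<in> P \<Longrightarrow> g \<in> P \<Longrightarrow> f + g \<in> P"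
  and P_mult: "h \<in> dpoly \<Longrightarrow> g \<in> P \<Longrightarrow> h * g \<in> P"
  and P_prime: "f \<in> dpoly \<Longrightarrow> g \<in> dpoly \<Longrightarrow> f * g \<in> P \<Longrightarrow> f \<in> P \<or> g \<in> P"
  and P_dd: "k \<in> {1..m} \<Longrightarrow> f \<in> P \<Longrightarrow> dd k f \<in> P"
  using P unfolding prime_dideal_def by blast+

lemma P_poly:
  assumes "v \<in> dvars m n" "\<forall>i. coeff G i \<in> P"
  shows "poly G (mvar v) \<in> P"
  by (rule ideal_poly[OF assms(1) P_add P_mult assms(2)])

text \<open>A nontrivial relation of least degree is taken. If its leading coefficient were in
  \<open>P\<close>, the leading term could be dropped; if its separant were in \<open>P\<close>, the
  formal derivative would be a relation of smaller degree, forcing its coefficients into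
  \<open>P\<close>.\<close>

lemma exists_minimal_poly:
  assumes "leader P v"
  shows "\<exists>G. minimal_poly P v G"
proof -
  let ?C = "\<lambda>G. coeffs_in (low v) G \<and> poly G (mvar v) \<in> P \<and> \<not> (\<forall>i. coeff G i \<in> P)"
  have v: "v \<in> dvars m n" and "\<exists>G. ?C G" using assms by (auto simp: leader_def)
  then obtain G where G: "?C G" and min: "\<And>H. ?C H \<Longrightarrow> Polynomial.degree G \<le> Polynomial.degree H"
    using exists_least_iff[of "\<lambda>d. \<exists>G. ?C G \<and> Polynomial.degree G = d"] by (metis linorder_not_less)
  have G': "mpoly_vars (coeff G i) \<subseteq> low v" for i using G by (auto simp: coeffs_in_def)
  have lower: "\<forall>i. coeff H i \<in> P" if "coeffs_in (low v) H" "poly H (mvar v) \<in> P"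
    "Polynomial.degree H < Polynomial.degree G" for H
    using min[of H] that by auto
  have deg: "Polynomial.degree G > 0"
  proof (rule ccontr)
    assume "\<not> ?thesis"
    then obtain c where "G = [:c:]" by (auto elim: degree_eq_zeroE)
    then show False using G P_zero by (auto simp: coeff_pCons split: nat.splits) (metis gr0_conv_Suc)
  qed
  have lc: "lead_coeff G \<notin> P"
  proof
    assume lc: "lead_coeff G \<in> P"
    define H where "H = G - Polynomial.monom (lead_coeff G) (Polynomial.degree G)"
    have "coeff H i = 0" if "i \<ge> Polynomial.degree G" for i
      using that by (cases "i = Polynomial.degree G") (auto simp: H_def coeff_eq_0)
    then have "Polynomial.degree H < Polynomial.degree G"
      using deg by (intro le_less_trans[OF degree_le[of "Polynomial.degree G - 1"]]) auto
    moreover have "coeffs_in (low v) H"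
      unfolding H_def using G G' by (intro coeffs_in_diff coeffs_in_monom) auto
    moreover have "poly (Polynomial.monom (- lead_coeff G) (Polynomial.degree G)) (mvar v) \<in> P"
      using lc P_mult[of "-1" "lead_coeff G"] P_zero
      by (intro P_poly[OF v]) (auto simp: dpoly_closed)
    then have "poly H (mvar v) \<in> P"
      using P_add[of "poly G (mvar v)"] G by (fastforce simp: H_def poly_monom)
    ultimately have H: "\<forall>i. coeff H i \<in> P" using lower by blast
    have "coeff G i \<in> P" for i
    proof -
      have "coeff G i = coeff H i + (if i = Polynomial.degree G then lead_coeff G else 0)"
        by (simp add: H_def)
      also have "\<dots> \<in> P" by (rule P_add) (use H lc P_zero in auto)
      finally show ?thesis .
    qed
    then show False using G by blast
  qed
  have "poly (pdiff G) (mvar v) \<notin> P"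
  proof
    assume "poly (pdiff G) (mvar v) \<in> P"
    then have "\<forall>i. coeff (pdiff G) i \<in> P"
      using lower[of "pdiff G"] coeffs_in_pdiff G degree_pdiff_less[OF deg] by blast
    then have "coeff (pdiff G) (Polynomial.degree G - 1) \<in> P" by blast
    then have "of_nat (Polynomial.degree G) * lead_coeff G \<in> P"
      using deg by (simp add: coeff_pdiff)
    \<comment> \<open>Characteristic zero: the degree is invertible, so the leading coefficient
      itself would lie in \<open>P\<close>.\<close>
    then have "mconst (1 / of_nat (Polynomial.degree G)) * (of_nat (Polynomial.degree G) * lead_coeff G) \<in> P"
      by (rule P_mult[OF dpoly_closed(4)])
    moreover have "mconst (1 / of_nat (Polynomial.degree G)) * of_nat (Polynomial.degree G) = (1 :: (dvar, 'k) mpoly)"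
      using deg by (simp flip: unital_hom.hom_of_nat[OF unital_hom_mconst] mconst_mult)
    ultimately show False using lc by (simp add: mult.assoc[symmetric])
  qed
  then show ?thesis using G lc deg lower unfolding minimal_poly_def by blast
qed

text \<open>Differentiating a minimal polynomial gives a relation linear in the next derivative,
  whose leading coefficient is the separant and hence outside \<open>P\<close>.\<close>

lemma leader_shift:
  assumes "leader P v" "k \<in> {1..m}"
  shows "leader P (shift k v)"
proof -
  obtain G where G: "minimal_poly P v G" using exists_minimal_poly[OF assms(1)] by blast
  have v: "v \<in> dvars m n" using assms(1) by (simp add: leader_def)
  have "coeffs_in (low (shift k v)) (prolong k v G)"
    by (rule coeffs_in_prolong[OF assms(2) v]) (use G in \<open>simp add: minimal_poly_def\<close>)
  moreover have "poly (prolong k v G) (mvar (shift k v)) \<in> P"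
    using G assms(2) by (simp only: poly_prolong) (simp add: P_dd minimal_poly_def)
  moreover have "coeff (prolong k v G) 1 \<notin> P"
    using G by (simp add: prolong_def minimal_poly_def)
  ultimately show ?thesis using shift_dvars[OF assms(2) v] unfolding leader_def by blast
qed

lemma leader_mono:
  assumes "leader P \<alpha>" "dvar_le \<alpha> \<beta>" "\<beta> \<in> dvars m n"
  shows "leader P \<beta>"
  using assms(2,3)
proof (induction "mdeg m (fst \<beta>)" arbitrary: \<beta> rule: less_induct)
  case less
  show ?case
  proof (cases "\<alpha> = \<beta>")
    case False
    then obtain k \<gamma> where k: "k \<in> {1..m}" "\<gamma> \<in> dvars m n" "dvar_le \<alpha> \<gamma>" "shift k \<gamma> = \<beta>"
      using exists_unshift[of \<alpha> m n \<beta>] less.prems assms(1) by (auto simp: leader_def)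
    then have "leader P \<gamma>" using less.hyps[of \<gamma>] mdeg_shift[OF k(1), of \<gamma>] by auto
    then show ?thesis using leader_shift k by blast
  qed (use assms(1) in simp)
qed

definition minimal_leaders :: "dvar set" where
  "minimal_leaders = {\<alpha>. leader P \<alpha> \<and> (\<forall>\<beta>. leader P \<beta> \<and> dvar_le \<beta> \<alpha> \<longrightarrow> \<beta> = \<alpha>)}"

lemma antichain_minimal_leaders: "antichain m n minimal_leaders"
proof -
  have "leader P \<alpha> \<Longrightarrow> \<alpha> \<in> dvars m n" for \<alpha> by (simp add: leader_def)
  then show ?thesis unfolding antichain_def minimal_leaders_def by blast
qed

lemma dvar_le_mdeg:
  assumes "dvar_le \<alpha> \<beta>" "\<alpha> \<noteq> \<beta>" "\<alpha> \<in> dvars m n" "\<beta> \<in> dvars m n"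
  shows "mdeg m (fst \<alpha>) < mdeg m (fst \<beta>)"
proof -
  obtain k \<gamma> where k: "k \<in> {1..m}" "\<gamma> \<in> dvars m n" "dvar_le \<alpha> \<gamma>" "shift k \<gamma> = \<beta>"
    using exists_unshift assms by blast
  then have "mdeg m (fst \<alpha>) \<le> mdeg m (fst \<gamma>)" by (auto simp: dvar_le_def mdeg_mono)
  then show ?thesis using k mdeg_shift[OF k(1), of \<gamma>] by simp
qed

lemma exists_minimal_leader:
  assumes "leader P \<beta>"
  shows "\<exists>\<alpha>\<in>minimal_leaders. dvar_le \<alpha> \<beta>"
  using assms
proof (induction "mdeg m (fst \<beta>)" arbitrary: \<beta> rule: less_induct)
  case less
  show ?case
  proof (cases "\<beta> \<in> minimal_leaders")
    case False
    then obtain \<gamma> where \<gamma>: "leader P \<gamma>" "dvar_le \<gamma> \<beta>" "\<gamma> \<noteq> \<beta>"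
      using less.prems by (auto simp: minimal_leaders_def)
    then have "mdeg m (fst \<gamma>) < mdeg m (fst \<beta>)"
      using dvar_le_mdeg less.prems by (auto simp: leader_def)
    then show ?thesis using less.hyps \<gamma> dvar_le_trans by blast
  qed (use dvar_le_refl in blast)
qed

end

section \<open>Algebraic closure as a matroid closure\<close>

definition is_subfield :: "'u::field set \<Rightarrow> bool" where
  "is_subfield F \<longleftrightarrow> 1 \<in> F \<and> (\<forall>x\<in>F. - x \<in> F \<and> inverse x \<in> F) \<and> (\<forall>x\<in>F. \<forall>y\<in>F. x + y \<in> F \<and> x * y \<in> F)"

lemma is_subfieldD:
  assumes "is_subfield F"
  shows "0 \<in> F" "1 \<in> F" "x \<in> F \<Longrightarrow> - x \<in> F" "x \<in> F \<Longrightarrow> inverse x \<in> F"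
    "x \<in> F \<Longrightarrow> y \<in> F \<Longrightarrow> x + y \<in> F" "x \<in> F \<Longrightarrow> y \<in> F \<Longrightarrow> x * y \<in> F" "x \<in> F \<Longrightarrow> y \<in> F \<Longrightarrow> x / y \<in> F"
proof -
  show "1 \<in> F" "x \<in> F \<Longrightarrow> - x \<in> F" "x \<in> F \<Longrightarrow> inverse x \<in> F"
    "x \<in> F \<Longrightarrow> y \<in> F \<Longrightarrow> x + y \<in> F" "x \<in> F \<Longrightarrow> y \<in> F \<Longrightarrow> x * y \<in> F" "x \<in> F \<Longrightarrow> y \<in> F \<Longrightarrow> x / y \<in> F"
    using assms by (auto simp: is_subfield_def divide_inverse)
  have "1 + - 1 \<in> F" using assms unfolding is_subfield_def by blast
  then show "0 \<in> F" by simp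
qed

lemma inv_type:
  fixes x :: "'u::field"
  assumes "x \<noteq> 0"
  shows "inv\<^bsub>ring_of_type_algebra\<^esub> x = inverse x"
proof -
  interpret U: field "ring_of_type_algebra :: 'u ring" by (rule field_from_type_algebra)
  show ?thesis by (rule U.comm_inv_char) (use assms in \<open>auto simp: ring_of_type_algebra_def\<close>)
qed

lemma uminus_type:
  fixes x :: "'u::field"
  shows "\<ominus>\<^bsub>ring_of_type_algebra\<^esub> x = - x"
proof -
  interpret U: field "ring_of_type_algebra :: 'u ring" by (rule field_from_type_algebra)
  show ?thesis by (rule U.minus_equality) (auto simp: ring_of_type_algebra_def)
qed

lemma is_subfield_iff:
  "is_subfield F \<longleftrightarrow> subfield F (ring_of_type_algebra :: 'u::field ring)"
proof
  interpret U: field "ring_of_type_algebra :: 'u ring" by (rule field_from_type_algebra)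
  assume F: "is_subfield F"
  show "subfield F (ring_of_type_algebra :: 'u ring)"
  proof (rule U.subfieldI'[OF U.subringI])
    show "inv\<^bsub>ring_of_type_algebra\<^esub> k \<in> F" if "k \<in> F - {\<zero>\<^bsub>ring_of_type_algebra\<^esub>}" for k
    proof -
      have "k \<noteq> 0" using that by (auto simp: ring_of_type_algebra_def)
      then show ?thesis using that is_subfieldD(4)[OF F] by (simp add: inv_type)
    qed
  qed (use is_subfieldD[OF F] in \<open>auto simp: uminus_type, auto simp: ring_of_type_algebra_def\<close>)
next
  interpret U: field "ring_of_type_algebra :: 'u ring" by (rule field_from_type_algebra)
  assume F: "subfield F (ring_of_type_algebra :: 'u ring)"
  note sub = subring_typeI[OF subfieldE(1)[OF F]]
  have "inverse x \<in> F" if "x \<in> F" for x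
  proof (cases "x = 0")
    case False
    then have "x \<in> F - {\<zero>\<^bsub>ring_of_type_algebra\<^esub>}" using that by (auto simp: ring_of_type_algebra_def)
    from U.subfield_m_inv(1)[OF F this] show ?thesis using False by (simp add: inv_type)
  qed (use sub in simp)
  then show "is_subfield F" using sub by (simp add: is_subfield_def)
qed

definition algebraics :: "'u::field set \<Rightarrow> 'u set" where
  "algebraics F = {x. \<exists>q. q \<noteq> 0 \<and> (\<forall>i. coeff q i \<in> F) \<and> poly q x = 0}"

text \<open>Gives access to the carrier-based theory of algebraic extensions. There a polynomial is
  the list of its coefficients with the leading one first, which explains the reversals.\<close>

lemma algebraics_iff:
  assumes "is_subfield F"
  shows "x \<in> algebraics F \<longleftrightarrow> ring.algebraic (ring_of_type_algebra :: 'u::field ring) F x"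
proof -
  let ?U = "ring_of_type_algebra :: 'u ring"
  interpret U: field ?U by (rule field_from_type_algebra)
  have F: "subring F ?U" using assms is_subfield_iff subfieldE(1) by blast
  have zero: "\<zero>\<^bsub>?U\<^esub> = 0" and carrier: "carrier ?U = UNIV" by (simp_all add: ring_of_type_algebra_def)
  have eval: "U.eval (rev cs) y = poly (Poly cs) y" for cs y
  proof (induction cs)
    case Nil
    show ?case by (simp add: zero)
  next
    case (Cons c cs)
    have "U.eval (rev cs @ [c]) y = U.eval (rev cs) y \<otimes>\<^bsub>?U\<^esub> y \<oplus>\<^bsub>?U\<^esub> c"
      by (rule U.eval_append_aux) (auto simp: ring_of_type_algebra_def)
    moreover have "u \<otimes>\<^bsub>?U\<^esub> y \<oplus>\<^bsub>?U\<^esub> c = u * y + c" for u by (simp add: ring_of_type_algebra_def)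
    ultimately show ?case using Cons by simp
  qed
  show ?thesis
  proof
    assume "x \<in> algebraics F"
    then obtain q where q: "q \<noteq> 0" "\<forall>i. coeff q i \<in> F" "poly q x = 0" by (auto simp: algebraics_def)
    have "set (coeffs q) \<subseteq> F" using q(2) by (auto simp: coeffs_def)
    moreover have "hd (rev (coeffs q)) \<noteq> 0" using q(1) by (simp add: hd_rev last_coeffs_eq_coeff_degree)
    ultimately have "rev (coeffs q) \<in> carrier (F [X]\<^bsub>?U\<^esub>)"
      by (simp add: univ_poly_def polynomial_def zero)
    then have "(U.algebraic over F) x"
      by (rule U.algebraicI) (use q eval[of "coeffs q"] in \<open>auto simp: zero\<close>)
    then show "U.algebraic F x" by (simp add: over_def)
  next
    assume "U.algebraic F x"
    then have "(U.algebraic over F) x" by (simp add: over_def)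
    then obtain cs where cs: "cs \<in> carrier (F [X]\<^bsub>?U\<^esub>)" "cs \<noteq> []" "U.eval cs x = \<zero>\<^bsub>?U\<^esub>"
      using U.algebraicE[OF F, of x] carrier by auto
    then have *: "set cs \<subseteq> F" "hd cs \<noteq> 0" by (auto simp: univ_poly_def polynomial_def zero)
    have "coeff (Poly (rev cs)) i \<in> F" for i
    proof (cases "i < length cs")
      case True
      then have "rev cs ! i \<in> set (rev cs)" by (intro nth_mem) simp
      then show ?thesis using True * by (auto simp: coeff_Poly_eq nth_default_def)
    qed (use is_subfieldD(1)[OF assms] in \<open>simp add: coeff_Poly_eq nth_default_def\<close>)
    moreover have "coeff (Poly (rev cs)) (length cs - 1) \<noteq> 0"
      using cs(2) * by (simp add: coeff_Poly_eq nth_default_def rev_nth hd_conv_nth)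
    then have "Poly (rev cs) \<noteq> 0" by (metis coeff_0)
    moreover have "poly (Poly (rev cs)) x = 0" using eval[of "rev cs" x] cs(3) zero by simp
    ultimately show "x \<in> algebraics F" unfolding algebraics_def by blast
  qed
qed

lemma is_subfield_algebraics:
  assumes "is_subfield F"
  shows "is_subfield (algebraics (F :: 'u::field set))"
proof -
  interpret U: field "ring_of_type_algebra :: 'u ring" by (rule field_from_type_algebra)
  have "algebraics F = {x \<in> carrier ring_of_type_algebra. (U.algebraic over F) x}"
    by (auto simp: algebraics_iff[OF assms] over_def ring_of_type_algebra_def)
  then show ?thesis using U.subfield_of_algebraics assms by (simp add: is_subfield_iff)
qed

lemma algebraics_incl: "is_subfield F \<Longrightarrow> F \<subseteq> algebraics F"
proof
  fix x assume "is_subfield F" "x \<in> F"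
  then show "x \<in> algebraics F"
    unfolding algebraics_def
    by (intro CollectI exI[of _ "[:- x, 1:]"])
       (auto simp: is_subfieldD coeff_pCons split: nat.splits)
qed

lemma algebraics_mono: "F \<subseteq> F' \<Longrightarrow> algebraics F \<subseteq> algebraics F'"
  unfolding algebraics_def by blast

text \<open>The coefficients of an equation over the algebraic elements generate a finite extension
  of \<open>F\<close>; adjoining \<open>x\<close> keeps it finite, so \<open>x\<close> is algebraic
  over \<open>F\<close>.\<close>

lemma algebraics_idem:
  assumes F: "is_subfield (F :: 'u::field set)"
  shows "algebraics (algebraics F) \<subseteq> algebraics F"
proof
  interpret U: field "ring_of_type_algebra :: 'u ring" by (rule field_from_type_algebra)
  fix x assume "x \<in> algebraics (algebraics F)"
  then obtain q where q: "q \<noteq> 0" "\<forall>i. coeff q i \<in> algebraics F" "poly q x = 0"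
    unfolding algebraics_def by blast
  define cs where "cs = coeffs q"
  have F': "subfield F (ring_of_type_algebra :: 'u ring)" using F is_subfield_iff by blast
  have carrier: "carrier (ring_of_type_algebra :: 'u ring) = UNIV" by (simp add: ring_of_type_algebra_def)
  have cs: "(U.algebraic over F) c" if "c \<in> set cs" for c
    using that q(2) algebraics_iff[OF F] by (auto simp: cs_def coeffs_def over_def split: if_splits)
  define E where "E = U.finite_extension F cs"
  have E: "subfield E ring_of_type_algebra"
    unfolding E_def by (rule U.finite_extension_is_subfield[OF F' _ cs]) (simp add: carrier)
  have dimE: "U.finite_dimension F E"
    unfolding E_def by (rule U.finite_extension_finite_dimension(1)[OF F' _ cs]) (simp add: carrier)
  have "set cs \<subseteq> E"
    unfolding E_def by (rule U.finite_extension_mem[OF subfieldE(1)[OF F']]) (simp add: carrier)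
  moreover have E': "is_subfield E" using E is_subfield_iff by blast
  ultimately have "coeff q i \<in> E" for i
    using is_subfieldD(1)[OF E'] by (metis coeff_in_coeffs coeff_0 cs_def coeff_eq_0 linorder_not_le subsetD)
  then have "x \<in> algebraics E" using q unfolding algebraics_def by blast
  then have algE: "(U.algebraic over E) x" using algebraics_iff[OF E'] by (simp add: over_def)
  then have "U.finite_dimension E (U.simple_extension E x)"
    using U.finite_dimension_simple_extension[OF E] carrier by simp
  then have fin: "U.finite_dimension F (U.simple_extension E x)"
    using U.telescopic_base_dim(1)[OF F' E dimE] by blast
  have "(U.algebraic over F) x"
    by (rule U.finite_dimension_imp_algebraic[OF F' U.simple_extension_is_subring fin])
       (use E carrier subfieldE(1)[OF E] U.simple_extension_mem[OF subfieldE(1)[OF E], of x] in auto)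
  then show "x \<in> algebraics F" using algebraics_iff[OF F] by (simp add: over_def)
qed

definition gen_field :: "'u::field set \<Rightarrow> 'u set" where
  "gen_field A = \<Inter>{F. is_subfield F \<and> A \<subseteq> F}"

lemma is_subfield_gen_field: "is_subfield (gen_field A)"
  unfolding gen_field_def is_subfield_def by auto

lemma gen_field_incl: "A \<subseteq> gen_field A"
  unfolding gen_field_def by blast

lemma gen_field_min: "is_subfield F \<Longrightarrow> A \<subseteq> F \<Longrightarrow> gen_field A \<subseteq> F"
  unfolding gen_field_def by blast

definition cl :: "'u::field set \<Rightarrow> 'u set" where "cl A = algebraics (gen_field A)"

lemma is_subfield_cl: "is_subfield (cl A)"
  unfolding cl_def by (rule is_subfield_algebraics[OF is_subfield_gen_field])

lemma cl_incl: "A \<subseteq> cl A"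
  unfolding cl_def using gen_field_incl algebraics_incl[OF is_subfield_gen_field] by blast

lemma cl_least:
  assumes "A \<subseteq> cl B"
  shows "cl A \<subseteq> cl B"
proof -
  have "gen_field A \<subseteq> cl B" using gen_field_min[OF is_subfield_cl assms] .
  then have "cl A \<subseteq> algebraics (cl B)" unfolding cl_def[of A] by (rule algebraics_mono)
  then show ?thesis using algebraics_idem[OF is_subfield_gen_field] unfolding cl_def by blast
qed

lemma cl_mono: "A \<subseteq> B \<Longrightarrow> cl A \<subseteq> cl B"
  using cl_least cl_incl by blast

lemma algebraics_cl: "algebraics (cl A) \<subseteq> cl A"
  unfolding cl_def by (rule algebraics_idem[OF is_subfield_gen_field])

section \<open>Fractions, the exchange property, and the size of independent sets\<close>

definition is_subring :: "'u::field set \<Rightarrow> bool" where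
  "is_subring D \<longleftrightarrow> 1 \<in> D \<and> (\<forall>x\<in>D. - x \<in> D) \<and> (\<forall>x\<in>D. \<forall>y\<in>D. x + y \<in> D \<and> x * y \<in> D)"

lemma is_subfield_fractions:
  assumes "is_subring D"
  shows "is_subfield {x / y | x y. x \<in> D \<and> y \<in> D}"
proof -
  have D: "1 \<in> D" "x \<in> D \<Longrightarrow> - x \<in> D" "x \<in> D \<Longrightarrow> y \<in> D \<Longrightarrow> x + y \<in> D" "x \<in> D \<Longrightarrow> y \<in> D \<Longrightarrow> x * y \<in> D" for x y
    using assms by (auto simp: is_subring_def)
  have "1 + - 1 \<in> D" using D by blast
  then have D0: "0 \<in> D" by simp
  show ?thesis
    unfolding is_subfield_def
  proof (intro conjI ballI, goal_cases)
    case 1 show ?case using D(1) by (intro CollectI exI[of _ 1]) simp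
  next
    case (2 x) then show ?case using D(2) by force
  next
    case (3 x)
    then obtain a b where *: "a \<in> D" "b \<in> D" "x = a / b" by blast
    have "inverse x = b / a" by (simp add: *)
    then show ?case using * by blast
  next
    case (4 x y)
    then obtain a b c d where *: "a \<in> D" "b \<in> D" "c \<in> D" "d \<in> D" "x = a / b" "y = c / d" by blast
    \<comment> \<open>Since \<open>x / 0 = 0\<close>, the set puts no condition on denominators; a
      summand with denominator zero is zero and is split off before the usual addition rule.\<close>
    consider "b = 0" | "d = 0" | "b \<noteq> 0" "d \<noteq> 0" by blast
    then show ?case
    proof cases
      case 1 then show ?thesis using * by auto
    next
      case 2 then show ?thesis using * by auto
    next
      case 3
      then have "x + y = (a * d + c * b) / (b * d)" by (simp add: * add_frac_eq)
      then show ?thesis using * D by blast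
    qed
  next
    case (5 x y)
    then show ?case using D(4) by (auto simp: times_divide_times_eq) blast
  qed
qed

lemma common_denominator:
  assumes D: "is_subring D" and "finite B" "B \<subseteq> {x / y | x y. x \<in> D \<and> y \<in> D}"
  shows "\<exists>d\<in>D. d \<noteq> 0 \<and> (\<forall>b\<in>B. d * b \<in> D)"
  using assms(2,3)
proof (induction B rule: finite_induct)
  case empty
  then show ?case using D by (intro bexI[of _ 1]) (auto simp: is_subring_def)
next
  case (insert b B)
  then obtain d where d: "d \<in> D" "d \<noteq> 0" "\<forall>b\<in>B. d * b \<in> D" by auto
  obtain x y where b: "x \<in> D" "y \<in> D" "b = x / y" using insert.prems by blast
  have mult: "x \<in> D \<Longrightarrow> y \<in> D \<Longrightarrow> x * y \<in> D" for x y using D by (simp add: is_subring_def)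
  show ?case
  proof (cases "y = 0")
    case True
    have "1 + - 1 \<in> D" using D unfolding is_subring_def by blast
    then show ?thesis using True b d by (intro bexI[of _ d]) auto
  next
    case False
    have "y * (d * b') \<in> D" if "b' \<in> B" for b' using d(3) that b(2) mult by blast
    moreover have "y * d * b = x * d" using False b by simp
    ultimately show ?thesis using False d b mult
      by (intro bexI[of _ "y * d"]) (auto simp: mult.assoc)
  qed
qed

lemma algebraics_fractions:
  assumes D: "is_subring D" and "x \<in> algebraics F" and F: "F \<subseteq> {x / y | x y. x \<in> D \<and> y \<in> D}"
  shows "\<exists>q. q \<noteq> 0 \<and> (\<forall>i. coeff q i \<in> D) \<and> poly q x = 0"
proof -
  obtain q where q: "q \<noteq> 0" "\<forall>i. coeff q i \<in> F" "poly q x = 0"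
    using assms(2) by (auto simp: algebraics_def)
  have "finite (range (coeff q))"
    by (rule finite_subset[of _ "insert 0 (coeff q ` {..Polynomial.degree q})"])
       (auto simp: image_iff, metis atMost_iff coeff_eq_0 not_le_imp_less)
  moreover have "range (coeff q) \<subseteq> {x / y | x y. x \<in> D \<and> y \<in> D}" using q(2) F by blast
  ultimately obtain d where "d \<in> D" "d \<noteq> 0" "\<forall>c\<in>range (coeff q). d * c \<in> D"
    using common_denominator[OF D] by meson
  then show ?thesis using q by (intro exI[of _ "Polynomial.smult d q"]) auto
qed

text \<open>A relation for \<open>y\<close> with coefficients polynomial in \<open>x\<close> is
  regrouped by powers of \<open>x\<close>. If all new coefficients vanished at \<open>y\<close>,
  they would be zero polynomials because \<open>y\<close> is transcendental over \<open>F\<close>,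
  and the relation would be trivial. So it is a nonzero relation for \<open>x\<close>.\<close>

lemma cl_exchange:
  assumes y: "y \<in> cl (insert x A)" "y \<notin> cl A"
  shows "x \<in> cl (insert y A)"
proof -
  define F where "F = gen_field A"
  have F: "is_subfield F" unfolding F_def by (rule is_subfield_gen_field)
  define D where "D = {poly f x | f. \<forall>i. coeff f i \<in> F}"
  have sum: "(\<Sum>i\<in>B. f i) \<in> F'" if "is_subfield F'" "\<And>i. i \<in> B \<Longrightarrow> f i \<in> F'" for F' B and f :: "nat \<Rightarrow> 'a"
    using that by (induction B rule: infinite_finite_induct) (auto simp: is_subfieldD)
  have D: "is_subring D"
    unfolding is_subring_def
  proof (intro conjI ballI, goal_cases)
    case 1
    have "\<forall>i. coeff (1 :: 'a poly) i \<in> F" using is_subfieldD(1,2)[OF F] by (simp add: one_pCons coeff_pCons split: nat.splits)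
    then show ?case unfolding D_def by (intro CollectI exI[of _ 1]) simp
  next
    case (2 z)
    then obtain f where "z = poly f x" "\<forall>i. coeff f i \<in> F" by (auto simp: D_def)
    then show ?case unfolding D_def
      by (intro CollectI exI[of _ "- f"]) (auto simp: is_subfieldD[OF F])
  next
    case (3 z w)
    then obtain f g where "z = poly f x" "\<forall>i. coeff f i \<in> F" "w = poly g x" "\<forall>i. coeff g i \<in> F"
      by (auto simp: D_def)
    then show ?case unfolding D_def
      by (intro CollectI exI[of _ "f + g"]) (auto simp: is_subfieldD[OF F])
  next
    case (4 z w)
    then obtain f g where "z = poly f x" "\<forall>i. coeff f i \<in> F" "w = poly g x" "\<forall>i. coeff g i \<in> F"
      by (auto simp: D_def)
    then show ?case unfolding D_def
      by (intro CollectI exI[of _ "f * g"]) (auto simp: coeff_mult intro!: sum[OF F] is_subfieldD[OF F])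
  qed
  have c_D: "c \<in> D" if "c \<in> F" for c
    unfolding D_def using that is_subfieldD(1)[OF F]
    by (intro CollectI exI[of _ "[:c:]"]) (auto simp: coeff_pCons split: nat.splits)
  have x_D: "x \<in> D"
    unfolding D_def using is_subfieldD(1,2)[OF F]
    by (intro CollectI exI[of _ "[:0, 1:]"]) (auto simp: coeff_pCons split: nat.splits)
  have one: "1 \<in> D" using D by (simp add: is_subring_def)
  have "insert x A \<subseteq> {r / s | r s. r \<in> D \<and> s \<in> D}"
  proof
    fix z assume "z \<in> insert x A"
    then have "z \<in> D" using c_D x_D gen_field_incl[of A] by (auto simp: F_def)
    then show "z \<in> {r / s | r s. r \<in> D \<and> s \<in> D}" using one by (intro CollectI exI[of _ z] exI[of _ 1]) simp
  qed
  then have "gen_field (insert x A) \<subseteq> {r / s | r s. r \<in> D \<and> s \<in> D}"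
    by (rule gen_field_min[OF is_subfield_fractions[OF D]])
  from algebraics_fractions[OF D _ this] y(1)
  obtain q where q: "q \<noteq> 0" "\<forall>j. coeff q j \<in> D" "poly q y = 0" unfolding cl_def by blast
  then obtain h where h: "\<And>j i. coeff (h j) i \<in> F" "\<And>j. coeff q j = poly (h j) x"
    unfolding D_def mem_Collect_eq by metis
  define N where "N = Polynomial.degree q"
  define M where "M = Max (Polynomial.degree ` h ` {..N})"
  have M: "Polynomial.degree (h j) \<le> M" if "j \<le> N" for j unfolding M_def using that by (intro Max_ge) auto
  have hx: "poly (h j) z = (\<Sum>i\<le>M. coeff (h j) i * z ^ i)" if "j \<le> N" for j z
    unfolding poly_altdef using M[OF that] by (intro sum.mono_neutral_left) (auto simp: coeff_eq_0)
  \<comment> \<open>The coefficient of the \<open>i\<close>-th power of \<open>x\<close>, as a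
    polynomial in \<open>y\<close>.\<close>
  define s where "s i = (\<Sum>j\<le>N. Polynomial.monom (coeff (h j) i) j)" for i
  have coeff_s: "coeff (s i) j = (if j \<le> N then coeff (h j) i else 0)" for i j
    by (simp add: s_def coeff_sum)
  have poly_s: "poly (s i) y = (\<Sum>j\<le>N. coeff (h j) i * y ^ j)" for i
    by (simp add: s_def poly_sum poly_monom)
  define q' where "q' = (\<Sum>i\<le>M. Polynomial.monom (poly (s i) y) i)"
  have coeff_q': "coeff q' i = (if i \<le> M then poly (s i) y else 0)" for i
    by (simp add: q'_def coeff_sum)
  have "poly q' x = (\<Sum>i\<le>M. (\<Sum>j\<le>N. coeff (h j) i * y ^ j) * x ^ i)"
    by (simp add: q'_def poly_sum poly_monom poly_s)
  also have "\<dots> = (\<Sum>j\<le>N. (\<Sum>i\<le>M. coeff (h j) i * x ^ i) * y ^ j)"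
    unfolding sum_distrib_right by (subst sum.swap) (simp add: mult_ac)
  also have "\<dots> = (\<Sum>j\<le>N. coeff q j * y ^ j)" by (simp add: hx h(2))
  also have "\<dots> = 0" using q(3) by (simp add: poly_altdef N_def)
  finally have root: "poly q' x = 0" .
  have "q' \<noteq> 0"
  proof
    assume "q' = 0"
    have "coeff (h j) i = 0" if "j \<le> N" for i j
    proof (cases "i \<le> M")
      case True
      have "poly (s i) y = 0" using coeff_q'[of i] True \<open>q' = 0\<close> by simp
      moreover have "\<forall>j. coeff (s i) j \<in> F" using h(1) is_subfieldD(1)[OF F] by (simp add: coeff_s)
      ultimately have "s i = 0" using y(2) unfolding cl_def algebraics_def F_def by blast
      then show ?thesis using coeff_s[of i j] that by simp
    next
      case False
      then show ?thesis using M[OF that] by (simp add: coeff_eq_0)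
    qed
    then have "coeff q N = 0" using h(2)[of N] hx[of N x] by simp
    then show False using q(1) by (simp add: N_def)
  qed
  moreover have "coeff q' i \<in> gen_field (insert y A)" for i
  proof -
    have K: "is_subfield (gen_field (insert y A))" by (rule is_subfield_gen_field)
    have FK: "F \<subseteq> gen_field (insert y A)"
      unfolding F_def using gen_field_incl[of "insert y A"] by (intro gen_field_min K) auto
    have yK: "y \<in> gen_field (insert y A)" using gen_field_incl by blast
    have "y ^ j \<in> gen_field (insert y A)" for j by (induction j) (auto simp: is_subfieldD[OF K] yK)
    then show ?thesis using h(1) FK
      by (auto simp: coeff_q' poly_s is_subfieldD[OF K] intro!: sum[OF K] is_subfieldD(6)[OF K])
  qed
  ultimately show ?thesis using root unfolding cl_def algebraics_def by blast
qed

definition cl_independent :: "'u::field set \<Rightarrow> 'u set \<Rightarrow> bool" where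
  "cl_independent A S \<longleftrightarrow> (\<forall>s\<in>S. s \<notin> cl (A \<union> (S - {s})))"

text \<open>Steinitz exchange over the base \<open>A\<close>: an element of \<open>S\<close> outside
  \<open>T\<close> is replaced by one of \<open>T\<close>, preserving size and independence, until
  \<open>S\<close> lies inside \<open>T\<close>.\<close>

lemma steinitz:
  assumes "finite S" "finite T" "cl_independent A S" "S \<subseteq> cl (A \<union> T)"
  shows "card S \<le> card T"
  using assms
proof (induction "card (S - T)" arbitrary: S rule: less_induct)
  case less
  show ?case
  proof (cases "S \<subseteq> T")
    case True
    then show ?thesis using less.prems card_mono by blast
  next
    case False
    then obtain s where s: "s \<in> S" "s \<notin> T" by blast
    define S0 where "S0 = S - {s}"
    have s_ind: "s \<notin> cl (A \<union> S0)" using less.prems(3) s(1) by (auto simp: cl_independent_def S0_def)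
    \<comment> \<open>If \<open>S0\<close> spanned \<open>T\<close> it would span all of
      \<open>S\<close>, including \<open>s\<close>, against independence.\<close>
    have "\<not> T \<subseteq> cl (A \<union> S0)"
    proof
      assume "T \<subseteq> cl (A \<union> S0)"
      then have "A \<union> T \<subseteq> cl (A \<union> S0)" using cl_incl by blast
      then have "cl (A \<union> T) \<subseteq> cl (A \<union> S0)" by (rule cl_least)
      then show False using s_ind less.prems(4) s(1) by blast
    qed
    then obtain t where t: "t \<in> T" "t \<notin> cl (A \<union> S0)" by blast
    have tS0: "t \<notin> S0" using t(2) cl_incl by blast
    have ind: "cl_independent A (insert t S0)"
      unfolding cl_independent_def
    proof
      fix u assume u: "u \<in> insert t S0"
      show "u \<notin> cl (A \<union> (insert t S0 - {u}))"
      proof (cases "u = t")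
        case True
        then show ?thesis using t(2) tS0 by (simp add: insert_Diff_if)
      next
        case False
        then have uS: "u \<in> S0" using u by blast
        define B where "B = A \<union> (S0 - {u})"
        have eq: "A \<union> (insert t S0 - {u}) = insert t B" "insert u B = A \<union> S0"
          using False uS by (auto simp: B_def)
        have "B \<subseteq> A \<union> (S - {u})" by (auto simp: B_def S0_def)
        then have uB: "u \<notin> cl B"
          using less.prems(3) uS cl_mono[of B "A \<union> (S - {u})"] by (auto simp: cl_independent_def S0_def)
        show ?thesis
        proof
          assume "u \<in> cl (A \<union> (insert t S0 - {u}))"
          \<comment> \<open>Exchange turns a dependence of \<open>u\<close> on \<open>t\<close> into
            a dependence of \<open>t\<close> on \<open>S0\<close>.\<close>
          then have "t \<in> cl (insert u B)" using cl_exchange[of u t B] uB by (simp add: eq)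
          then show False using t(2) by (simp add: eq)
        qed
      qed
    qed
    have "insert t S0 - T \<subset> S - T" using s t(1) by (auto simp: S0_def)
    then have "card (insert t S0 - T) < card (S - T)"
      using less.prems(1) by (intro psubset_card_mono) auto
    moreover have "insert t S0 \<subseteq> cl (A \<union> T)"
      using less.prems(4) t(1) cl_incl[of "A \<union> T"] by (auto simp: S0_def)
    ultimately have "card (insert t S0) \<le> card T"
      using less.hyps[of "insert t S0"] less.prems(1,2) ind by (simp add: S0_def)
    moreover have "card (insert t S0) = card S"
      using tS0 s(1) less.prems(1) card_Suc_Diff1[of S s] by (simp add: S0_def)
    ultimately show ?thesis by simp
  qed
qed

section \<open>A prime differential ideal determined by the leaders of bounded degree\<close>

locale truncated_kernel = prime_kernel m n dK dU \<iota> P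
  for m n :: nat and dK :: "nat \<Rightarrow> 'k::field_char_0 \<Rightarrow> 'k" and dU :: "nat \<Rightarrow> 'u::field_char_0 \<Rightarrow> 'u"
    and \<iota> :: "'k \<Rightarrow> 'u" and P :: "(dvar, 'k) mpoly set" +
  fixes a :: "nat \<Rightarrow> 'u" and \<alpha>s :: "dvar list" and p :: nat
  assumes generic: "f \<in> dpoly \<Longrightarrow> ev (pt a) f = 0 \<longleftrightarrow> f \<in> P"
    and \<alpha>s: "set \<alpha>s = minimal_leaders" and D_cond: "D_condition m n \<alpha>s p"
begin

abbreviation "\<Gamma> \<equiv> Gamma_upto m n p"
abbreviation deg :: "dvar \<Rightarrow> nat" where "deg v \<equiv> mdeg m (fst v)"

definition A :: "dvar set" where "A = minimal_leaders \<inter> \<Gamma>"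
text \<open>Up to degree \<open>p\<close> these are exactly the leaders of \<open>P\<close>. Above
  it, leaders of \<open>P\<close> that are no derivatives of earlier ones are deliberately missing:
  in \<open>Q\<close> they will be independent.\<close>

definition E :: "dvar set" where "E = {\<beta> \<in> dvars m n. \<exists>\<alpha>\<in>A. dvar_le \<alpha> \<beta>}"

lemma E_dvars: "v \<in> E \<Longrightarrow> v \<in> dvars m n"
  by (simp add: E_def)

lemma E_leader: "v \<in> E \<Longrightarrow> leader P v"
  unfolding E_def A_def minimal_leaders_def using leader_mono by blast

lemma Gamma_leader:
  assumes "leader P v" "deg v \<le> p"
  shows "v \<in> E"
proof -
  obtain \<alpha> where \<alpha>: "\<alpha> \<in> minimal_leaders" "dvar_le \<alpha> v" using exists_minimal_leader[OF assms(1)] by blast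
  then have "deg \<alpha> \<le> deg v" by (auto simp: dvar_le_def mdeg_mono)
  then have "\<alpha> \<in> A" using \<alpha> assms(2) by (auto simp: A_def Gamma_upto_def minimal_leaders_def leader_def)
  then show ?thesis using \<alpha> assms(1) by (auto simp: E_def leader_def)
qed

lemma E_mono: "\<alpha> \<in> E \<Longrightarrow> dvar_le \<alpha> \<beta> \<Longrightarrow> \<beta> \<in> dvars m n \<Longrightarrow> \<beta> \<in> E"
  unfolding E_def using dvar_le_trans by blast

lemma exists_E_unshift:
  assumes "v \<in> E" "deg v > p"
  shows "\<exists>q. fst q \<in> {1..m} \<and> snd q \<in> E \<and> shift (fst q) (snd q) = v"
proof -
  obtain \<alpha> where \<alpha>: "\<alpha> \<in> A" "dvar_le \<alpha> v" using assms(1) by (auto simp: E_def)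
  then have "\<alpha> \<noteq> v" "\<alpha> \<in> dvars m n" using assms(2) by (auto simp: A_def Gamma_upto_def)
  then obtain k \<gamma> where "k \<in> {1..m}" "\<gamma> \<in> dvars m n" "dvar_le \<alpha> \<gamma>" "shift k \<gamma> = v"
    using exists_unshift[of \<alpha> m n v] \<alpha> E_dvars assms(1) by blast
  then show ?thesis using \<alpha>(1) by (intro exI[of _ "(k, \<gamma>)"]) (auto simp: E_def)
qed

text \<open>One predecessor in \<open>E\<close> is fixed for each element of \<open>E\<close> above
  degree \<open>p\<close>. That any other predecessor would do as well is the content of
  compatibility.\<close>

definition pick :: "dvar \<Rightarrow> nat \<times> dvar" where
  "pick v = (SOME q. fst q \<in> {1..m} \<and> snd q \<in> E \<and> shift (fst q) (snd q) = v)"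

lemma pick:
  assumes "v \<in> E" "deg v > p"
  shows "fst (pick v) \<in> {1..m}" "snd (pick v) \<in> E" "shift (fst (pick v)) (snd (pick v)) = v"
  using someI_ex[OF exists_E_unshift[OF assms]] unfolding pick_def by blast+

text \<open>The counter is \<open>deg v - p\<close>, truncated at zero: minimal polynomials up to
  degree \<open>p\<close>, and above it one prolongation along \<open>pick\<close> for each further
  degree.\<close>

primrec F_iter :: "nat \<Rightarrow> dvar \<Rightarrow> (dvar, 'k) mpoly poly" where
  "F_iter 0 v = (SOME G. minimal_poly P v G)"
| "F_iter (Suc d) v = prolong (fst (pick v)) (snd (pick v)) (F_iter d (snd (pick v)))"

definition F :: "dvar \<Rightarrow> (dvar, 'k) mpoly poly" where "F v = F_iter (deg v - p) v"
definition separant :: "dvar \<Rightarrow> (dvar, 'k) mpoly" where "separant v = poly (pdiff (F v)) (mvar v)"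

lemma F_low: "v \<in> E \<Longrightarrow> deg v \<le> p \<Longrightarrow> minimal_poly P v (F v)"
  using someI_ex[OF exists_minimal_poly[OF E_leader]] by (simp add: F_def)

lemma F_high:
  assumes "v \<in> E" "deg v > p"
  shows "F v = prolong (fst (pick v)) (snd (pick v)) (F (snd (pick v)))"
proof -
  have "deg v = Suc (deg (snd (pick v)))"
    using mdeg_shift[OF pick(1)[OF assms], of "snd (pick v)"] pick(3)[OF assms] by simp
  then have "deg v - p = Suc (deg (snd (pick v)) - p)" using assms(2) by simp
  then show ?thesis by (simp add: F_def)
qed

lemma low_Gamma: "v \<in> dvars m n \<Longrightarrow> deg v \<le> p \<Longrightarrow> insert v (low v) \<subseteq> \<Gamma>"
  by (rule below_subset_Gamma) (simp add: Gamma_upto_def)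

text \<open>Prolonging keeps the separant, which also becomes the leading coefficient. So all
  initials and separants come from degree at most \<open>p\<close>; their variables stay in
  \<open>\<Gamma>\<close>, where membership in \<open>P\<close> can be tested on the values of
  \<open>b\<close>.\<close>

lemma F_props:
  assumes "v \<in> E"
  shows "coeffs_in (low v) (F v) \<and> poly (F v) (mvar v) \<in> P \<and> Polynomial.degree (F v) > 0 \<and>
    lead_coeff (F v) \<notin> P \<and> mpoly_vars (lead_coeff (F v)) \<subseteq> \<Gamma> \<and>
    separant v \<notin> P \<and> mpoly_vars (separant v) \<subseteq> \<Gamma> \<and> (deg v > p \<longrightarrow> Polynomial.degree (F v) = 1)"
  using assms
proof (induction "deg v" arbitrary: v rule: less_induct)
  case less
  have v: "v \<in> dvars m n" using less.prems E_dvars by blast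
  show ?case
  proof (cases "deg v \<le> p")
    case True
    have G: "minimal_poly P v (F v)" by (rule F_low[OF less.prems True])
    then have c: "coeffs_in (low v) (F v)" by (simp add: minimal_poly_def)
    then have "mpoly_vars (lead_coeff (F v)) \<subseteq> low v" by (simp add: coeffs_in_def)
    then have "mpoly_vars (lead_coeff (F v)) \<subseteq> \<Gamma>" using low_Gamma[OF v True] by blast
    moreover have "mpoly_vars (separant v) \<subseteq> \<Gamma>"
      using poly_upto[OF coeffs_in_pdiff[OF c]] low_Gamma[OF v True] unfolding separant_def by blast
    ultimately show ?thesis using G True by (simp add: minimal_poly_def separant_def)
  next
    case False
    define k where "k = fst (pick v)"
    define u where "u = snd (pick v)"
    have k: "k \<in> {1..m}" "u \<in> E" "shift k u = v"
      using pick[OF less.prems] False unfolding k_def u_def by auto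
    have F: "F v = prolong k u (F u)" using F_high less.prems False by (simp add: k_def u_def)
    have IH: "coeffs_in (low u) (F u)" "poly (F u) (mvar u) \<in> P"
      "separant u \<notin> P" "mpoly_vars (separant u) \<subseteq> \<Gamma>"
      using less.hyps[of u] k mdeg_shift[OF k(1), of u] by auto
    have s0: "separant u \<noteq> 0" using IH(3) P_zero by auto
    have Fv: "F v = [:poly (map_poly (dd k) (F u)) (mvar u), separant u:]"
      by (simp add: F prolong_def separant_def)
    have "coeffs_in (low v) (F v)"
      using coeffs_in_prolong[OF k(1) E_dvars[OF k(2)] IH(1)] k(3) by (simp add: F)
    moreover have "poly (F v) (mvar v) \<in> P"
      using poly_prolong[OF k(1), of u "F u"] P_dd[OF k(1) IH(2)] k(3) by (simp add: F)
    moreover have "separant v = separant u" by (simp add: separant_def[of v] Fv pdiff_pCons)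
    ultimately show ?thesis using IH s0 by (simp add: Fv)
  qed
qed

lemma dd_F_pick:
  assumes "v \<in> E" "deg v > p"
  shows "dd (fst (pick v)) (poly (F (snd (pick v))) (mvar (snd (pick v)))) = poly (F v) (mvar v)"
  using poly_prolong[OF pick(1)[OF assms]] pick(3)[OF assms] F_high[OF assms] by metis

section \<open>Values for all derivatives, chosen by recursion on the ranking\<close>

lemma ev_cong: "(\<And>v. v \<in> mpoly_vars f \<Longrightarrow> b v = c v) \<Longrightarrow> ev b f = ev c f"
  by (rule mpoly_eval_cong)

text \<open>The last clause says that \<open>t\<close> is transcendental over the lower values, with
  denominators cleared. Only values of \<open>b\<close> below \<open>v\<close> matter, which allows
  \<open>b\<close> to be constructed by well-founded recursion.\<close>

definition good_value :: "(dvar \<Rightarrow> 'u) \<Rightarrow> dvar \<Rightarrow> 'u \<Rightarrow> bool" where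
  "good_value b v t \<longleftrightarrow> (v \<in> dvars m n \<longrightarrow>
     (if deg v \<le> p then t = pt a v
      else if v \<in> E then ev (b(v := t)) (poly (F v) (mvar v)) = 0
      else (\<forall>G. coeffs_in (low v) G \<and> ev (b(v := t)) (poly G (mvar v)) = 0
              \<longrightarrow> (\<forall>i. ev b (coeff G i) = 0))))"

lemma ev_upd_poly:
  assumes "coeffs_in (low v) G"
  shows "ev (b(v := t)) (poly G (mvar v)) = poly (map_poly (ev b) G) t"
proof -
  have "map_poly (ev (b(v := t))) G = map_poly (ev b) G"
  proof (rule poly_eqI)
    fix i
    have "mpoly_vars (coeff G i) \<subseteq> low v" using assms by (simp add: coeffs_in_def)
    then have "ev (b(v := t)) (coeff G i) = ev b (coeff G i)"
      by (intro ev_cong) (auto simp: below_def)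
    then show "coeff (map_poly (ev (b(v := t))) G) i = coeff (map_poly (ev b) G) i"
      by (simp add: ev.hom_coeff)
  qed
  then show ?thesis by (simp add: ev.hom_poly)
qed

lemma good_value_cong:
  assumes "\<And>\<beta>. \<beta> \<in> low v \<Longrightarrow> b \<beta> = c \<beta>"
  shows "good_value b v t = good_value c v t"
proof -
  have e: "ev b f = ev c f" if "mpoly_vars f \<subseteq> low v" for f
    using that assms by (intro ev_cong) blast
  have eq: "ev (b(v := t)) (poly G (mvar v)) = ev (c(v := t)) (poly G (mvar v))" if "coeffs_in (low v) G" for G
    using poly_upto[OF that] assms by (intro ev_cong) auto
  moreover have "ev b (coeff G i) = ev c (coeff G i)" if "coeffs_in (low v) G" for G i
    using that by (intro e) (simp add: coeffs_in_def)
  ultimately have "(coeffs_in (low v) G \<and> ev (b(v := t)) (poly G (mvar v)) = 0 \<longrightarrow> (\<forall>i. ev b (coeff G i) = 0))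
      \<longleftrightarrow> (coeffs_in (low v) G \<and> ev (c(v := t)) (poly G (mvar v)) = 0 \<longrightarrow> (\<forall>i. ev c (coeff G i) = 0))" for G
    by (cases "coeffs_in (low v) G") auto
  moreover have "v \<in> E \<Longrightarrow> ev (b(v := t)) (poly (F v) (mvar v)) = ev (c(v := t)) (poly (F v) (mvar v))"
    using eq F_props by blast
  ultimately show ?thesis unfolding good_value_def by simp
qed

lemma ev_dfield:
  assumes "mpoly_vars f \<subseteq> V" "b ` V \<subseteq> B"
  shows "ev b f \<in> dfield B"
  using assms(1)
proof (induction f rule: mpoly_induct)
  case (const c) then show ?case using dfield_incl(1) by auto
next
  case (var v) then show ?case using assms(2) dfield_incl(2) by auto
qed (auto simp: ev.hom_add ev.hom_mult dfield_closed)

lemma exists_good_value: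
  assumes IH: "\<And>\<beta>. \<beta> \<in> low v \<Longrightarrow> good_value b \<beta> (b \<beta>)"
  shows "\<exists>t. good_value b v t"
proof (cases "v \<in> dvars m n \<and> deg v > p")
  case False
  then show ?thesis by (intro exI[of _ "pt a v"]) (auto simp: good_value_def)
next
  case v: True
  show ?thesis
  proof (cases "v \<in> E")
    case True
    note Fv = F_props[OF True]
    have "\<Gamma> \<subseteq> low v"
    proof
      fix \<beta> assume "\<beta> \<in> \<Gamma>"
      then have "\<beta> \<in> dvars m n" "deg \<beta> < deg v" using v by (auto simp: Gamma_upto_def)
      then show "\<beta> \<in> low v" using mdeg_less_imp_rk by (simp add: below_def)
    qed
    then have "b \<beta> = pt a \<beta>" if "\<beta> \<in> \<Gamma>" for \<beta>
      using IH[of \<beta>] that by (auto simp: good_value_def Gamma_upto_def)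
    then have "ev b (lead_coeff (F v)) = ev (pt a) (lead_coeff (F v))"
      using Fv by (intro ev_cong) blast
    also have "\<dots> \<noteq> 0"
    proof -
      have "mpoly_vars (lead_coeff (F v)) \<subseteq> low v" using Fv by (simp add: coeffs_in_def)
      then show ?thesis using generic[OF low_dpoly] Fv by blast
    qed
    \<comment> \<open>Above degree \<open>p\<close> the polynomial \<open>F v\<close> is linear, and
      its leading coefficient does not vanish at the values already chosen, so it can be solved for
      the value at \<open>v\<close>.\<close>
    finally have lc: "coeff (map_poly (ev b) (F v)) 1 \<noteq> 0" using Fv v by (simp add: ev.hom_coeff)
    define q where "q = map_poly (ev b) (F v)"
    have "Polynomial.degree q \<le> 1"
      using Fv v by (intro degree_le) (auto simp: q_def ev.hom_coeff coeff_eq_0)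
    then have "q = [:coeff q 0, coeff q 1:]"
      by (intro poly_eqI) (auto simp: coeff_pCons coeff_eq_0 split: nat.splits)
    then have "poly q x = coeff q 0 + x * coeff q 1" for x
      by (metis add_0_right mult_zero_right poly_0 poly_pCons)
    then have "poly q (- coeff q 0 / coeff q 1) = 0" using lc by (simp add: q_def)
    then show ?thesis
      using v True Fv by (intro exI[of _ "- coeff q 0 / coeff q 1"]) (simp add: good_value_def ev_upd_poly q_def)
  next
    case False
    \<comment> \<open>Only finitely many derivatives rank below \<open>v\<close>, so there is an
      element transcendental over the differential field of their values.\<close>
    obtain t where t: "\<And>q. (\<forall>i. coeff q i \<in> dfield (b ` low v)) \<Longrightarrow> poly q t = 0 \<Longrightarrow> q = 0"
      using exists_transcendental[of "b ` low v"] finite_below by blast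
    have "\<forall>i. ev b (coeff G i) = 0" if G: "coeffs_in (low v) G" "ev (b(v := t)) (poly G (mvar v)) = 0" for G
    proof -
      have "ev b (coeff G i) \<in> dfield (b ` low v)" for i
        using G(1) by (intro ev_dfield[of _ "low v"]) (auto simp: coeffs_in_def)
      then have "map_poly (ev b) G = 0"
        using G t[of "map_poly (ev b) G"] by (simp add: ev_upd_poly ev.hom_coeff)
      then show ?thesis by (metis coeff_0 ev.hom_coeff)
    qed
    then show ?thesis using v False by (intro exI[of _ t]) (auto simp: good_value_def)
  qed
qed

lemma exists_good_point: "\<exists>b. \<forall>v. good_value b v (b v)"
proof (rule dependent_wf_choice[where R = "{(\<beta>, v). \<beta> \<in> low v}" and P = good_value])
  show "wf {(\<beta>, v). \<beta> \<in> low v}"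
    by (rule wf_subset[OF wf_measure[of rank]]) (auto simp: below_def)
  show "good_value f x t = good_value g x t" if "\<And>z. (z, x) \<in> {(\<beta>, v). \<beta> \<in> low v} \<Longrightarrow> f z = g z" for f g x t
    using that by (intro good_value_cong) auto
  show "\<exists>t. good_value f x t" if "\<And>y. (y, x) \<in> {(\<beta>, v). \<beta> \<in> low v} \<Longrightarrow> good_value f y (f y)" for f x
    using that by (intro exists_good_value) auto
qed

definition b :: "dvar \<Rightarrow> 'u" where "b = (SOME b. \<forall>v. good_value b v (b v))"

lemma b_good: "good_value b v (b v)"
  using someI_ex[OF exists_good_point] unfolding b_def by blast

lemma b_Gamma: "v \<in> \<Gamma> \<Longrightarrow> b v = pt a v"
  using b_good[of v] by (auto simp: good_value_def Gamma_upto_def)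

lemma ev_Gamma:
  assumes "mpoly_vars f \<subseteq> \<Gamma>"
  shows "ev b f = 0 \<longleftrightarrow> f \<in> P"
proof -
  have "f \<in> dpoly" using assms by (intro dpolyI) (auto simp: Gamma_upto_def)
  moreover have "ev b f = ev (pt a) f" using assms b_Gamma by (intro ev_cong) blast
  ultimately show ?thesis using generic by simp
qed

lemma ev_poly_low:
  assumes "v \<in> dvars m n" "deg v \<le> p" "coeffs_in (low v) G"
  shows "ev b (poly G (mvar v)) = 0 \<longleftrightarrow> poly G (mvar v) \<in> P" "ev b (coeff G i) = 0 \<longleftrightarrow> coeff G i \<in> P"
proof -
  have "mpoly_vars (coeff G i) \<subseteq> low v" using assms(3) by (simp add: coeffs_in_def)
  then show "ev b (poly G (mvar v)) = 0 \<longleftrightarrow> poly G (mvar v) \<in> P" "ev b (coeff G i) = 0 \<longleftrightarrow> coeff G i \<in> P"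
    using poly_upto[OF assms(3)] low_Gamma[OF assms(1,2)] by (intro ev_Gamma; blast)+
qed

lemma ev_F: "v \<in> E \<Longrightarrow> ev b (poly (F v) (mvar v)) = 0"
  using b_good[of v] ev_poly_low[of v "F v"] F_props[of v] E_dvars[of v]
  by (cases "deg v \<le> p") (auto simp: good_value_def)

lemma ev_separant: "v \<in> E \<Longrightarrow> ev b (separant v) \<noteq> 0" "v \<in> E \<Longrightarrow> ev b (lead_coeff (F v)) \<noteq> 0"
  using F_props[of v] ev_Gamma by auto

lemma b_transcendental:
  assumes "v \<in> dvars m n" "v \<notin> E" "coeffs_in (low v) G" "ev b (poly G (mvar v)) = 0"
  shows "\<forall>i. ev b (coeff G i) = 0"
proof (cases "deg v \<le> p")
  case True
  then have "\<not> leader P v" using Gamma_leader assms(2) by blast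
  then have "\<forall>i. coeff G i \<in> P" using assms ev_poly_low[OF assms(1) True assms(3)] by (auto simp: leader_def)
  then show ?thesis using ev_poly_low[OF assms(1) True assms(3)] by simp
next
  case False
  then show ?thesis using b_good[of v] assms by (auto simp: good_value_def)
qed

lemma b_minimal:
  assumes "v \<in> E" "coeffs_in (low v) G" "ev b (poly G (mvar v)) = 0"
    "Polynomial.degree G < Polynomial.degree (F v)"
  shows "\<forall>i. ev b (coeff G i) = 0"
proof (cases "deg v \<le> p")
  case True
  then show ?thesis
    using F_low[OF assms(1) True] assms ev_poly_low[OF E_dvars[OF assms(1)] True assms(2)]
    by (auto simp: minimal_poly_def)
next
  case False
  then have "Polynomial.degree G = 0" using F_props[OF assms(1)] assms(4) by auto
  then obtain c where "G = [:c:]" by (auto elim: degree_eq_zeroE)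
  then show ?thesis using assms(3) by (auto simp: coeff_pCons split: nat.splits)
qed

text \<open>Up to cancelling initials, which lie outside the prime \<open>P\<close>, the relations
  among the values of \<open>b\<close> come from the polynomials \<open>F v\<close>, and these yield
  elements of \<open>P\<close>. The induction runs over the highest variable.\<close>

lemma ker_subset_P:
  assumes "f \<in> dpoly" "ev b f = 0"
  shows "f \<in> P"
proof -
  have base: "g \<in> P" if "mpoly_vars g = {}" "ev b g = 0" for g
    using mpoly_vars_empty[OF that(1)] that(2) P_zero by auto
  have upto: "\<forall>g. mpoly_vars g \<subseteq> insert v (low v) \<and> ev b g = 0 \<longrightarrow> g \<in> P" if "v \<in> dvars m n" for v
    using that
  proof (induction "rank v" arbitrary: v rule: less_induct)
    case less
    have low: "g \<in> P" if g: "mpoly_vars g \<subseteq> low v" "ev b g = 0" for g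
    proof (cases "mpoly_vars g = {}")
      case False
      then obtain u where u: "u \<in> mpoly_vars g" "mpoly_vars g \<subseteq> insert u (low u)"
        using mpoly_vars_max[of g m n] g(1) below_subset_dvars by blast
      then have "rank u < rank v" "u \<in> dvars m n" using g(1) by (auto simp: below_def)
      then show ?thesis using less.hyps u g(2) by blast
    qed (use base g in blast)
    show ?case
    proof (intro allI impI, elim conjE)
      fix g assume g: "mpoly_vars g \<subseteq> insert v (low v)" "ev b g = 0"
      show "g \<in> P"
      proof (cases "v \<in> E")
        case True
        note Fv = F_props[OF True]
        have lc: "lead_coeff (F v) \<in> dpoly" using Fv by (intro low_dpoly[of _ v]) (simp add: coeffs_in_def)
        show ?thesis
        proof (rule ideal_reduction[where F = "F v" and b = b, OF less.prems])
          show "h \<in> P" if "h \<in> dpoly" "lead_coeff (F v) * h \<in> P" for h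
            using P_prime[OF lc that(1)] that(2) Fv by blast
        qed (use Fv ev_F[OF True] P_add P_mult low b_minimal[OF True] g in auto)
      next
        case False
        show ?thesis
          by (rule ideal_transcendental[where b = b, OF less.prems])
             (use P_add P_mult low b_transcendental[OF less.prems False] g in auto)
      qed
    qed
  qed
  show ?thesis
  proof (cases "mpoly_vars f = {}")
    case False
    then obtain u where "u \<in> mpoly_vars f" "mpoly_vars f \<subseteq> insert u (low u)"
      using mpoly_vars_max[of f m n] assms(1) by (auto simp: dpolys_def)
    then show ?thesis using upto[of u] assms by (auto simp: dpolys_def)
  qed (use base assms in blast)
qed

text \<open>
  \<open>compatible k u\<close> says that \<open>\<partial>\<^sub>k\<close> preserves the relations among the values of \<open>b\<close> up to \<open>u\<close>, that is,
  it induces a derivation on the field that they generate.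
\<close>

definition compatible :: "nat \<Rightarrow> dvar \<Rightarrow> bool" where
  "compatible k u \<longleftrightarrow> (\<forall>g. mpoly_vars g \<subseteq> insert u (low u) \<and> ev b g = 0 \<longrightarrow> ev b (dd k g) = 0)"

text \<open>Relations at \<open>b\<close> lie in the differential ideal \<open>P\<close>, and a
  derivative within degree \<open>p\<close> is tested on \<open>\<Gamma>\<close>, where the values
  of \<open>b\<close> are those of the generic point.\<close>

lemma compatible_low:
  assumes "u \<in> dvars m n" "k \<in> {1..m}" "deg (shift k u) \<le> p"
  shows "compatible k u"
  unfolding compatible_def
proof (intro allI impI, elim conjE)
  fix g assume g: "mpoly_vars g \<subseteq> insert u (low u)" "ev b g = 0"
  have "g \<in> P" using ker_subset_P upto_dpoly[OF assms(1) g(1)] g(2) by blast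
  then have "dd k g \<in> P" using P_dd assms(2) by blast
  moreover have sub: "insert u (low u) \<subseteq> low (shift k u)" by (rule upto_subset_below_shift[OF assms(1,2)])
  have "mpoly_vars (dd k g) \<subseteq> insert (shift k u) (low (shift k u))"
    by (rule mpoly_vars_dd[OF assms(2) g(1)]) (use sub below_shift[OF _ assms(1,2)] in auto)
  then have "mpoly_vars (dd k g) \<subseteq> \<Gamma>"
    using low_Gamma[OF shift_dvars[OF assms(2,1)] assms(3)] by blast
  ultimately show "ev b (dd k g) = 0" using ev_Gamma by blast
qed

section \<open>The induction step of compatibility: all routes into one derivative above degree
  p\<close>

context
  fixes v :: dvar
  assumes v: "v \<in> dvars m n" and deg_v: "deg v > p"
    and IH: "\<And>k u. u \<in> dvars m n \<Longrightarrow> k \<in> {1..m} \<Longrightarrow> rank (shift k u) < rank v \<Longrightarrow> compatible k u"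
begin

text \<open>By the product rule this set is closed under multiples and, for polynomials vanishing at
  \<open>b\<close>, under cancelling a factor that does not vanish there. These are the closure
  properties that pseudo-division asks for.\<close>

definition ker_dd :: "nat \<Rightarrow> (dvar, 'k) mpoly set" where
  "ker_dd k = {g. ev b g = 0 \<and> ev b (dd k g) = 0}"

lemma ker_dd_ideal:
  assumes "k \<in> {1..m}"
  shows "f \<in> ker_dd k \<Longrightarrow> g \<in> ker_dd k \<Longrightarrow> f + g \<in> ker_dd k" "g \<in> ker_dd k \<Longrightarrow> f * g \<in> ker_dd k"
    "ev b c \<noteq> 0 \<Longrightarrow> ev b g = 0 \<Longrightarrow> c * g \<in> ker_dd k \<Longrightarrow> g \<in> ker_dd k"
  using derivation.deriv_add[OF derivation_dd[OF assms]] derivation.deriv_mult[OF derivation_dd[OF assms]]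
  by (auto simp: ker_dd_def ev.hom_add ev.hom_mult)

text \<open>Shifting preserves the ranking, so the highest variable \<open>w\<close> of
  \<open>g\<close> has \<open>shift k w\<close> below \<open>shift k u\<close>, and the induction
  hypothesis covers it.\<close>

lemma ker_dd_base:
  assumes "u \<in> dvars m n" "k \<in> {1..m}" "rank (shift k u) \<le> rank v" "mpoly_vars g \<subseteq> low u" "ev b g = 0"
  shows "g \<in> ker_dd k"
proof (cases "mpoly_vars g = {}")
  case True
  then obtain c where "g = mconst c" using mpoly_vars_empty by blast
  then show ?thesis using assms(5) derivation.deriv_zero[OF derivation_dd[OF assms(2)]]
    by (simp add: ker_dd_def)
next
  case False
  then obtain w where w: "w \<in> mpoly_vars g" "mpoly_vars g \<subseteq> insert w (low w)"
    using mpoly_vars_max[of g m n] assms(4) below_subset_dvars by blast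
  then have "w \<in> low u" using assms(4) by blast
  then have "shift k w \<in> low (shift k u)" by (rule below_shift[OF _ assms(1,2)])
  then have "rank (shift k w) < rank v" "w \<in> dvars m n"
    using assms(3) \<open>w \<in> low u\<close> by (simp_all add: below_def)
  then have "compatible k w" using IH assms(2) by blast
  then show ?thesis using w(2) assms(5) by (simp add: compatible_def ker_dd_def)
qed

text \<open>Every relation at \<open>u\<close> reduces to \<open>G\<close> and lower relations by
  pseudo-division, so the derivative has to be checked on \<open>G\<close> alone.\<close>

lemma compatible_reduction:
  assumes u: "u \<in> dvars m n" "k \<in> {1..m}" "shift k u = v"
    and G: "coeffs_in (low u) G" "Polynomial.degree G > 0" "ev b (lead_coeff G) \<noteq> 0"
      "poly G (mvar u) \<in> ker_dd k"
    and min: "\<And>H. coeffs_in (low u) H \<Longrightarrow> ev b (poly H (mvar u)) = 0 \<Longrightarrow>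
      Polynomial.degree H < Polynomial.degree G \<Longrightarrow> \<forall>i. ev b (coeff H i) = 0"
  shows "compatible k u"
  unfolding compatible_def
proof (intro allI impI, elim conjE)
  fix g assume g: "mpoly_vars g \<subseteq> insert u (low u)" "ev b g = 0"
  have "g \<in> ker_dd k"
  proof (rule ideal_reduction[where F = G and b = b, OF u(1)])
    show "ev b (poly G (mvar u)) = 0" using G(4) by (simp add: ker_dd_def)
    show "h \<in> ker_dd k" if "mpoly_vars h \<subseteq> low u" "ev b h = 0" for h
      using ker_dd_base[OF u(1,2) _ that] u(3) by simp
  qed (use G ker_dd_ideal[OF u(2)] min g in auto)
  then show "ev b (dd k g) = 0" by (simp add: ker_dd_def)
qed

text \<open>Outside \<open>E\<close> the value at \<open>u\<close> satisfies no new relation, so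
  only lower relations have to be differentiated.\<close>

lemma compatible_transcendental:
  assumes u: "u \<in> dvars m n" "k \<in> {1..m}" "shift k u = v" "u \<notin> E"
  shows "compatible k u"
  unfolding compatible_def
proof (intro allI impI, elim conjE)
  fix g assume g: "mpoly_vars g \<subseteq> insert u (low u)" "ev b g = 0"
  have "g \<in> ker_dd k"
  proof (rule ideal_transcendental[where b = b, OF u(1)])
    show "h \<in> ker_dd k" if "mpoly_vars h \<subseteq> low u" "ev b h = 0" for h
      using ker_dd_base[OF u(1,2) _ that] u(3) by simp
  qed (use ker_dd_ideal[OF u(2)] b_transcendental[OF u(1,4)] g in auto)
  then show "ev b (dd k g) = 0" by (simp add: ker_dd_def)
qed

text \<open>Holds by construction: differentiating the polynomial of the picked predecessor gives
  that of \<open>F v\<close>, and \<open>b v\<close> was chosen as a root.\<close>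

lemma compatible_pick:
  assumes "v \<in> E"
  shows "compatible (fst (pick v)) (snd (pick v))"
proof -
  note pv = pick[OF assms deg_v]
  note Fu = F_props[OF pv(2)]
  have "poly (F (snd (pick v))) (mvar (snd (pick v))) \<in> ker_dd (fst (pick v))"
    using ev_F[OF pv(2)] ev_F[OF assms] dd_F_pick[OF assms deg_v] by (simp add: ker_dd_def)
  then show ?thesis
    using Fu ev_separant(2)[OF pv(2)] b_minimal[OF pv(2)] by (intro compatible_reduction pv E_dvars) auto
qed

text \<open>Let f be the polynomial of \<open>F w\<close>. By induction \<open>dd j\<close> f
  vanishes at \<open>b\<close>, so by \<open>comp\<close> its image under \<open>dd i\<close> does,
  and commuting, so does \<open>dd j\<close> of \<open>dd i\<close> f. The polynomial
  \<open>dd i\<close> f is linear in \<open>shift i w\<close> with the nonvanishing separant as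
  coefficient, so checking it suffices.\<close>

lemma compatible_swap:
  assumes w: "w \<in> E" and ij: "i \<in> {1..m}" "j \<in> {1..m}" "shift i (shift j w) = v"
    and comp: "compatible i (shift j w)"
  shows "compatible j (shift i w)"
proof -
  have wd: "w \<in> dvars m n" using w E_dvars by blast
  have dv: "shift i w \<in> dvars m n" "shift j w \<in> dvars m n" using wd ij shift_dvars by blast+
  have v': "shift j (shift i w) = v" using ij(3) shift_commute by simp
  note Fw = F_props[OF w]
  have c: "compatible i w" "compatible j w"
    using IH[OF wd] ij rk_shift[OF dv(1) ij(2)] rk_shift[OF dv(2) ij(1)] v' by auto
  have vars: "mpoly_vars (poly (F w) (mvar w)) \<subseteq> insert w (low w)" using poly_upto Fw by blast
  have dj: "ev b (dd j (poly (F w) (mvar w))) = 0" and di: "ev b (dd i (poly (F w) (mvar w))) = 0"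
    using c vars ev_F[OF w] by (auto simp: compatible_def)
  have "mpoly_vars (dd j (poly (F w) (mvar w))) \<subseteq> insert (shift j w) (low (shift j w))"
    by (rule mpoly_vars_dd[OF ij(2) vars])
       (use upto_subset_below_shift[OF wd ij(2)] below_shift[OF _ wd ij(2)] in auto)
  then have "ev b (dd i (dd j (poly (F w) (mvar w)))) = 0"
    using comp dj by (simp add: compatible_def)
  then have "ev b (dd j (dd i (poly (F w) (mvar w)))) = 0" using dd_commute[OF ij(1,2)] by simp
  then have ker: "poly (prolong i w (F w)) (mvar (shift i w)) \<in> ker_dd j"
    using di by (simp add: poly_prolong[OF ij(1)] ker_dd_def)
  have s: "separant w \<noteq> 0" using Fw P_zero by auto
  have deg: "Polynomial.degree (prolong i w (F w)) = 1" "lead_coeff (prolong i w (F w)) = separant w"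
    using s by (simp_all add: prolong_def separant_def)
  show ?thesis
  proof (rule compatible_reduction[OF dv(1) ij(2) v' _ _ _ ker])
    show "coeffs_in (low (shift i w)) (prolong i w (F w))" using coeffs_in_prolong[OF ij(1) wd] Fw by blast
    fix H assume H: "ev b (poly H (mvar (shift i w))) = 0"
      "Polynomial.degree H < Polynomial.degree (prolong i w (F w))"
    then have "Polynomial.degree H = 0" using deg by simp
    then obtain c where "H = [:c:]" by (auto elim: degree_eq_zeroE)
    then show "\<forall>i. ev b (coeff H i) = 0" using H(1) by (auto simp: coeff_pCons split: nat.splits)
  qed (use deg ev_separant[OF w] in auto)
qed

definition unshift :: "nat \<Rightarrow> dvar \<Rightarrow> dvar" where
  "unshift k u = ((fst u)(k := fst u k - 1), snd u)"

lemma unshift_shift: "unshift k (shift k u) = u"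
  by (simp add: unshift_def shift_def)

lemma below_minusD:
  assumes "below_minus \<eta> (fst v) k" "(\<eta>, snd v) \<in> A" "k \<in> {1..m}"
  shows "fst v k > 0" "shift k (unshift k v) = v" "unshift k v \<in> E" "\<eta> k < fst v k" "\<eta> \<le> fst v"
proof -
  have le: "\<eta> l \<le> fst v l" "l = k \<Longrightarrow> Suc (\<eta> k) \<le> fst v l" for l
    using assms(1)[unfolded below_minus_def le_fun_def, rule_format, of l] by (auto split: if_splits)
  show "\<eta> k < fst v k" "\<eta> \<le> fst v" using le(2)[of k] le(1) by (auto simp: le_fun_def)
  show pos: "fst v k > 0" using le(2)[of k] by simp
  then show "shift k (unshift k v) = v" by (auto simp: shift_def unshift_def)
  have "unshift k v \<in> dvars m n" using v by (auto simp: unshift_def dvars_def multi_indices_def)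
  moreover have "dvar_le (\<eta>, snd v) (unshift k v)"
    using le by (auto simp: dvar_le_def unshift_def le_fun_def)
  ultimately show "unshift k v \<in> E" using assms(2) by (auto simp: E_def)
qed

text \<open>For distinct \<open>i\<close> and \<open>j\<close>, lowering \<open>v\<close> in both
  entries still leaves it above \<eta>. The two routes thus start from a common element of
  \<open>E\<close> and can be swapped.\<close>

lemma compatible_transfer:
  assumes \<eta>: "(\<eta>, snd v) \<in> A" and i: "i \<in> {1..m}" "below_minus \<eta> (fst v) i"
    and j: "j \<in> {1..m}" "below_minus \<eta> (fst v) j" and comp: "compatible i (unshift i v)"
  shows "compatible j (unshift j v)"
proof (cases "i = j")
  case False
  define w where "w = unshift i (unshift j v)"
  note Di = below_minusD[OF i(2) \<eta> i(1)] and Dj = below_minusD[OF j(2) \<eta> j(1)]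
  have w: "shift i (shift j w) = v" "shift j w = unshift i v" "shift i w = unshift j v"
    using False Di(1) Dj(1) by (auto simp: w_def shift_def unshift_def fun_eq_iff)
  have "w \<in> dvars m n" using v by (auto simp: w_def unshift_def dvars_def multi_indices_def)
  moreover have "dvar_le (\<eta>, snd v) w"
    unfolding dvar_le_def w_def unshift_def le_fun_def
    using Di(4,5) Dj(4) False by (auto simp: le_fun_def)
  ultimately have "w \<in> E" using \<eta> by (auto simp: E_def)
  then show ?thesis using compatible_swap[of w i j] i j w comp by simp
qed (use comp in simp)

lemma below_minusI:
  "\<eta> \<le> \<tau> \<Longrightarrow> \<eta> k < \<tau> k \<Longrightarrow> below_minus \<eta> \<tau> k"
  by (auto simp: below_minus_def le_fun_def)

text \<open>Since the least upper bound has smaller degree than \<open>v\<close>, there is an entry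
  \<open>k\<close> in which both elements stay strictly below \<open>v\<close>. The route through
  \<open>k\<close> is available to both and links \<open>i\<close> with \<open>j\<close>.\<close>

lemma compatible_step:
  assumes \<eta>: "(\<eta>\<^sub>1, snd v) \<in> A" "(\<eta>\<^sub>2, snd v) \<in> A"
    and i: "i \<in> {1..m}" "below_minus \<eta>\<^sub>1 (fst v) i" and j: "j \<in> {1..m}" "below_minus \<eta>\<^sub>2 (fst v) j"
    and lub: "mdeg m (sup \<eta>\<^sub>1 \<eta>\<^sub>2) < deg v" and comp: "compatible i (unshift i v)"
  shows "compatible j (unshift j v)"
proof -
  have le: "\<eta>\<^sub>1 \<le> fst v" "\<eta>\<^sub>2 \<le> fst v"
    using below_minusD(5)[OF i(2) \<eta>(1) i(1)] below_minusD(5)[OF j(2) \<eta>(2) j(1)] .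
  have "\<exists>k\<in>{1..m}. sup \<eta>\<^sub>1 \<eta>\<^sub>2 k < fst v k"
  proof (rule ccontr)
    assume "\<not> ?thesis"
    then have "deg v \<le> mdeg m (sup \<eta>\<^sub>1 \<eta>\<^sub>2)" unfolding mdeg_def by (intro sum_mono) (auto simp: not_less)
    then show False using lub by simp
  qed
  then obtain k where k: "k \<in> {1..m}" "\<eta>\<^sub>1 k < fst v k" "\<eta>\<^sub>2 k < fst v k" by (auto simp: sup_nat_def)
  have "compatible k (unshift k v)"
    using compatible_transfer[OF \<eta>(1) i k(1) below_minusI comp] le k by blast
  then show ?thesis
    using compatible_transfer[OF \<eta>(2) k(1) below_minusI j] le k by blast
qed

text \<open>Each link is a single step, because consecutive least upper bounds have degree at most
  \<open>p\<close>, which is below that of \<open>v\<close>. Both directions are wanted, as chains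
  are supplied only for \<open>i < j\<close>.\<close>

lemma compatible_chain:
  fixes \<eta> :: "nat \<Rightarrow> nat \<Rightarrow> nat" and k :: "nat \<Rightarrow> nat" and s :: nat
  assumes "\<forall>q\<in>{1..s}. (\<eta> q, snd v) \<in> A \<and> k q \<in> {1..m} \<and> below_minus (\<eta> q) (fst v) (k q)"
    and "\<forall>q\<in>{1..<s}. mdeg m (sup (\<eta> q) (\<eta> (Suc q))) \<le> p" and "1 \<le> s"
  shows "compatible (k 1) (unshift (k 1) v) \<longleftrightarrow> compatible (k s) (unshift (k s) v)"
proof -
  have "q \<le> s \<longrightarrow> (compatible (k 1) (unshift (k 1) v) \<longleftrightarrow> compatible (k q) (unshift (k q) v))" if "1 \<le> q" for q
    using that
  proof (induction q rule: dec_induct)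
    case (step q)
    show ?case
    proof
      assume "Suc q \<le> s"
      then have q: "q \<in> {1..s}" "Suc q \<in> {1..s}" "q \<in> {1..<s}" using step.hyps by auto
      have "mdeg m (sup (\<eta> q) (\<eta> (Suc q))) < deg v" "mdeg m (sup (\<eta> (Suc q)) (\<eta> q)) < deg v"
        using assms(2) q(3) deg_v by (force simp: sup_commute)+
      then have "compatible (k q) (unshift (k q) v) \<longleftrightarrow> compatible (k (Suc q)) (unshift (k (Suc q)) v)"
        using assms(1) q(1,2) compatible_step by blast
      then show "compatible (k 1) (unshift (k 1) v) \<longleftrightarrow> compatible (k (Suc q)) (unshift (k (Suc q)) v)"
        using step.IH \<open>Suc q \<le> s\<close> by simp
    qed
  qed simp
  then show ?thesis using assms(3) by blast
qed

text \<open>The remaining case: the least upper bound lies below \<open>v\<close> without having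
  smaller degree, so it equals \<open>v\<close>. Then \<open>v\<close> belongs to
  \<open>lub_set A\<close> outside \<open>\<Gamma>\<close>, exactly where \<open>D_condition\<close>
  supplies a chain.\<close>

lemma compatible_lub:
  assumes \<eta>: "(\<eta>\<^sub>1, snd v) \<in> A" "(\<eta>\<^sub>2, snd v) \<in> A"
    and i: "i \<in> {1..m}" "below_minus \<eta>\<^sub>1 (fst v) i" and j: "j \<in> {1..m}" "below_minus \<eta>\<^sub>2 (fst v) j"
    and lub: "\<not> mdeg m (sup \<eta>\<^sub>1 \<eta>\<^sub>2) < deg v" and "i < j"
  shows "compatible i (unshift i v) \<longleftrightarrow> compatible j (unshift j v)"
proof -
  have le: "\<eta>\<^sub>1 \<le> fst v" "\<eta>\<^sub>2 \<le> fst v"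
    using below_minusD(5)[OF i(2) \<eta>(1) i(1)] below_minusD(5)[OF j(2) \<eta>(2) j(1)] .
  have AD: "(\<eta>, snd v) \<in> A \<Longrightarrow> \<eta> \<in> multi_indices m \<and> mdeg m \<eta> \<le> p" for \<eta>
    by (auto simp: A_def Gamma_upto_def dvars_def)
  have sup: "sup \<eta>\<^sub>1 \<eta>\<^sub>2 = fst v"
  proof (rule ccontr)
    assume neq: "sup \<eta>\<^sub>1 \<eta>\<^sub>2 \<noteq> fst v"
    have "dvar_le (sup \<eta>\<^sub>1 \<eta>\<^sub>2, snd v) v" using le by (simp add: dvar_le_def)
    moreover have "(sup \<eta>\<^sub>1 \<eta>\<^sub>2, snd v) \<in> dvars m n"
      using AD \<eta> v by (auto simp: dvars_def intro!: multi_indices_sup)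
    ultimately show False using dvar_le_mdeg[of "(sup \<eta>\<^sub>1 \<eta>\<^sub>2, snd v)" v] neq v lub by (auto simp: prod_eq_iff)
  qed
  have "\<eta>\<^sub>1 \<noteq> \<eta>\<^sub>2" using sup AD[OF \<eta>(1)] deg_v by auto
  then have "(sup \<eta>\<^sub>1 \<eta>\<^sub>2, snd v) \<in> lub_set A" using \<eta> unfolding lub_set_def by blast
  then have "(fst v, snd v) \<in> lub_set A - \<Gamma>" using deg_v by (simp add: sup Gamma_upto_def)
  moreover have "set \<alpha>s \<inter> \<Gamma> = A" by (simp add: A_def \<alpha>s)
  moreover have "\<exists>\<beta>\<^sub>1. (\<beta>\<^sub>1, snd v) \<in> A \<and> below_minus \<beta>\<^sub>1 (fst v) i" "\<exists>\<beta>\<^sub>2. (\<beta>\<^sub>2, snd v) \<in> A \<and> below_minus \<beta>\<^sub>2 (fst v) j"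
    using \<eta> i j by blast+
  ultimately obtain s :: nat and \<eta> k where "1 \<le> s" "k 1 = i" "k s = j"
    "\<forall>q\<in>{1..s}. (\<eta> q, snd v) \<in> A \<and> k q \<in> {1..m} \<and> below_minus (\<eta> q) (fst v) (k q)"
    "\<forall>q\<in>{1..<s}. mdeg m (sup (\<eta> q) (\<eta> (Suc q))) \<le> p"
    using D_cond[unfolded D_condition_def Let_def] i(1) j(1) \<open>i < j\<close>
    by (auto dest!: bspec[where x = "(fst v, snd v)"]) blast
  then show ?thesis using compatible_chain by metis
qed

text \<open>Compatibility is known for the picked route and is carried from there to the route
  through \<open>u\<close>, by a single step or by a chain.\<close>

lemma compatible_E:
  assumes u: "u \<in> E" "k \<in> {1..m}" "shift k u = v"
  shows "compatible k u"
proof -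
  have vE: "v \<in> E" using E_mono[OF u(1), of v] v u(3) dvar_le_shift by metis
  note pv = pick[OF vE deg_v]
  define i where "i = fst (pick v)"
  have comp: "compatible i (unshift i v)"
    using compatible_pick[OF vE] unshift_shift[of i "snd (pick v)"] pv(3) by (simp add: i_def)
  have ex: "\<exists>\<eta>. (\<eta>, snd v) \<in> A \<and> below_minus \<eta> (fst v) l"
    if w: "w \<in> E" "shift l w = v" for w l
  proof -
    obtain \<alpha> where "\<alpha> \<in> A" "dvar_le \<alpha> w" using w(1) unfolding E_def by blast
    moreover have "snd w = snd v" "fst v = (fst w)(l := Suc (fst w l))" using w(2) by (auto simp: shift_def)
    moreover have "(fst \<alpha>, snd \<alpha>) = \<alpha>" by simp
    ultimately show ?thesis
      by (intro exI[of _ "fst \<alpha>"]) (auto simp: dvar_le_def below_minus_def le_fun_def)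
  qed
  obtain \<eta>\<^sub>1 where \<eta>1: "(\<eta>\<^sub>1, snd v) \<in> A" "below_minus \<eta>\<^sub>1 (fst v) i"
    using ex[OF pv(2), of i] pv(3) by (auto simp: i_def)
  obtain \<eta>\<^sub>2 where \<eta>2: "(\<eta>\<^sub>2, snd v) \<in> A" "below_minus \<eta>\<^sub>2 (fst v) k"
    using ex[OF u(1,3)] by blast
  have im: "i \<in> {1..m}" using pv(1) by (simp add: i_def)
  have "compatible k (unshift k v)"
  proof (cases "mdeg m (sup \<eta>\<^sub>1 \<eta>\<^sub>2) < deg v")
    case True
    then show ?thesis using compatible_step[OF \<eta>1(1) \<eta>2(1) im \<eta>1(2) u(2) \<eta>2(2)] comp by blast
  next
    case False
    then have F': "\<not> mdeg m (sup \<eta>\<^sub>2 \<eta>\<^sub>1) < deg v" by (simp add: sup_commute)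
    consider "i = k" | "i < k" | "k < i" by linarith
    then show ?thesis
    proof cases
      case 1 then show ?thesis using comp by simp
    next
      case 2 then show ?thesis
        using compatible_lub[OF \<eta>1(1) \<eta>2(1) im \<eta>1(2) u(2) \<eta>2(2) False] comp by blast
    next
      case 3 then show ?thesis
        using compatible_lub[OF \<eta>2(1) \<eta>1(1) u(2) \<eta>2(2) im \<eta>1(2) F'] comp by blast
    qed
  qed
  then show ?thesis using unshift_shift[of k u] u(3) by simp
qed

end

lemma compatible:
  assumes "u \<in> dvars m n" "k \<in> {1..m}"
  shows "compatible k u"
  using assms
proof (induction "rank (shift k u)" arbitrary: k u rule: less_induct)
  case less
  have v: "shift k u \<in> dvars m n" using shift_dvars less.prems by blast
  show ?case
  proof (cases "deg (shift k u) \<le> p")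
    case True
    then show ?thesis using compatible_low less.prems by blast
  next
    case False
    then have deg: "deg (shift k u) > p" by simp
    have IH: "compatible l w" if "w \<in> dvars m n" "l \<in> {1..m}" "rank (shift l w) < rank (shift k u)" for l w
      using less.hyps that by blast
    show ?thesis
      using compatible_E[OF v deg IH _ less.prems(2) refl]
        compatible_transcendental[OF v deg IH less.prems refl] by blast
  qed
qed

definition Q :: "(dvar, 'k) mpoly set" where "Q = {f \<in> dpoly. ev b f = 0}"

text \<open>The kernel of an evaluation in a field is prime; closure under derivations is
  compatibility at the highest variable.\<close>

lemma prime_dideal_Q: "prime_dideal Q"
  unfolding prime_dideal_def
proof (intro conjI ballI impI)
  fix k f assume k: "k \<in> {1..m}" and f: "f \<in> Q"
  show "dd k f \<in> Q"
  proof (cases "mpoly_vars f = {}")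
    case True
    then obtain c where "f = mconst c" using mpoly_vars_empty by blast
    then show ?thesis using f derivation.deriv_zero[OF derivation_dd[OF k]] by (auto simp: Q_def)
  next
    case False
    then obtain u where u: "u \<in> mpoly_vars f" "mpoly_vars f \<subseteq> insert u (low u)"
      using mpoly_vars_max[of f m n] f by (auto simp: dpolys_def Q_def)
    then have "u \<in> dvars m n" using f by (auto simp: dpolys_def Q_def)
    then show ?thesis using compatible[OF _ k, of u] u(2) f k dpoly_closed(7)
      by (auto simp: compatible_def Q_def)
  qed
qed (auto simp: Q_def dpoly_closed ev.hom_add ev.hom_mult)

lemma Q_subset_P: "Q \<subseteq> P"
  using ker_subset_P by (auto simp: Q_def)

lemma P_Gamma_subset_Q: "f \<in> P \<Longrightarrow> mpoly_vars f \<subseteq> \<Gamma> \<Longrightarrow> f \<in> Q"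
  using ev_Gamma P_dpoly by (auto simp: Q_def)

lemma leader_Q:
  assumes "leader Q v"
  shows "v \<in> E"
proof (rule ccontr)
  assume "v \<notin> E"
  obtain G where G: "v \<in> dvars m n" "coeffs_in (low v) G" "poly G (mvar v) \<in> Q" "\<not> (\<forall>i. coeff G i \<in> Q)"
    using assms unfolding leader_def by blast
  have "ev b (poly G (mvar v)) = 0" using G(3) by (simp add: Q_def)
  then have "\<forall>i. ev b (coeff G i) = 0" using b_transcendental[OF G(1) \<open>v \<notin> E\<close> G(2)] by blast
  moreover have "coeff G i \<in> dpoly" for i using G(2) by (intro low_dpoly[of _ v]) (simp add: coeffs_in_def)
  ultimately show False using G(4) by (simp add: Q_def)
qed

end

section \<open>The function field inside the universal extension\<close>

text \<open>With an injective homomorphism into a field, identities between fractions can be checked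
  on their values, which avoids arguing inside \<open>C\<close>.\<close>

locale frac_embedding =
  fixes C :: "('c, 'd) ring_scheme" and \<theta> :: "'c \<Rightarrow> 'u::field"
  assumes C_zero: "\<zero>\<^bsub>C\<^esub> \<in> carrier C" and C_one: "\<one>\<^bsub>C\<^esub> \<in> carrier C"
    and C_add: "x \<in> carrier C \<Longrightarrow> y \<in> carrier C \<Longrightarrow> x \<oplus>\<^bsub>C\<^esub> y \<in> carrier C"
    and C_mult: "x \<in> carrier C \<Longrightarrow> y \<in> carrier C \<Longrightarrow> x \<otimes>\<^bsub>C\<^esub> y \<in> carrier C"
    and \<theta>_inj: "inj_on \<theta> (carrier C)"
    and \<theta>_zero: "\<theta> \<zero>\<^bsub>C\<^esub> = 0" and \<theta>_one: "\<theta> \<one>\<^bsub>C\<^esub> = 1"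
    and \<theta>_add: "x \<in> carrier C \<Longrightarrow> y \<in> carrier C \<Longrightarrow> \<theta> (x \<oplus>\<^bsub>C\<^esub> y) = \<theta> x + \<theta> y"
    and \<theta>_mult: "x \<in> carrier C \<Longrightarrow> y \<in> carrier C \<Longrightarrow> \<theta> (x \<otimes>\<^bsub>C\<^esub> y) = \<theta> x * \<theta> y"
begin

definition nz :: "'c set" where "nz = carrier C - {\<zero>\<^bsub>C\<^esub>}"

lemma nz_iff: "y \<in> nz \<longleftrightarrow> y \<in> carrier C \<and> \<theta> y \<noteq> 0"
  using \<theta>_inj C_zero \<theta>_zero unfolding nz_def by (metis Diff_iff empty_iff inj_onD insert_iff)

lemma nz_mult: "x \<in> nz \<Longrightarrow> y \<in> nz \<Longrightarrow> x \<otimes>\<^bsub>C\<^esub> y \<in> nz"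
  by (simp add: nz_iff C_mult \<theta>_mult)

lemma nz_one: "\<one>\<^bsub>C\<^esub> \<in> nz"
  by (simp add: nz_iff C_one \<theta>_one)

abbreviation "FF \<equiv> fraction_field C"

lemma fraction_eq:
  assumes "x \<in> carrier C" "y \<in> nz"
  shows "fraction C x y = {(c, d). c \<in> carrier C \<and> d \<in> nz \<and> \<theta> c / \<theta> d = \<theta> x / \<theta> y}"
proof -
  have "x \<otimes>\<^bsub>C\<^esub> d = c \<otimes>\<^bsub>C\<^esub> y \<longleftrightarrow> \<theta> c / \<theta> d = \<theta> x / \<theta> y" if "c \<in> carrier C" "d \<in> nz" for c d
  proof -
    have "x \<otimes>\<^bsub>C\<^esub> d = c \<otimes>\<^bsub>C\<^esub> y \<longleftrightarrow> \<theta> (x \<otimes>\<^bsub>C\<^esub> d) = \<theta> (c \<otimes>\<^bsub>C\<^esub> y)"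
      using inj_on_eq_iff[OF \<theta>_inj] assms that by (simp add: nz_iff C_mult)
    then show ?thesis using assms that by (auto simp: nz_iff \<theta>_mult frac_eq_eq)
  qed
  then show ?thesis
    using assms unfolding fraction_def fraction_rel_def nz_def[symmetric] by (auto simp: nz_iff)
qed

lemma fraction_mem: "x \<in> carrier C \<Longrightarrow> y \<in> nz \<Longrightarrow> (x, y) \<in> fraction C x y"
  by (simp add: fraction_eq)

definition \<psi> :: "('c \<times> 'c) set \<Rightarrow> 'u" where
  "\<psi> Z = (let q = SOME q. q \<in> Z in \<theta> (fst q) / \<theta> (snd q))"

lemma \<psi>_fraction:
  assumes "x \<in> carrier C" "y \<in> nz"
  shows "\<psi> (fraction C x y) = \<theta> x / \<theta> y"
proof -
  have "(SOME q. q \<in> fraction C x y) \<in> fraction C x y"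
    using fraction_mem[OF assms] by (rule someI)
  then show ?thesis unfolding \<psi>_def Let_def by (auto simp: fraction_eq[OF assms])
qed

lemma carrier_FF: "carrier FF = {fraction C x y | x y. x \<in> carrier C \<and> y \<in> nz}"
  unfolding fraction_field_def fraction_def quotient_def nz_def[symmetric] by auto

lemma FF_E:
  assumes "Z \<in> carrier FF"
  obtains x y where "x \<in> carrier C" "y \<in> nz" "Z = fraction C x y"
  using assms unfolding carrier_FF by blast

lemma fraction_in [intro, simp]: "x \<in> carrier C \<Longrightarrow> y \<in> nz \<Longrightarrow> fraction C x y \<in> carrier FF"
  unfolding carrier_FF by blast

lemma \<psi>_inj: "inj_on \<psi> (carrier FF)"
proof (rule inj_onI)
  fix Z Z' assume Z: "Z \<in> carrier FF" "Z' \<in> carrier FF" "\<psi> Z = \<psi> Z'"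
  obtain x y where xy: "x \<in> carrier C" "y \<in> nz" "Z = fraction C x y" using Z(1) by (rule FF_E)
  obtain c d where cd: "c \<in> carrier C" "d \<in> nz" "Z' = fraction C c d" using Z(2) by (rule FF_E)
  have "\<theta> x / \<theta> y = \<theta> c / \<theta> d" using Z(3) xy cd by (simp add: \<psi>_fraction)
  then show "Z = Z'" using xy cd by (simp add: fraction_eq)
qed

lemma one_FF: "\<one>\<^bsub>FF\<^esub> = fraction C \<one>\<^bsub>C\<^esub> \<one>\<^bsub>C\<^esub>" and zero_FF: "\<zero>\<^bsub>FF\<^esub> = fraction C \<zero>\<^bsub>C\<^esub> \<one>\<^bsub>C\<^esub>"
  by (simp_all add: fraction_field_def)

lemma one_zero_in: "\<one>\<^bsub>FF\<^esub> \<in> carrier FF" "\<zero>\<^bsub>FF\<^esub> \<in> carrier FF"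
  by (simp_all add: one_FF zero_FF C_one C_zero nz_one)

lemma \<psi>_one: "\<psi> \<one>\<^bsub>FF\<^esub> = 1" and \<psi>_zero: "\<psi> \<zero>\<^bsub>FF\<^esub> = 0"
  by (simp_all add: one_FF zero_FF \<psi>_fraction C_one C_zero nz_one \<theta>_one \<theta>_zero)

text \<open>The operations of \<open>fraction_field\<close> are unions over all pairs of
  representatives; such a union collapses once every pair yields the same class.\<close>

lemma union_const:
  assumes "(x0, y0) \<in> P" "(c0, d0) \<in> Q"
    and "\<And>x y c d. (x, y) \<in> P \<Longrightarrow> (c, d) \<in> Q \<Longrightarrow> g x y c d = S"
  shows "(\<Union>(x, y)\<in>P. \<Union>(c, d)\<in>Q. g x y c d) = S"
proof -
  have "(case q of (x, y) \<Rightarrow> \<Union>(c, d)\<in>Q. g x y c d) = S" if "q \<in> P" for q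
  proof -
    obtain x y where q: "q = (x, y)" by fastforce
    have "(case q' of (c, d) \<Rightarrow> g x y c d) = S" if "q' \<in> Q" for q'
      using assms(3) \<open>q \<in> P\<close> that q by (cases q') simp
    then have "(\<Union>(c, d)\<in>Q. g x y c d) = (\<Union>q'\<in>Q. S)" by (rule SUP_cong[OF refl])
    also have "\<dots> = S" using assms(2) by blast
    finally show ?thesis by (simp add: q)
  qed
  then have "(\<Union>(x, y)\<in>P. \<Union>(c, d)\<in>Q. g x y c d) = (\<Union>q\<in>P. S)" by (rule SUP_cong[OF refl])
  also have "\<dots> = S" using assms(1) by blast
  finally show ?thesis .
qed

lemma mult_FF:
  assumes "x \<in> carrier C" "y \<in> nz" "c \<in> carrier C" "d \<in> nz"
  shows "fraction C x y \<otimes>\<^bsub>FF\<^esub> fraction C c d = fraction C (x \<otimes>\<^bsub>C\<^esub> c) (y \<otimes>\<^bsub>C\<^esub> d)"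
proof -
  have "fraction C x y \<otimes>\<^bsub>FF\<^esub> fraction C c d = (\<Union>(a, b)\<in>fraction C x y. \<Union>(c, d)\<in>fraction C c d.
      fraction C (a \<otimes>\<^bsub>C\<^esub> c) (b \<otimes>\<^bsub>C\<^esub> d))"
    by (simp only: fraction_field_def monoid.select_convs)
  also have "\<dots> = fraction C (x \<otimes>\<^bsub>C\<^esub> c) (y \<otimes>\<^bsub>C\<^esub> d)"
  proof (rule union_const[where g = "\<lambda>a b c d. fraction C (a \<otimes>\<^bsub>C\<^esub> c) (b \<otimes>\<^bsub>C\<^esub> d)",
        OF fraction_mem[OF assms(1,2)] fraction_mem[OF assms(3,4)]])
  fix x' y' c' d' assume *: "(x', y') \<in> fraction C x y" "(c', d') \<in> fraction C c d"
  then have "\<theta> x' / \<theta> y' * (\<theta> c' / \<theta> d') = \<theta> x / \<theta> y * (\<theta> c / \<theta> d)"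
    using assms by (simp add: fraction_eq)
  then show "fraction C (x' \<otimes>\<^bsub>C\<^esub> c') (y' \<otimes>\<^bsub>C\<^esub> d') = fraction C (x \<otimes>\<^bsub>C\<^esub> c) (y \<otimes>\<^bsub>C\<^esub> d)"
    using * assms by (simp add: fraction_eq C_mult nz_mult) (simp add: nz_iff \<theta>_mult)
  qed
  finally show ?thesis .
qed

lemma add_FF:
  assumes "x \<in> carrier C" "y \<in> nz" "c \<in> carrier C" "d \<in> nz"
  shows "fraction C x y \<oplus>\<^bsub>FF\<^esub> fraction C c d
    = fraction C ((x \<otimes>\<^bsub>C\<^esub> d) \<oplus>\<^bsub>C\<^esub> (c \<otimes>\<^bsub>C\<^esub> y)) (y \<otimes>\<^bsub>C\<^esub> d)"
proof -
  have "fraction C x y \<oplus>\<^bsub>FF\<^esub> fraction C c d = (\<Union>(a, b)\<in>fraction C x y. \<Union>(c, d)\<in>fraction C c d.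
      fraction C ((a \<otimes>\<^bsub>C\<^esub> d) \<oplus>\<^bsub>C\<^esub> (c \<otimes>\<^bsub>C\<^esub> b)) (b \<otimes>\<^bsub>C\<^esub> d))"
    by (simp only: fraction_field_def ring.select_convs)
  also have "\<dots> = fraction C ((x \<otimes>\<^bsub>C\<^esub> d) \<oplus>\<^bsub>C\<^esub> (c \<otimes>\<^bsub>C\<^esub> y)) (y \<otimes>\<^bsub>C\<^esub> d)"
  proof (rule union_const[where g = "\<lambda>a b c d. fraction C ((a \<otimes>\<^bsub>C\<^esub> d) \<oplus>\<^bsub>C\<^esub> (c \<otimes>\<^bsub>C\<^esub> b)) (b \<otimes>\<^bsub>C\<^esub> d)",
        OF fraction_mem[OF assms(1,2)] fraction_mem[OF assms(3,4)]])
  fix x' y' c' d' assume *: "(x', y') \<in> fraction C x y" "(c', d') \<in> fraction C c d"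
  then have in': "x' \<in> carrier C" "y' \<in> nz" "c' \<in> carrier C" "d' \<in> nz"
    and eq: "\<theta> x' / \<theta> y' + \<theta> c' / \<theta> d' = \<theta> x / \<theta> y + \<theta> c / \<theta> d"
    using assms by (simp_all add: fraction_eq)
  have cl: "y \<in> carrier C" "d \<in> carrier C" "y' \<in> carrier C" "d' \<in> carrier C"
    "\<theta> y \<noteq> 0" "\<theta> d \<noteq> 0" "\<theta> y' \<noteq> 0" "\<theta> d' \<noteq> 0"
    using in' assms by (auto simp: nz_iff)
  have "(\<theta> x' * \<theta> d' + \<theta> c' * \<theta> y') / (\<theta> y' * \<theta> d') = (\<theta> x * \<theta> d + \<theta> c * \<theta> y) / (\<theta> y * \<theta> d)"
    using eq cl by (simp add: add_frac_eq)
  then show "fraction C ((x' \<otimes>\<^bsub>C\<^esub> d') \<oplus>\<^bsub>C\<^esub> (c' \<otimes>\<^bsub>C\<^esub> y')) (y' \<otimes>\<^bsub>C\<^esub> d')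
      = fraction C ((x \<otimes>\<^bsub>C\<^esub> d) \<oplus>\<^bsub>C\<^esub> (c \<otimes>\<^bsub>C\<^esub> y)) (y \<otimes>\<^bsub>C\<^esub> d)"
    using in' assms cl by (simp add: fraction_eq C_mult C_add nz_mult \<theta>_add \<theta>_mult)
  qed
  finally show ?thesis .
qed

lemma FF_closed:
  assumes "Z \<in> carrier FF" "Z' \<in> carrier FF"
  shows "Z \<otimes>\<^bsub>FF\<^esub> Z' \<in> carrier FF" "\<psi> (Z \<otimes>\<^bsub>FF\<^esub> Z') = \<psi> Z * \<psi> Z'"
    and "Z \<oplus>\<^bsub>FF\<^esub> Z' \<in> carrier FF" "\<psi> (Z \<oplus>\<^bsub>FF\<^esub> Z') = \<psi> Z + \<psi> Z'"
proof -
  obtain x y where xy: "x \<in> carrier C" "y \<in> nz" "Z = fraction C x y" using assms(1) by (rule FF_E)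
  obtain c d where cd: "c \<in> carrier C" "d \<in> nz" "Z' = fraction C c d" using assms(2) by (rule FF_E)
  have cl: "y \<in> carrier C" "d \<in> carrier C" "\<theta> y \<noteq> 0" "\<theta> d \<noteq> 0" using xy cd by (auto simp: nz_iff)
  show "Z \<otimes>\<^bsub>FF\<^esub> Z' \<in> carrier FF" "\<psi> (Z \<otimes>\<^bsub>FF\<^esub> Z') = \<psi> Z * \<psi> Z'"
    using xy cd cl by (simp_all add: mult_FF C_mult nz_mult \<psi>_fraction \<theta>_mult)
  show "Z \<oplus>\<^bsub>FF\<^esub> Z' \<in> carrier FF" "\<psi> (Z \<oplus>\<^bsub>FF\<^esub> Z') = \<psi> Z + \<psi> Z'"
    using xy cd cl by (simp_all add: add_FF C_mult C_add nz_mult \<psi>_fraction \<theta>_mult \<theta>_add add_frac_eq)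
qed

lemma FF_eqI: "Z \<in> carrier FF \<Longrightarrow> Z' \<in> carrier FF \<Longrightarrow> \<psi> Z = \<psi> Z' \<Longrightarrow> Z = Z'"
  using \<psi>_inj by (rule inj_onD)

text \<open>The laws are pulled back from the field \<open>'u\<close> along the injective
  \<open>\<psi>\<close>.\<close>

lemma comm_monoid_FF: "Group.comm_monoid FF"
  by (rule comm_monoidI; (rule FF_eqI)?; simp add: FF_closed one_zero_in \<psi>_one mult_ac)

lemma abelian_monoid_FF: "abelian_monoid FF"
  by (rule abelian_monoidI; (rule FF_eqI)?; simp add: FF_closed one_zero_in \<psi>_zero add_ac)

lemma \<psi>_pow: "Z \<in> carrier FF \<Longrightarrow> Z [^]\<^bsub>FF\<^esub> (k :: nat) \<in> carrier FF \<and> \<psi> (Z [^]\<^bsub>FF\<^esub> k) = \<psi> Z ^ k"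
proof (induction k)
  case 0
  then show ?case by (simp add: Group.monoid.nat_pow_0[OF Group.comm_monoid.axioms(1)[OF comm_monoid_FF]]
        one_zero_in \<psi>_one)
next
  case (Suc k)
  then show ?case
    by (simp add: Group.monoid.nat_pow_Suc[OF Group.comm_monoid.axioms(1)[OF comm_monoid_FF]]
        FF_closed mult.commute)
qed

lemma \<psi>_finprod:
  assumes "finite A" "f \<in> A \<rightarrow> carrier FF"
  shows "finprod FF f A \<in> carrier FF \<and> \<psi> (finprod FF f A) = (\<Prod>x\<in>A. \<psi> (f x))"
  using assms
proof (induction A rule: finite_induct)
  case empty
  then show ?case by (simp add: comm_monoid.finprod_empty[OF comm_monoid_FF] one_zero_in \<psi>_one)
next
  case (insert x A)
  then have "finprod FF f (insert x A) = f x \<otimes>\<^bsub>FF\<^esub> finprod FF f A"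
    by (intro comm_monoid.finprod_insert[OF comm_monoid_FF]) auto
  then show ?case using insert by (simp add: FF_closed)
qed

lemma \<psi>_finsum:
  assumes "finite A" "f \<in> A \<rightarrow> carrier FF"
  shows "finsum FF f A \<in> carrier FF \<and> \<psi> (finsum FF f A) = (\<Sum>x\<in>A. \<psi> (f x))"
  using assms
proof (induction A rule: finite_induct)
  case empty
  then show ?case by (simp add: abelian_monoid.finsum_empty[OF abelian_monoid_FF] one_zero_in \<psi>_zero)
next
  case (insert x A)
  then have "finsum FF f (insert x A) = f x \<oplus>\<^bsub>FF\<^esub> finsum FF f A"
    by (intro abelian_monoid.finsum_insert[OF abelian_monoid_FF]) auto
  then show ?case using insert by (simp add: FF_closed)
qed

lemma \<psi>_mpoly_eval:
  assumes "\<And>c. \<phi> c \<in> carrier FF" "\<And>v. v \<in> mpoly_vars q \<Longrightarrow> a v \<in> carrier FF"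
  shows "mpoly_eval_ring FF \<phi> a q \<in> carrier FF"
    and "\<psi> (mpoly_eval_ring FF \<phi> a q) = mpoly_eval (\<lambda>c. \<psi> (\<phi> c)) (\<lambda>v. \<psi> (a v)) q"
proof -
  have mon: "finprod FF (\<lambda>v. a v [^]\<^bsub>FF\<^esub> Poly_Mapping.lookup t v) (Poly_Mapping.keys t) \<in> carrier FF \<and>
      \<psi> (finprod FF (\<lambda>v. a v [^]\<^bsub>FF\<^esub> Poly_Mapping.lookup t v) (Poly_Mapping.keys t))
        = (\<Prod>v\<in>Poly_Mapping.keys t. \<psi> (a v) ^ Poly_Mapping.lookup t v)"
    if "t \<in> Poly_Mapping.keys q" for t
  proof -
    have "a v \<in> carrier FF" if "v \<in> Poly_Mapping.keys t" for v
      using assms(2) that \<open>t \<in> _\<close> by (auto simp: mpoly_vars_def)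
    then show ?thesis
      using \<psi>_finprod[of "Poly_Mapping.keys t" "\<lambda>v. a v [^]\<^bsub>FF\<^esub> Poly_Mapping.lookup t v"] \<psi>_pow by auto
  qed
  show "mpoly_eval_ring FF \<phi> a q \<in> carrier FF"
    and "\<psi> (mpoly_eval_ring FF \<phi> a q) = mpoly_eval (\<lambda>c. \<psi> (\<phi> c)) (\<lambda>v. \<psi> (a v)) q"
    unfolding mpoly_eval_ring_def mpoly_eval_def
    using \<psi>_finsum[of "Poly_Mapping.keys q" "\<lambda>t. \<phi> (Poly_Mapping.lookup q t) \<otimes>\<^bsub>FF\<^esub>
        finprod FF (\<lambda>v. a v [^]\<^bsub>FF\<^esub> Poly_Mapping.lookup t v) (Poly_Mapping.keys t)"]
      assms(1) mon by (auto simp: FF_closed)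
qed

lemma algebraically_independent_iff:
  assumes "\<And>c. \<phi> c \<in> carrier FF" "S \<subseteq> carrier FF"
  shows "algebraically_independent FF \<phi> S \<longleftrightarrow>
    (\<forall>q. mpoly_vars q \<subseteq> S \<and> mpoly_eval (\<lambda>c. \<psi> (\<phi> c)) \<psi> q = 0 \<longrightarrow> q = 0)"
proof -
  have "mpoly_eval_ring FF \<phi> (\<lambda>s. s) q = \<zero>\<^bsub>FF\<^esub> \<longleftrightarrow> mpoly_eval (\<lambda>c. \<psi> (\<phi> c)) \<psi> q = 0"
    if "mpoly_vars q \<subseteq> S" for q
  proof -
    have "v \<in> carrier FF" if "v \<in> mpoly_vars q" for v
      using that \<open>mpoly_vars q \<subseteq> S\<close> assms(2) by blast
    note * = \<psi>_mpoly_eval[where \<phi> = \<phi> and q = q and a = "\<lambda>s. s", OF assms(1) this]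
    show ?thesis using FF_eqI[OF *(1) one_zero_in(2)] *(2) \<psi>_zero by metis
  qed
  then show ?thesis using assms(2) unfolding algebraically_independent_def by blast
qed

end

context differential_extension
begin

text \<open>A relation over \<open>K(S - {s})\<close> satisfied by \<open>s\<close> is, after clearing denominators, a polynomial relation.\<close>

lemma independent_imp_cl_independent:
  fixes \<psi> :: "'l \<Rightarrow> 'u"
  assumes ind: "\<And>q :: ('l, 'k) mpoly. mpoly_vars q \<subseteq> S \<Longrightarrow> mpoly_eval \<iota> \<psi> q = 0 \<Longrightarrow> q = 0"
  shows "cl_independent (range \<iota>) (\<psi> ` S)"
  unfolding cl_independent_def
proof (intro ballI notI)
  interpret ev': unital_hom "mpoly_eval \<iota> \<psi> :: ('l, 'k) mpoly \<Rightarrow> 'u" by (rule unital_hom_mpoly_eval[OF unital_\<iota>])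
  fix z assume "z \<in> \<psi> ` S" and cl: "z \<in> cl (range \<iota> \<union> (\<psi> ` S - {z}))"
  then obtain s where s: "s \<in> S" "z = \<psi> s" by blast
  define D where "D = {mpoly_eval \<iota> \<psi> q | q :: ('l, 'k) mpoly. mpoly_vars q \<subseteq> S - {s}}"
  have D: "is_subring D"
    unfolding is_subring_def
  proof (intro conjI ballI, goal_cases)
    case 1 show ?case unfolding D_def by (intro CollectI exI[of _ 1]) simp
  next
    case (2 x)
    then obtain q where "x = mpoly_eval \<iota> \<psi> q" "mpoly_vars (q :: ('l, 'k) mpoly) \<subseteq> S - {s}" by (auto simp: D_def)
    then show ?case unfolding D_def by (intro CollectI exI[of _ "- q"]) (simp add: ev'.hom_minus)
  next
    case (3 x y)
    then obtain q q' where "x = mpoly_eval \<iota> \<psi> q" "mpoly_vars (q :: ('l, 'k) mpoly) \<subseteq> S - {s}"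
      "y = mpoly_eval \<iota> \<psi> q'" "mpoly_vars (q' :: ('l, 'k) mpoly) \<subseteq> S - {s}" by (auto simp: D_def)
    then show ?case unfolding D_def
      by (intro CollectI exI[of _ "q + q'"]) (simp add: ev'.hom_add mpoly_vars_add)
  next
    case (4 x y)
    then obtain q q' where "x = mpoly_eval \<iota> \<psi> q" "mpoly_vars (q :: ('l, 'k) mpoly) \<subseteq> S - {s}"
      "y = mpoly_eval \<iota> \<psi> q'" "mpoly_vars (q' :: ('l, 'k) mpoly) \<subseteq> S - {s}" by (auto simp: D_def)
    then show ?case unfolding D_def
      by (intro CollectI exI[of _ "q * q'"]) (simp add: ev'.hom_mult mpoly_vars_mult)
  qed
  have one: "1 \<in> D" using D by (simp add: is_subring_def)
  have "range \<iota> \<union> (\<psi> ` S - {z}) \<subseteq> {x / y | x y. x \<in> D \<and> y \<in> D}"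
  proof
    fix y assume y: "y \<in> range \<iota> \<union> (\<psi> ` S - {z})"
    have "y \<in> D"
    proof (cases "y \<in> range \<iota>")
      case True
      then obtain c where "y = \<iota> c" by blast
      then show ?thesis unfolding D_def
        by (intro CollectI exI[of _ "mconst c"]) (simp add: mpoly_eval_mconst[OF unital_\<iota>])
    next
      case False
      then obtain t where "t \<in> S" "t \<noteq> s" "y = \<psi> t" using y s by blast
      then show ?thesis unfolding D_def
        by (intro CollectI exI[of _ "mvar t"]) (simp add: mpoly_eval_mvar[OF unital_\<iota>])
    qed
    then show "y \<in> {x / y | x y. x \<in> D \<and> y \<in> D}" using one by (intro CollectI exI[of _ y] exI[of _ 1]) simp
  qed
  then have "gen_field (range \<iota> \<union> (\<psi> ` S - {z})) \<subseteq> {x / y | x y. x \<in> D \<and> y \<in> D}"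
    by (rule gen_field_min[OF is_subfield_fractions[OF D]])
  from algebraics_fractions[OF D cl[unfolded cl_def] this]
  obtain q where q: "q \<noteq> 0" "\<forall>i. coeff q i \<in> D" "poly q z = 0" by blast
  then obtain g :: "nat \<Rightarrow> ('l, 'k) mpoly" where g: "\<And>i. mpoly_vars (g i) \<subseteq> S - {s}" "\<And>i. coeff q i = mpoly_eval \<iota> \<psi> (g i)"
    unfolding D_def mem_Collect_eq by metis
  \<comment> \<open>The coefficients of \<open>q\<close> are lifted to polynomials in the other
    indeterminates. Independence makes the resulting relation zero, and uniqueness of its
    coefficients makes \<open>q\<close> zero.\<close>
  define G where "G = (\<Sum>i\<le>Polynomial.degree q. Polynomial.monom (g i) i)"
  have coeff_G: "coeff G i = (if i \<le> Polynomial.degree q then g i else 0)" for i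
    by (simp add: G_def coeff_sum)
  have G: "coeffs_in (S - {s}) G" using g(1) by (simp add: coeffs_in_def coeff_G)
  have "map_poly (mpoly_eval \<iota> \<psi>) G = q"
    by (rule poly_eqI) (simp add: ev'.hom_coeff coeff_G g(2)[symmetric] coeff_eq_0)
  then have "mpoly_eval \<iota> \<psi> (poly G (mvar s)) = 0"
    using q(3) s(2) by (simp add: ev'.hom_poly mpoly_eval_mvar[OF unital_\<iota>])
  moreover have "mpoly_vars (poly G (mvar s)) \<subseteq> S"
    using mpoly_vars_poly[OF G, of "mvar s" S] s(1) by auto
  ultimately have "poly G (mvar s) = 0" by (rule ind[rotated])
  then have "G = 0" using mpoly_univariate_unique[OF G] by blast
  then have "coeff q (Polynomial.degree q) = 0"
    using g(2)[of "Polynomial.degree q"] coeff_G[of "Polynomial.degree q"] by simp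
  then show False using q(1) by simp
qed

end

section \<open>The values of the nonleaders as a transcendence basis\<close>

context prime_kernel
begin

context
  fixes a :: "nat \<Rightarrow> 'u"
  assumes generic: "\<And>f. f \<in> dpoly \<Longrightarrow> ev (pt a) f = 0 \<longleftrightarrow> f \<in> P"
begin

abbreviation "nonleaders \<equiv> {v \<in> dvars m n. \<not> leader P v}"

text \<open>Induction on the rank: the value of a leader is a root of its minimal polynomial, whose
  coefficients take values in the closure by induction, and the closure is algebraically closed in
  the universal field.\<close>

lemma pt_in_cl: "v \<in> dvars m n \<Longrightarrow> pt a v \<in> cl (range \<iota> \<union> pt a ` nonleaders)"
proof (induction "rank v" arbitrary: v rule: less_induct)
  case less
  show ?case
  proof (cases "leader P v")
    case False
    then have "pt a v \<in> range \<iota> \<union> pt a ` nonleaders" using less.prems by blast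
    then show ?thesis using cl_incl[of "range \<iota> \<union> pt a ` nonleaders"] by (rule rev_subsetD)
  next
    case True
    then obtain G where G: "minimal_poly P v G" using exists_minimal_poly by blast
    let ?c = "cl (range \<iota> \<union> pt a ` nonleaders)"
    note K = is_subfieldD[OF is_subfield_cl[of "range \<iota> \<union> pt a ` nonleaders"]]
    have ev_c: "ev (pt a) f \<in> ?c" if "mpoly_vars f \<subseteq> low v" for f
      using that
    proof (induction f rule: mpoly_induct)
      case (const c) then show ?case using cl_incl[of "range \<iota> \<union> pt a ` nonleaders"] by (simp add: subset_iff)
    next
      case (var w) then show ?case using less.hyps[of w] by (simp add: below_def)
    qed (simp_all add: ev.hom_add ev.hom_mult K)
    define q where "q = map_poly (ev (pt a)) G"
    have G': "mpoly_vars (coeff G i) \<subseteq> low v" for i using G by (simp add: minimal_poly_def coeffs_in_def)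
    have "coeff q i \<in> ?c" for i by (simp add: q_def ev.hom_coeff ev_c G')
    moreover have "coeff q (Polynomial.degree G) \<noteq> 0"
      using generic[OF low_dpoly[OF G']] G by (simp add: q_def ev.hom_coeff minimal_poly_def)
    then have "q \<noteq> 0" by auto
    moreover have "poly q (pt a v) = 0"
      using generic[of "poly G (mvar v)"] G P_dpoly by (simp add: q_def minimal_poly_def ev.hom_poly)
    ultimately have "pt a v \<in> algebraics ?c" unfolding algebraics_def by blast
    then show ?thesis using algebraics_cl by blast
  qed
qed

lemma ev_in_cl:
  assumes "f \<in> dpoly"
  shows "ev (pt a) f \<in> cl (range \<iota> \<union> pt a ` nonleaders)"
proof -
  note K = is_subfieldD[OF is_subfield_cl[of "range \<iota> \<union> pt a ` nonleaders"]]
  have "mpoly_vars f \<subseteq> dvars m n" using assms by (simp add: dpolys_def)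
  then show ?thesis
  proof (induction f rule: mpoly_induct)
    case (const c) then show ?case using cl_incl[of "range \<iota> \<union> pt a ` nonleaders"] by (simp add: subset_iff)
  qed (simp_all add: ev.hom_add ev.hom_mult K pt_in_cl)
qed

text \<open>The highest variable of a relation among nonleaders is no leader, so all coefficients
  with respect to it lie in \<open>P\<close>; they involve lower nonleaders only and vanish by
  induction.\<close>

lemma nonleaders_independent:
  assumes "mpoly_vars f \<subseteq> nonleaders" "f \<in> P"
  shows "f = 0"
proof -
  have const: "g = 0" if g: "mpoly_vars g = {}" "g \<in> P" for g
  proof -
    obtain c where c: "g = mconst c" using mpoly_vars_empty[OF g(1)] by blast
    then have "\<iota> c = 0" using generic[of g] g(2) by (simp add: dpoly_closed)
    then show ?thesis using c by simp
  qed
  have "\<forall>g. mpoly_vars g \<subseteq> nonleaders \<inter> insert v (low v) \<and> g \<in> P \<longrightarrow> g = 0" if "v \<in> dvars m n" for v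
    using that
  proof (induction "rank v" arbitrary: v rule: less_induct)
    case less
    have low: "g = 0" if g: "mpoly_vars g \<subseteq> nonleaders \<inter> low v" "g \<in> P" for g
    proof (cases "mpoly_vars g = {}")
      case False
      then obtain u where u: "u \<in> mpoly_vars g" "mpoly_vars g \<subseteq> insert u (low u)"
        using mpoly_vars_max[of g m n] g(1) by blast
      then have "u \<in> low v" using g(1) by blast
      then have "rank u < rank v" "u \<in> dvars m n" by (auto simp: below_def)
      then show ?thesis using less.hyps u g by blast
    qed (use const g in blast)
    show ?case
    proof (intro allI impI, elim conjE)
      fix g assume g: "mpoly_vars g \<subseteq> nonleaders \<inter> insert v (low v)" "g \<in> P"
      show "g = 0"
      proof (cases "v \<in> mpoly_vars g")
        case False
        then show ?thesis using low g by blast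
      next
        case True
        then have v: "\<not> leader P v" using g(1) by blast
        have "mpoly_vars g \<subseteq> insert v (nonleaders \<inter> low v)" using g(1) by blast
        from mpoly_univariate[OF this]
        obtain G where G: "coeffs_in (nonleaders \<inter> low v) G" "g = poly G (mvar v)" by blast
        have "coeffs_in (low v) G" by (rule coeffs_in_mono[OF G(1)]) simp
        then have "\<forall>i. coeff G i \<in> P" using v less.prems g(2) G(2) by (auto simp: leader_def)
        then have "coeff G i = 0" for i using low G(1) by (simp add: coeffs_in_def)
        then have "G = 0" by (intro poly_eqI) simp
        then show ?thesis using G(2) by simp
      qed
    qed
  qed
  note upto = this
  show ?thesis
  proof (cases "mpoly_vars f = {}")
    case False
    then obtain u where "u \<in> mpoly_vars f" "mpoly_vars f \<subseteq> insert u (low u)"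
      using mpoly_vars_max[of f m n] assms(1) by blast
    then show ?thesis using upto[of u] assms by blast
  qed (use const assms in blast)
qed

lemma inj_pt_nonleaders: "inj_on (pt a) nonleaders"
proof (rule inj_onI)
  fix v w assume vw: "v \<in> nonleaders" "w \<in> nonleaders" "pt a v = pt a w"
  have "mvar v - mvar w \<in> P"
    using generic[of "mvar v - mvar w"] vw dpoly_closed(1)[of "mvar v" "- mvar w"]
    by (simp add: ev.hom_diff dpoly_closed)
  moreover have "mpoly_vars (mvar v - mvar w :: (dvar, 'k) mpoly) \<subseteq> nonleaders"
    using vw by (intro mpoly_vars_diff) auto
  ultimately have "(mvar v :: (dvar, 'k) mpoly) = mvar w" using nonleaders_independent by fastforce
  then have "mpoly_vars (mvar v :: (dvar, 'k) mpoly) = mpoly_vars (mvar w :: (dvar, 'k) mpoly)" by simp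
  then show "v = w" by simp
qed

end

end

section \<open>Irreducible components and their order\<close>

lemma ring_dpoly_ring:
  "ring (dpoly_ring m n :: (dvar, 'k::comm_ring_1) mpoly ring)"
proof -
  let ?R = "ring_of_type_algebra :: (dvar, 'k) mpoly ring"
  interpret R: ring ?R by (rule ring_from_type_algebra)
  have minus: "\<ominus>\<^bsub>?R\<^esub> f = - f" for f
    by (rule R.minus_equality) (auto simp: ring_of_type_algebra_def)
  have "subring (dpolys m n) ?R"
    by (rule R.subringI)
       (auto simp: minus dpolys_def, auto simp: ring_of_type_algebra_def mpoly_vars_def
         dest!: subsetD[OF keys_mult] subsetD[OF Poly_Mapping.keys_add])
  then show ?thesis unfolding dpoly_ring_def by (rule R.subring_is_ring)
qed

context differential_extension
begin

abbreviation "I \<equiv> vanishing_ideal m n \<iota> dU"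
abbreviation "Z \<equiv> zero_set m n \<iota> dU :: (dvar, 'k) mpoly set \<Rightarrow> (nat \<Rightarrow> 'u) set"

lemma Z_iff: "x \<in> Z \<Sigma> \<longleftrightarrow> x \<in> affine_space n \<and> (\<forall>f\<in>\<Sigma>. ev (pt x) f = 0)"
  by (simp add: zero_set_def dpoly_eval_eq)

lemma I_iff: "f \<in> I W \<longleftrightarrow> f \<in> dpoly \<and> (\<forall>x\<in>W. ev (pt x) f = 0)"
  by (simp add: vanishing_ideal_def dpoly_eval_eq)

lemma variety_insert:
  assumes "\<Sigma> \<subseteq> dpoly" "f \<in> dpoly"
  shows "diff_variety m n \<iota> dU (Z (insert f \<Sigma>))"
  unfolding diff_variety_def using assms by blast

lemma prime_dideal_I:
  assumes "irreducible_variety m n \<iota> dU W"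
  shows "prime_dideal (I W)"
proof -
  obtain \<Sigma> where \<Sigma>: "\<Sigma> \<subseteq> dpoly" "W = Z \<Sigma>"
    using assms unfolding irreducible_variety_def diff_variety_def by blast
  have irr: "W = W1 \<or> W = W2" if "diff_variety m n \<iota> dU W1" "diff_variety m n \<iota> dU W2" "W = W1 \<union> W2" for W1 W2
    using assms that unfolding irreducible_variety_def by blast
  have "W \<noteq> {}" using assms by (simp add: irreducible_variety_def)
  then have one: "1 \<notin> I W" by (auto simp: I_iff)
  have prime: "f \<in> I W \<or> g \<in> I W" if fg: "f \<in> dpoly" "g \<in> dpoly" "f * g \<in> I W" for f g
  proof -
    \<comment> \<open>Values lie in a field, so every point of \<open>W\<close> kills one of the
      factors; irreducibility then makes one factor vanish on all of \<open>W\<close>.\<close>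
    have "W = Z (insert f \<Sigma>) \<union> Z (insert g \<Sigma>)"
    proof (intro equalityI subsetI)
      fix x assume x: "x \<in> W"
      then have "ev (pt x) f * ev (pt x) g = 0" using fg(3) by (simp add: I_iff ev.hom_mult)
      then show "x \<in> Z (insert f \<Sigma>) \<union> Z (insert g \<Sigma>)" using x by (auto simp: \<Sigma>(2) Z_iff)
    qed (auto simp: \<Sigma>(2) Z_iff)
    then have "W = Z (insert f \<Sigma>) \<or> W = Z (insert g \<Sigma>)"
      by (rule irr[OF variety_insert[OF \<Sigma>(1) fg(1)] variety_insert[OF \<Sigma>(1) fg(2)]])
    then show ?thesis
    proof
      assume W: "W = Z (insert f \<Sigma>)"
      have "\<forall>x\<in>W. ev (pt x) f = 0" by (subst W) (simp add: Z_iff)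
      then show ?thesis using fg(1) by (simp add: I_iff)
    next
      assume W: "W = Z (insert g \<Sigma>)"
      have "\<forall>x\<in>W. ev (pt x) g = 0" by (subst W) (simp add: Z_iff)
      then show ?thesis using fg(2) by (simp add: I_iff)
    qed
  qed
  have dd: "dd k f \<in> I W" if "k \<in> {1..m}" "f \<in> I W" for k f
    using that derivation.deriv_zero[OF differential_field_type[OF dU that(1)]]
    by (simp add: I_iff ev_dd dpoly_closed del: atLeastAtMost_iff)
  show ?thesis
    unfolding prime_dideal_def
    using one prime dd by (auto simp: I_iff dpoly_closed ev.hom_add ev.hom_mult)
qed

text \<open>A variety containing a generic point of \<open>Q\<close> has its equations in
  \<open>Q\<close> and so contains all of \<open>Z Q\<close>; this gives irreducibility. The same
  point shows that nothing outside \<open>Q\<close> vanishes on \<open>Z Q\<close>.\<close>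

lemma irreducible_Z:
  assumes "prime_dideal Q"
  shows "irreducible_variety m n \<iota> dU (Z Q)" "I (Z Q) = Q"
proof -
  obtain b where b: "b \<in> affine_space n" "\<And>f. f \<in> dpoly \<Longrightarrow> ev (pt b) f = 0 \<longleftrightarrow> f \<in> Q"
    using realize_prime_dideal[OF assms] by blast
  have Q: "Q \<subseteq> dpoly" using assms by (simp add: prime_dideal_def)
  have bZ: "b \<in> Z Q" using b Q by (auto simp: Z_iff)
  have "f \<in> Q" if "f \<in> I (Z Q)" for f using that bZ b(2)[of f] by (auto simp: I_iff)
  moreover have "f \<in> I (Z Q)" if "f \<in> Q" for f using that Q by (auto simp: I_iff Z_iff)
  ultimately show "I (Z Q) = Q" by blast
  have cover: "Z Q \<subseteq> W" if W: "diff_variety m n \<iota> dU W" "b \<in> W" for W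
  proof -
    obtain \<Sigma> where \<Sigma>: "\<Sigma> \<subseteq> dpoly" "W = Z \<Sigma>" using W(1) unfolding diff_variety_def by blast
    have "ev (pt b) f = 0" if "f \<in> \<Sigma>" for f using W(2) that unfolding \<Sigma>(2) Z_iff by blast
    then have "\<Sigma> \<subseteq> Q" using \<Sigma>(1) b(2) by blast
    then show ?thesis unfolding \<Sigma>(2) using Z_iff by blast
  qed
  show "irreducible_variety m n \<iota> dU (Z Q)"
    unfolding irreducible_variety_def
  proof (intro conjI allI impI)
    show "diff_variety m n \<iota> dU (Z Q)" unfolding diff_variety_def using Q by blast
    show "Z Q \<noteq> {}" using bZ by blast
    fix W1 W2 assume "diff_variety m n \<iota> dU W1 \<and> diff_variety m n \<iota> dU W2 \<and> Z Q = W1 \<union> W2"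
    then show "Z Q = W1 \<or> Z Q = W2" using cover bZ by blast
  qed
qed

text \<open>\<open>Z Q\<close> is an irreducible variety between \<open>W\<close> and
  \<open>Z \<Sigma>\<close>, so it equals the component, and \<open>Q\<close> is recovered from its
  zeros.\<close>

lemma component_ideal_minimal:
  assumes comp: "irreducible_component m n \<iota> dU (Z \<Sigma>) W"
    and Q: "prime_dideal Q" "\<Sigma> \<subseteq> Q" "Q \<subseteq> I W"
  shows "I W = Q"
proof -
  have "irreducible_variety m n \<iota> dU W" using comp by (simp add: irreducible_component_def)
  then obtain \<Sigma>' where "W = Z \<Sigma>'" unfolding irreducible_variety_def diff_variety_def by blast
  then have "W \<subseteq> affine_space n" by (auto simp: Z_iff)
  then have "W \<subseteq> Z Q" using Q(3) by (auto simp: Z_iff I_iff subset_iff)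
  moreover have "Z Q \<subseteq> Z \<Sigma>" using Q(2) Z_iff by blast
  ultimately have "Z Q = W"
    using comp irreducible_Z(1)[OF Q(1)] unfolding irreducible_component_def by blast
  then show ?thesis using irreducible_Z(2)[OF Q(1)] by simp
qed

lemma component_leader_bound:
  assumes comp: "irreducible_component m n \<iota> dU (Z \<Sigma>) W"
    and \<Sigma>: "\<Sigma> \<subseteq> dpoly" "\<forall>f\<in>\<Sigma>. order_at_most m r f" and v: "leader (I W) v"
  shows "\<exists>\<alpha>. leader (I W) \<alpha> \<and> dvar_le \<alpha> v \<and> mdeg m (fst \<alpha>) \<le> C_number r m n"
proof -
  have P: "prime_dideal (I W)"
    using comp prime_dideal_I by (simp add: irreducible_component_def)
  interpret prime_kernel m n dK dU \<iota> "I W" by unfold_locales (rule P)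
  obtain a where a: "\<And>f. f \<in> dpoly \<Longrightarrow> ev (pt a) f = 0 \<longleftrightarrow> f \<in> I W"
    using realize_prime_dideal[OF P] by blast
  obtain \<alpha>s where \<alpha>s: "antichain_seq m n \<alpha>s" "set \<alpha>s = minimal_leaders"
    using antichain_imp_antichain_seq[OF antichain_minimal_leaders] by blast
  define p where "p = D_number r m n \<alpha>s"
  note D = D_number_props[OF \<alpha>s(1), of r, folded p_def]
  interpret truncated_kernel m n dK dU \<iota> "I W" a \<alpha>s p
    by unfold_locales (use a \<alpha>s(2) D(2) in auto)
  have "\<Sigma> \<subseteq> Q"
  proof
    fix f assume f: "f \<in> \<Sigma>"
    have "W \<subseteq> Z \<Sigma>" using comp by (simp add: irreducible_component_def)
    then have "f \<in> I W" using f \<Sigma>(1) by (auto simp: I_iff Z_iff)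
    \<comment> \<open>Here \<open>r \<le> p\<close> is used: the equations involve no derivative of
      order above \<open>p\<close>, so they survive the truncation.\<close>
    moreover have "mpoly_vars f \<subseteq> \<Gamma>"
      using f \<Sigma> D(1) by (fastforce simp: order_at_most_def dpolys_def Gamma_upto_def)
    ultimately show "f \<in> Q" by (rule P_Gamma_subset_Q)
  qed
  then have "I W = Q" by (rule component_ideal_minimal[OF comp prime_dideal_Q _ Q_subset_P])
  then have "v \<in> E" using leader_Q v by simp
  then obtain \<alpha> where \<alpha>: "\<alpha> \<in> A" "dvar_le \<alpha> v" unfolding E_def by blast
  then have "leader (I W) \<alpha>" "mdeg m (fst \<alpha>) \<le> p"
    by (auto simp: A_def minimal_leaders_def Gamma_upto_def)
  then show ?thesis using \<alpha>(2) D(3) by (meson le_trans)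
qed

end

context prime_kernel
begin

text \<open>By finiteness some pure power in direction \<open>k\<close> is a leader, and a leader of
  degree at most \<open>C\<close> below it is again a pure power in that direction. Any derivative
  with \<open>k\<close>-th entry at least \<open>C\<close> lies above it. So nonleaders sit in a box
  with \<open>C\<close> choices for each of \<open>m\<close> entries.\<close>

lemma nonleaders_bound:
  assumes C: "\<And>v. leader P v \<Longrightarrow> \<exists>\<alpha>. leader P \<alpha> \<and> dvar_le \<alpha> v \<and> mdeg m (fst \<alpha>) \<le> C"
    and fin: "finite {v \<in> dvars m n. \<not> leader P v}"
  shows "card {v \<in> dvars m n. \<not> leader P v} \<le> n * C ^ m"
proof -
  let ?N = "{v \<in> dvars m n. \<not> leader P v}"
  let ?f = "\<lambda>v :: dvar. (restrict (fst v) {1..m}, snd v)"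
  have small: "fst v k < C" if v: "v \<in> ?N" "k \<in> {1..m}" for v k
  proof (rule ccontr)
    assume "\<not> fst v k < C"
    define axis where "axis u = ((\<lambda>l. if l = k then u else 0), snd v)" for u :: nat
    have axis: "axis u \<in> dvars m n" for u
      using v by (auto simp: axis_def dvars_def multi_indices_def)
    have "inj axis" by (rule injI) (auto simp: axis_def dest: fun_cong[of _ _ k])
    then have "infinite (range axis)" using finite_imageD by blast
    then have "\<not> range axis \<subseteq> ?N" using fin finite_subset by blast
    then obtain u where "leader P (axis u)" using axis by blast
    then obtain \<alpha> where \<alpha>: "leader P \<alpha>" "dvar_le \<alpha> (axis u)" "mdeg m (fst \<alpha>) \<le> C" using C by blast
    have le: "fst \<alpha> l \<le> (if l = k then u else 0)" for l
      using \<alpha>(2) by (auto simp: dvar_le_def axis_def le_fun_def)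
    have "fst \<alpha> k \<le> mdeg m (fst \<alpha>)"
      unfolding mdeg_def using v(2) by (intro member_le_sum) auto
    then have "fst \<alpha> l \<le> fst v l" for l
      using le[of l] \<alpha>(3) \<open>\<not> fst v k < C\<close> by (cases "l = k") auto
    then have "dvar_le \<alpha> v" using \<alpha>(2) by (auto simp: dvar_le_def axis_def le_fun_def)
    then show False using leader_mono[OF \<alpha>(1)] v(1) by blast
  qed
  have "inj_on ?f ?N"
  proof (rule inj_onI)
    fix v w assume vw: "v \<in> ?N" "w \<in> ?N" "?f v = ?f w"
    have "fst v k = fst w k" for k
    proof (cases "k \<in> {1..m}")
      case True
      have "restrict (fst v) {1..m} k = restrict (fst w) {1..m} k" using vw(3) by simp
      then show ?thesis using True by simp
    next
      case False
      then show ?thesis using vw(1,2) by (auto simp: dvars_def multi_indices_def)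
    qed
    then show "v = w" using vw(3) by (auto simp: prod_eq_iff fun_eq_iff)
  qed
  moreover have "?f ` ?N \<subseteq> ({1..m} \<rightarrow>\<^sub>E {..<C}) \<times> {1..n}"
    using small by (fastforce simp: dvars_def)
  ultimately have "card ?N \<le> card (({1..m} \<rightarrow>\<^sub>E {..<C}) \<times> {1..n})"
    by (intro card_inj_on_le) (auto intro: finite_PiE)
  also have "\<dots> = n * C ^ m" by (simp add: card_cartesian_product card_funcsetE)
  finally show ?thesis .
qed

end

section \<open>The function field at a generic point\<close>

locale generic_kernel = prime_kernel m n dK dU \<iota> "vanishing_ideal m n \<iota> dU W"
  for m n :: nat and dK :: "nat \<Rightarrow> 'k::field_char_0 \<Rightarrow> 'k" and dU :: "nat \<Rightarrow> 'u::field_char_0 \<Rightarrow> 'u"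
    and \<iota> :: "'k \<Rightarrow> 'u" and W :: "(nat \<Rightarrow> 'u) set" +
  fixes a :: "nat \<Rightarrow> 'u"
  assumes generic: "f \<in> dpoly \<Longrightarrow> ev (pt a) f = 0 \<longleftrightarrow> f \<in> I W"
begin

abbreviation "R \<equiv> dpoly_ring m n :: (dvar, 'k) mpoly ring"
abbreviation "U \<equiv> ring_of_type_algebra :: 'u ring"

definition \<theta> :: "(dvar, 'k) mpoly set \<Rightarrow> 'u" where "\<theta> F = the_elem (ev (pt a) ` F)"

lemma ring_hom_ring_ev: "ring_hom_ring R U (ev (pt a))"
proof (rule ring_hom_ringI2[OF ring_dpoly_ring ring_from_type_algebra])
  show "ev (pt a) \<in> ring_hom R U"
    by (rule ring_hom_memI)
       (auto simp: dpoly_ring_def ring_of_type_algebra_def ev.hom_add ev.hom_mult)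
qed

lemma kernel_ev: "a_kernel R U (ev (pt a)) = I W"
  using generic P_dpoly by (auto simp: a_kernel_def' dpoly_ring_def ring_of_type_algebra_def)

lemma coordinate_ring_eq: "coordinate_ring m n \<iota> dU W = R Quot (a_kernel R U (ev (pt a)))"
  by (simp add: coordinate_ring_def kernel_ev)

lemma \<theta>_coset:
  assumes "f \<in> dpoly"
  shows "\<theta> (I W +>\<^bsub>R\<^esub> f) = ev (pt a) f"
proof -
  have "f \<in> carrier R" using assms by (simp add: dpoly_ring_def)
  from ring_hom_ring.the_elem_simp[OF ring_hom_ring_ev this] show ?thesis
    unfolding kernel_ev \<theta>_def .
qed

lemma carrier_coordinate_ring:
  "carrier (coordinate_ring m n \<iota> dU W) = {I W +>\<^bsub>R\<^esub> f | f. f \<in> dpoly}"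
  by (auto simp: coordinate_ring_def FactRing_def A_RCOSETS_def' dpoly_ring_def)

text \<open>The coordinate ring is the quotient by the kernel of evaluation at the generic point, so
  the isomorphism theorem embeds it into the universal field.\<close>

lemma frac_embedding_\<theta>: "frac_embedding (coordinate_ring m n \<iota> dU W) \<theta>"
proof -
  interpret h: ring_hom_ring R U "ev (pt a)" by (rule ring_hom_ring_ev)
  have ideal: "ideal (a_kernel R U (ev (pt a))) R" by (rule h.kernel_is_ideal)
  interpret C: ring "coordinate_ring m n \<iota> dU W"
    unfolding coordinate_ring_eq by (rule ideal.quotient_is_ring[OF ideal])
  have hom: "\<theta> \<in> ring_hom (coordinate_ring m n \<iota> dU W) U"
    unfolding coordinate_ring_eq \<theta>_def by (rule h.the_elem_hom)
  have inj: "inj_on \<theta> (carrier (coordinate_ring m n \<iota> dU W))"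
    unfolding coordinate_ring_eq \<theta>_def by (rule inj_onI) (rule h.the_elem_inj)
  have "\<theta> \<zero>\<^bsub>coordinate_ring m n \<iota> dU W\<^esub> = 0"
  proof -
    have "ev (pt a) ` I W = {0}" using generic P_dpoly P_zero by (auto simp: image_iff)
    then show ?thesis by (simp add: \<theta>_def coordinate_ring_def FactRing_def)
  qed
  then show ?thesis
    by (intro frac_embedding.intro)
       (use inj hom in \<open>auto simp: ring_hom_def ring_of_type_algebra_def\<close>)
qed

sublocale fe: frac_embedding "coordinate_ring m n \<iota> dU W" \<theta> by (rule frac_embedding_\<theta>)

lemma FF_eq: "fe.FF = function_field m n \<iota> dU W"
  by (simp add: function_field_def)

lemma const_function_in: "const_function m n \<iota> dU W c \<in> carrier fe.FF"
  and \<psi>_const_function: "fe.\<psi> (const_function m n \<iota> dU W c) = \<iota> c"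
proof -
  have c: "I W +>\<^bsub>R\<^esub> mconst c \<in> carrier (coordinate_ring m n \<iota> dU W)"
    unfolding carrier_coordinate_ring using dpoly_closed(4) by blast
  show "const_function m n \<iota> dU W c \<in> carrier fe.FF" "fe.\<psi> (const_function m n \<iota> dU W c) = \<iota> c"
    unfolding const_function_def mconst_def[symmetric]
    using c by (simp_all add: fe.\<psi>_fraction fe.nz_one fe.\<theta>_one \<theta>_coset dpoly_closed)
qed

lemma independent_iff:
  assumes "S \<subseteq> carrier fe.FF"
  shows "algebraically_independent fe.FF (const_function m n \<iota> dU W) S \<longleftrightarrow>
    (\<forall>q. mpoly_vars q \<subseteq> S \<and> mpoly_eval \<iota> fe.\<psi> q = 0 \<longrightarrow> q = 0)"
  using fe.algebraically_independent_iff[of "const_function m n \<iota> dU W" S] const_function_in assms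
  by (simp add: \<psi>_const_function)

lemma \<psi>_in_cl:
  assumes "s \<in> carrier fe.FF"
  shows "fe.\<psi> s \<in> cl (range \<iota> \<union> pt a ` nonleaders)"
proof -
  have \<theta>: "\<theta> x \<in> cl (range \<iota> \<union> pt a ` nonleaders)" if "x \<in> carrier (coordinate_ring m n \<iota> dU W)" for x
    using that ev_in_cl[OF generic] by (auto simp: carrier_coordinate_ring \<theta>_coset)
  obtain x y where xy: "x \<in> carrier (coordinate_ring m n \<iota> dU W)" "y \<in> fe.nz"
    "s = fraction (coordinate_ring m n \<iota> dU W) x y" using assms by (rule fe.FF_E)
  then show ?thesis
    using \<theta>[of x] \<theta>[of y] is_subfieldD(7)[OF is_subfield_cl] by (simp add: fe.\<psi>_fraction fe.nz_iff)
qed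

text \<open>The function field is algebraic over the values of the nonleaders, so the exchange
  argument bounds every independent set.\<close>

lemma card_independent_le:
  assumes fin: "finite nonleaders" and S: "finite S"
    "algebraically_independent fe.FF (const_function m n \<iota> dU W) S"
  shows "card S \<le> card nonleaders"
proof -
  have sub: "S \<subseteq> carrier fe.FF" using S(2) by (simp add: algebraically_independent_def)
  have inj: "inj_on fe.\<psi> S" by (rule inj_on_subset[OF fe.\<psi>_inj sub])
  have "cl_independent (range \<iota>) (fe.\<psi> ` S)"
    using independent_imp_cl_independent[of S fe.\<psi>] S(2) independent_iff[OF sub] by blast
  moreover have "fe.\<psi> ` S \<subseteq> cl (range \<iota> \<union> pt a ` nonleaders)" using \<psi>_in_cl sub by blast
  ultimately have "card (fe.\<psi> ` S) \<le> card (pt a ` nonleaders)"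
    using steinitz[of "fe.\<psi> ` S" "pt a ` nonleaders" "range \<iota>"] fin S(1) by blast
  also have "\<dots> \<le> card nonleaders" using fin by (rule card_image_le)
  finally show ?thesis by (simp add: card_image[OF inj])
qed

definition coord :: "dvar \<Rightarrow> ((dvar, 'k) mpoly set \<times> (dvar, 'k) mpoly set) set" where
  "coord v = fraction (coordinate_ring m n \<iota> dU W) (I W +>\<^bsub>R\<^esub> mvar v) \<one>\<^bsub>coordinate_ring m n \<iota> dU W\<^esub>"

lemma coord:
  assumes "v \<in> dvars m n"
  shows "coord v \<in> carrier fe.FF" "fe.\<psi> (coord v) = pt a v"
proof -
  have "I W +>\<^bsub>R\<^esub> mvar v \<in> carrier (coordinate_ring m n \<iota> dU W)"
    unfolding carrier_coordinate_ring using dpoly_closed(8)[OF assms] by blast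
  then show "coord v \<in> carrier fe.FF" "fe.\<psi> (coord v) = pt a v"
    using assms by (simp_all add: coord_def fe.\<psi>_fraction fe.nz_one fe.\<theta>_one \<theta>_coset dpoly_closed)
qed

lemma inj_coord: "inj_on coord nonleaders"
proof (rule inj_onI)
  fix v w assume "v \<in> nonleaders" "w \<in> nonleaders" "coord v = coord w"
  then have "pt a v = pt a w" using coord(2) by (metis (mono_tags, lifting) mem_Collect_eq)
  then show "v = w" using inj_onD[OF inj_pt_nonleaders[OF generic]] \<open>v \<in> nonleaders\<close> \<open>w \<in> nonleaders\<close> by blast
qed

lemma independent_coord:
  assumes "B \<subseteq> nonleaders"
  shows "algebraically_independent fe.FF (const_function m n \<iota> dU W) (coord ` B)"
proof -
  let ?S = "coord ` B"
  have sub: "?S \<subseteq> carrier fe.FF" using assms coord(1) by blast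
  define g where "g = inv_into B coord"
  have g: "g s \<in> B" "coord (g s) = s" if "s \<in> ?S" for s
    using that by (auto simp: g_def inv_into_into f_inv_into_f)
  have "q = 0" if q: "mpoly_vars q \<subseteq> ?S" "mpoly_eval \<iota> fe.\<psi> q = 0"
    for q :: "(((dvar, 'k) mpoly set \<times> (dvar, 'k) mpoly set) set, 'k) mpoly"
  proof -
    have mc: "unital_hom (mconst :: 'k \<Rightarrow> (dvar, 'k) mpoly)" by (rule unital_hom_mconst)
    have mc': "unital_hom (mconst :: 'k \<Rightarrow> (((dvar, 'k) mpoly set \<times> (dvar, 'k) mpoly set) set, 'k) mpoly)"
      by (rule unital_hom_mconst)
    \<comment> \<open>Independence speaks of polynomials whose indeterminates are elements of the
      function field. They are renamed to derivatives and back, which loses nothing because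
      \<open>g\<close> inverts \<open>coord\<close>.\<close>
    let ?ren = "mpoly_eval mconst (\<lambda>s. mvar (g s)) :: (((dvar, 'k) mpoly set \<times> (dvar, 'k) mpoly set) set, 'k) mpoly \<Rightarrow> (dvar, 'k) mpoly"
    let ?back = "mpoly_eval mconst (\<lambda>v. mvar (coord v)) :: (dvar, 'k) mpoly \<Rightarrow> _"
    have "mpoly_vars (?ren q) \<subseteq> B \<and> ev (pt a) (?ren q) = mpoly_eval \<iota> fe.\<psi> q \<and> ?back (?ren q) = q"
      using q(1)
    proof (induction q rule: mpoly_induct)
      case (const c)
      then show ?case
        by (simp add: mpoly_eval_mconst[OF mc] mpoly_eval_mconst[OF mc'] mpoly_eval_mconst[OF unital_\<iota>])
    next
      case (var s)
      have "pt a (g s) = fe.\<psi> s" using coord(2)[of "g s"] g[OF var] assms by auto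
      then show ?case using g[OF var]
        by (simp add: mpoly_eval_mvar[OF mc] mpoly_eval_mvar[OF mc'] mpoly_eval_mvar[OF unital_\<iota>])
    next
      case (add p q)
      then show ?case
        by (simp add: mpoly_eval_add[OF mc] mpoly_eval_add[OF mc'] mpoly_eval_add[OF unital_\<iota>] mpoly_vars_add)
    next
      case (mult p q)
      then show ?case
        by (simp add: mpoly_eval_mult[OF mc] mpoly_eval_mult[OF mc'] mpoly_eval_mult[OF unital_\<iota>] mpoly_vars_mult)
    qed
    then have ren: "mpoly_vars (?ren q) \<subseteq> B" "ev (pt a) (?ren q) = 0" "?back (?ren q) = q" using q(2) by auto
    have "?ren q \<in> dpoly" using ren(1) assms by (intro dpolyI) blast
    then have "?ren q \<in> I W" using generic ren(2) by blast
    then have "?ren q = 0" using nonleaders_independent[OF generic _ , of "?ren q"] ren(1) assms by blast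
    then have "q = ?back 0" using ren(3) by simp
    also have "\<dots> = 0" by (simp add: unital_hom.hom_zero[OF unital_hom_mpoly_eval[OF mc']])
    finally show ?thesis .
  qed
  then show ?thesis using independent_iff[OF sub] by blast
qed

lemma card_nonleaders_le:
  assumes "finite B" "B \<subseteq> nonleaders"
  shows "enat (card B) \<le> variety_order m n \<iota> dU W"
proof -
  have "card (coord ` B) = card B" by (rule card_image[OF inj_on_subset[OF inj_coord assms(2)]])
  moreover have "algebraically_independent (function_field m n \<iota> dU W) (const_function m n \<iota> dU W) (coord ` B)"
    using independent_coord[OF assms(2)] by (simp add: FF_eq)
  ultimately show ?thesis
    unfolding variety_order_def trdeg_def using assms(1)
    by (intro Sup_upper CollectI exI[of _ "coord ` B"]) auto
qed

text \<open>Nonleaders give independent coordinate functions, so infinitely many of them would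
  exceed any finite order. This is where finite order becomes the finiteness behind the box
  count.\<close>

lemma finite_nonleaders:
  assumes "variety_order m n \<iota> dU W < \<infinity>"
  shows "finite nonleaders"
proof (rule ccontr)
  assume inf: "infinite nonleaders"
  obtain d where d: "variety_order m n \<iota> dU W = enat d" using assms by auto
  obtain B where "finite B" "card B = Suc d" "B \<subseteq> nonleaders"
    using infinite_arbitrarily_large[OF inf] by blast
  then have "enat (Suc d) \<le> enat d" using card_nonleaders_le[of B] d by simp
  then show False by simp
qed

lemma variety_order_le:
  assumes "finite nonleaders"
  shows "variety_order m n \<iota> dU W \<le> enat (card nonleaders)"
  unfolding variety_order_def trdeg_def
  by (rule Sup_least) (use card_independent_le[OF assms] in \<open>auto simp: FF_eq\<close>)

end

theorem proposition42:
  fixes m n r :: nat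
    and dK :: "nat \<Rightarrow> 'k::field_char_0 \<Rightarrow> 'k"
    and dU :: "nat \<Rightarrow> 'u::field_char_0 \<Rightarrow> 'u"
    and \<iota> :: "'k \<Rightarrow> 'u"
    and \<Sigma> :: "(dvar, 'k) mpoly set"
    and V W :: "(nat \<Rightarrow> 'u) set"
  assumes "m \<ge> 1" and "n \<ge> 1"
    and "differential_field (ring_of_type_algebra :: 'k ring) m dK"
    and "universal_extension m (ring_of_type_algebra :: 'k ring) dK
           (ring_of_type_algebra :: 'u ring) dU \<iota>"
    and "\<Sigma> \<subseteq> dpolys m n" and "\<forall>f\<in>\<Sigma>. order_at_most m r f"
    and "V = zero_set m n \<iota> dU \<Sigma>"
    and "irreducible_component m n \<iota> dU V W"
    and "variety_order m n \<iota> dU W < \<infinity>"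
  shows "variety_order m n \<iota> dU W \<le> enat (n * C_number r m n ^ m)"
proof -
  interpret differential_extension m n dK dU \<iota>
    by (rule differential_extension.intro) (use assms(3,4) in auto)
  have comp: "irreducible_component m n \<iota> dU (Z \<Sigma>) W" using assms(7,8) by simp
  then have P: "prime_dideal (I W)" using prime_dideal_I by (simp add: irreducible_component_def)
  obtain a where a: "\<And>f. f \<in> dpoly \<Longrightarrow> ev (pt a) f = 0 \<longleftrightarrow> f \<in> I W"
    using realize_prime_dideal[OF P] by blast
  interpret generic_kernel m n dK dU \<iota> W a by unfold_locales (use P a in auto)
  have fin: "finite nonleaders" by (rule finite_nonleaders[OF assms(9)])
  have "variety_order m n \<iota> dU W \<le> enat (card nonleaders)" by (rule variety_order_le[OF fin])
  also have "card nonleaders \<le> n * C_number r m n ^ m"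
    using nonleaders_bound[OF component_leader_bound[OF comp assms(5,6)] fin] by simp
  finally show ?thesis by simp
qed

end
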